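(* Let $n\ge 1$. For each $i=0,\dots,n-1$, let $S_i$ be the set of all finite binary fractions from the unit interval $[0,1]$ with sums of digits equal to $i$ modulo $n$. Then Jones' $n$-subgroup $\overrightarrow{F}_n$ (the set of all reduced $n$-good diagrams in R. Thompson's group $F$) is the intersection of the stabilizers of $S_i$, $i=0,\dots,n-1$, under the natural action of $F$ on $[0,1]$.
   Context: $F$ is the group of all piecewise-linear increasing homeomorphisms of $[0,1]$ with all slopes powers of $2$ and all break points of the derivative dyadic fractions; products are composed from left to right. The sum of digits of a finite binary fraction is the sum of the digits of its finite binary expansion. The stabilizer of $S\subseteq[0,1]$ is $\{g\in F:g(S)=S\}$. Diagrams: the cell $\pi$ is the plane directed graph whose top path is one edge and whose bottom path consists of two edges, with the same initial and terminal vertices (all edges are directed left to right). Diagrams over $\langle x\mid x=x^2\rangle$ are the plane graphs (up to isotopy) obtained from the single edge $\mathbf 1$ and from $\pi$ by addition $\Delta_1+\Delta_2$ (identify the terminal vertex of $\Delta_1$ with the initial vertex of $\Delta_2$), multiplication $\Delta_1\circ\Delta_2$ (identify the bottom path of $\Delta_1$ with the top path of $\Delta_2$ when they have the same length), and inversion (reflection in a horizontal line). A diagram $\Delta$ has an initial vertex $\iota(\Delta)$ and a terminal vertex $\tau(\Delta)$; the other vertices are called inner. A dipole is a subdiagram $\pi\circ\pi^{-1}$ or $\pi^{-1}\circ\pi$; it is eliminated by removing its two cells and identifying its top and bottom paths. A diagram is reduced if it has no dipoles; each diagram is equivalent via dipole moves to a unique reduced diagram. "Diagrams in $F$" are those whose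 top path and bottom path are single edges; reduced such diagrams, with product = reduced form of $\Delta_1\circ\Delta_2$, form a group identified with $F$ as follows. A reduced $\Delta$ is cut by its longest positive path from $\iota(\Delta)$ to $\tau(\Delta)$ as $\Delta=\Delta^+\circ\Delta^-$, where $\Delta^+$ consists of cells $\pi$ and $\Delta^-$ of cells $\pi^{-1}$. Assign $[0,1]$ to the top edge of $\Delta^+$ and, for each cell, the left and right halves of the interval of its top edge to its left and right bottom edges; the bottom path of $\Delta^+$ gives a dyadic subdivision of $[0,1]$ (top subdivision). Doing the same with $(\Delta^-)^{-1}$ gives the bottom subdivision. $\Delta$ corresponds to the homeomorphism mapping each segment of the top subdivision linearly onto the corresponding segment of the bottom subdivision. Thompson graph $T(\Delta)$: its vertices are all vertices of $\Delta$ except $\tau(\Delta)$; its edges are, for every inner vertex $v$ of $\Delta$, the top-most incoming edge of $v$ in $\Delta$ (upper edge) and the bottom-most incoming edge of $v$ in $\Delta$ (lower edge), counted as two distinct edges if they coincide. The top (resp. bottom) path from $\iota(\Delta)$ to an inner vertex $v$ is the unique positive (left-to-right) path in $T(\Delta)$ from $\iota(\Delta)$ to $v$ composed entirely of upper (resp. lower) edges. $\Delta$ is $n$-good if for every inner vertex $v$ the lengths of the top path and of the bottom path from $\iota(\Delta)$ to $v$ are equal modulo $n$. $\overrightarrow{F}_n$ is the set of all reduced $n$-good diagrams in $F$. *)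

theory Defs
  imports
    "HOL-Analysis.Analysis"
    "HOL-Algebra.Group_Action"
    "HOL-Number_Theory.Cong"
    "Graph_Theory.Arc_Walk"
begin

section \<open>Thompson's group\<close>

definition dyadics :: "real set" where
  "dyadics = {of_int m / 2 ^ k | (m::int) (k::nat). True}"

text \<open>A homeomorphism of \<open>[0,1]\<close> is a function on the reals that is the identity outside
  \<open>[0,1]\<close>, so that equality of functions is equality of homeomorphisms. The list \<open>xs\<close> is
  a dyadic subdivision of \<open>[0,1]\<close> containing all the break points.\<close>

definition thompson_homeos :: "(real \<Rightarrow> real) set" where
  "thompson_homeos = {f.
     (\<forall>x. x \<notin> {0..1} \<longrightarrow> f x = x) \<and>
     (\<exists>g. homeomorphism {0..1} {0..1} f g) \<and>
     strict_mono_on {0..1} f \<and>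
     (\<exists>xs. xs \<noteq> [] \<and> hd xs = 0 \<and> last xs = 1 \<and> sorted_wrt (<) xs \<and> set xs \<subseteq> dyadics \<and>
        (\<forall>i. Suc i < length xs \<longrightarrow>
           (\<exists>(k::int) c. \<forall>x\<in>{xs ! i..xs ! Suc i}. f x = 2 powi k * x + c)))}"

text \<open>Products are composed from left to right.\<close>

definition thompson_F :: "(real \<Rightarrow> real) monoid" where
  "thompson_F = \<lparr>carrier = thompson_homeos, mult = (\<lambda>f g. g \<circ> f), one = id\<rparr>"

text \<open>\<open>ds ! 0\<close> is the units digit and \<open>ds ! j\<close> is the \<open>j\<close>-th digit after the binary
  point. Finite expansions of a number in \<open>[0,1]\<close> differ only by trailing zeros.\<close>

definition finite_binary_expansion :: "nat list \<Rightarrow> real \<Rightarrow> bool" where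
  "finite_binary_expansion ds x \<longleftrightarrow>
     set ds \<subseteq> {0, 1} \<and> x = (\<Sum>j<length ds. real (ds ! j) / 2 ^ j)"

definition digit_class :: "nat \<Rightarrow> nat \<Rightarrow> real set" where
  "digit_class n i =
     {x \<in> {0..1}. \<exists>ds. finite_binary_expansion ds x \<and> [sum_list ds = i] (mod n)}"

section \<open>Diagrams\<close>

datatype edge = Edge (label: nat) (source: nat) (target: nat)

text \<open>A plane diagram is recorded, up to isotopy, by its vertices, edges, cells, top path and
  bottom path. A cell is given by its top path and its bottom path, both read from left to right.
  Vertex names and edge labels carry no meaning.\<close>

record diagram =
  vertices :: "nat set"
  edges :: "edge set"
  cells :: "(edge list \<times> edge list) set"
  top_path :: "edge list"
  bot_path :: "edge list"

definition initial_vertex :: "diagram \<Rightarrow> nat" where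
  "initial_vertex \<Delta> = source (hd (top_path \<Delta>))"

definition terminal_vertex :: "diagram \<Rightarrow> nat" where
  "terminal_vertex \<Delta> = target (last (top_path \<Delta>))"

definition inner_vertices :: "diagram \<Rightarrow> nat set" where
  "inner_vertices \<Delta> = vertices \<Delta> - {initial_vertex \<Delta>, terminal_vertex \<Delta>}"

definition edge_diagram :: "edge \<Rightarrow> diagram" where
  "edge_diagram e = \<lparr>vertices = {source e, target e}, edges = {e}, cells = {},
     top_path = [e], bot_path = [e]\<rparr>"

definition cell_diagram :: "edge \<Rightarrow> edge \<Rightarrow> edge \<Rightarrow> diagram" where
  "cell_diagram e f g = \<lparr>vertices = {source e, target f, target e}, edges = {e, f, g},
     cells = {([e], [f, g])}, top_path = [e], bot_path = [f, g]\<rparr>"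

definition diagram_sum :: "diagram \<Rightarrow> diagram \<Rightarrow> diagram" where
  "diagram_sum \<Delta>1 \<Delta>2 = \<lparr>vertices = vertices \<Delta>1 \<union> vertices \<Delta>2, edges = edges \<Delta>1 \<union> edges \<Delta>2,
     cells = cells \<Delta>1 \<union> cells \<Delta>2,
     top_path = top_path \<Delta>1 @ top_path \<Delta>2, bot_path = bot_path \<Delta>1 @ bot_path \<Delta>2\<rparr>"

definition diagram_comp :: "diagram \<Rightarrow> diagram \<Rightarrow> diagram" where
  "diagram_comp \<Delta>1 \<Delta>2 = \<lparr>vertices = vertices \<Delta>1 \<union> vertices \<Delta>2, edges = edges \<Delta>1 \<union> edges \<Delta>2,
     cells = cells \<Delta>1 \<union> cells \<Delta>2,
     top_path = top_path \<Delta>1, bot_path = bot_path \<Delta>2\<rparr>"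

definition diagram_inv :: "diagram \<Rightarrow> diagram" where
  "diagram_inv \<Delta> = \<lparr>vertices = vertices \<Delta>, edges = edges \<Delta>, cells = prod.swap ` cells \<Delta>,
     top_path = bot_path \<Delta>, bot_path = top_path \<Delta>\<rparr>"

definition path_vertices :: "edge list \<Rightarrow> nat set" where
  "path_vertices p = source ` set p \<union> target ` set p"

text \<open>Identification of vertices and edges is expressed by sharing names: two diagrams are glued
  when their names have been chosen so that they share exactly the parts to be identified. Since
  the base cases below admit all names, any sum, and any product along paths of the same length,
  can be formed after renaming.\<close>

definition summable_diagrams :: "diagram \<Rightarrow> diagram \<Rightarrow> bool" where
  "summable_diagrams \<Delta>1 \<Delta>2 \<longleftrightarrow>
     terminal_vertex \<Delta>1 = initial_vertex \<Delta>2 \<and>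
     vertices \<Delta>1 \<inter> vertices \<Delta>2 = {terminal_vertex \<Delta>1} \<and>
     edges \<Delta>1 \<inter> edges \<Delta>2 = {}"

definition composable_diagrams :: "diagram \<Rightarrow> diagram \<Rightarrow> bool" where
  "composable_diagrams \<Delta>1 \<Delta>2 \<longleftrightarrow>
     bot_path \<Delta>1 = top_path \<Delta>2 \<and>
     vertices \<Delta>1 \<inter> vertices \<Delta>2 = path_vertices (bot_path \<Delta>1) \<and>
     edges \<Delta>1 \<inter> edges \<Delta>2 = set (bot_path \<Delta>1)"

inductive_set diagrams :: "diagram set" where
  one: "source e \<noteq> target e \<Longrightarrow> edge_diagram e \<in> diagrams"
| cell: "\<lbrakk>source f = source e; target f = source g; target g = target e;
          distinct [source e, target f, target e]\<rbrakk> \<Longrightarrow> cell_diagram e f g \<in> diagrams"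
| sum: "\<lbrakk>\<Delta>1 \<in> diagrams; \<Delta>2 \<in> diagrams; summable_diagrams \<Delta>1 \<Delta>2\<rbrakk>
        \<Longrightarrow> diagram_sum \<Delta>1 \<Delta>2 \<in> diagrams"
| comp: "\<lbrakk>\<Delta>1 \<in> diagrams; \<Delta>2 \<in> diagrams; composable_diagrams \<Delta>1 \<Delta>2\<rbrakk>
        \<Longrightarrow> diagram_comp \<Delta>1 \<Delta>2 \<in> diagrams"
| inv: "\<Delta> \<in> diagrams \<Longrightarrow> diagram_inv \<Delta> \<in> diagrams"

definition positive_cell :: "edge list \<times> edge list \<Rightarrow> bool" where
  "positive_cell c \<longleftrightarrow> (\<exists>e f g. c = ([e], [f, g]))"

definition negative_cell :: "edge list \<times> edge list \<Rightarrow> bool" where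
  "negative_cell c \<longleftrightarrow> (\<exists>e f g. c = ([f, g], [e]))"

definition has_dipole :: "diagram \<Rightarrow> bool" where
  "has_dipole \<Delta> \<longleftrightarrow>
     (\<exists>e f g e'. ([e], [f, g]) \<in> cells \<Delta> \<and> ([f, g], [e']) \<in> cells \<Delta>) \<or>
     (\<exists>f g e f' g'. ([f, g], [e]) \<in> cells \<Delta> \<and> ([e], [f', g']) \<in> cells \<Delta>)"

definition reduced_F_diagrams :: "diagram set" where
  "reduced_F_diagrams =
     {\<Delta> \<in> diagrams. length (top_path \<Delta>) = 1 \<and> length (bot_path \<Delta>) = 1 \<and> \<not> has_dipole \<Delta>}"

definition diagram_digraph :: "diagram \<Rightarrow> (nat, edge) pre_digraph" where
  "diagram_digraph \<Delta> = \<lparr>verts = vertices \<Delta>, arcs = edges \<Delta>, tail = source, head = target\<rparr>"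

section \<open>Homeomorphisms represented by reduced diagrams\<close>

definition longest_positive_path :: "diagram \<Rightarrow> edge list \<Rightarrow> bool" where
  "longest_positive_path \<Delta> p \<longleftrightarrow>
     pre_digraph.awalk (diagram_digraph \<Delta>) (initial_vertex \<Delta>) p (terminal_vertex \<Delta>) \<and>
     (\<forall>q. pre_digraph.awalk (diagram_digraph \<Delta>) (initial_vertex \<Delta>) q (terminal_vertex \<Delta>)
        \<longrightarrow> length q \<le> length p)"

definition cut_diagram :: "diagram \<Rightarrow> diagram \<Rightarrow> diagram \<Rightarrow> bool" where
  "cut_diagram \<Delta> \<Delta>p \<Delta>m \<longleftrightarrow>
     \<Delta>p \<in> diagrams \<and> \<Delta>m \<in> diagrams \<and> composable_diagrams \<Delta>p \<Delta>m \<and>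
     \<Delta> = diagram_comp \<Delta>p \<Delta>m \<and> longest_positive_path \<Delta> (bot_path \<Delta>p) \<and>
     (\<forall>c\<in>cells \<Delta>p. positive_cell c) \<and> (\<forall>c\<in>cells \<Delta>m. negative_cell c)"

text \<open>\<open>edge_interval \<Delta> e a b\<close>: the interval assigned to the edge \<open>e\<close> is \<open>[a,b]\<close>.\<close>

inductive edge_interval :: "diagram \<Rightarrow> edge \<Rightarrow> real \<Rightarrow> real \<Rightarrow> bool" for \<Delta> where
  top: "top_path \<Delta> = [e] \<Longrightarrow> edge_interval \<Delta> e 0 1"
| left: "\<lbrakk>edge_interval \<Delta> e a b; ([e], [f, g]) \<in> cells \<Delta>\<rbrakk>
         \<Longrightarrow> edge_interval \<Delta> f a ((a + b) / 2)"
| right: "\<lbrakk>edge_interval \<Delta> e a b; ([e], [f, g]) \<in> cells \<Delta>\<rbrakk>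
         \<Longrightarrow> edge_interval \<Delta> g ((a + b) / 2) b"

text \<open>The same edge of the cutting path carries an interval of the top subdivision (from
  \<open>\<Delta>p\<close>) and the corresponding interval of the bottom subdivision (from the inverse of
  \<open>\<Delta>m\<close>).\<close>

definition represents :: "diagram \<Rightarrow> (real \<Rightarrow> real) \<Rightarrow> bool" where
  "represents \<Delta> h \<longleftrightarrow>
     (\<forall>x. x \<notin> {0..1} \<longrightarrow> h x = x) \<and>
     (\<exists>\<Delta>p \<Delta>m. cut_diagram \<Delta> \<Delta>p \<Delta>m \<and>
        (\<forall>e\<in>set (bot_path \<Delta>p). \<exists>a b c d.
           edge_interval \<Delta>p e a b \<and> edge_interval (diagram_inv \<Delta>m) e c d \<and>
           (\<forall>x\<in>{a..b}. h x = c + (d - c) / (b - a) * (x - a))))"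

section \<open>Thompson graphs and Jones' subgroups\<close>

definition incoming_edges :: "diagram \<Rightarrow> nat \<Rightarrow> edge set" where
  "incoming_edges \<Delta> v = {e \<in> edges \<Delta>. target e = v}"

text \<open>Two consecutive incoming edges of an inner vertex, in the order from top to bottom, are the
  last edges of the top path and of the bottom path of the cell between them.\<close>

definition directly_above :: "diagram \<Rightarrow> (edge \<times> edge) set" where
  "directly_above \<Delta> = {(last p, last q) | p q. (p, q) \<in> cells \<Delta>}"

definition topmost_incoming :: "diagram \<Rightarrow> nat \<Rightarrow> edge \<Rightarrow> bool" where
  "topmost_incoming \<Delta> v e \<longleftrightarrow> e \<in> incoming_edges \<Delta> v \<and>
     (\<forall>e'\<in>incoming_edges \<Delta> v. (e, e') \<in> (directly_above \<Delta>)\<^sup>*)"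

definition bottommost_incoming :: "diagram \<Rightarrow> nat \<Rightarrow> edge \<Rightarrow> bool" where
  "bottommost_incoming \<Delta> v e \<longleftrightarrow> e \<in> incoming_edges \<Delta> v \<and>
     (\<forall>e'\<in>incoming_edges \<Delta> v. (e', e) \<in> (directly_above \<Delta>)\<^sup>*)"

datatype level = Upper | Lower

definition thompson_graph :: "diagram \<Rightarrow> (nat, level \<times> edge) pre_digraph" where
  "thompson_graph \<Delta> =
     \<lparr>verts = vertices \<Delta> - {terminal_vertex \<Delta>},
      arcs = {(Upper, e) | e v. v \<in> inner_vertices \<Delta> \<and> topmost_incoming \<Delta> v e} \<union>
             {(Lower, e) | e v. v \<in> inner_vertices \<Delta> \<and> bottommost_incoming \<Delta> v e},
      tail = (\<lambda>(l, e). source e), head = (\<lambda>(l, e). target e)\<rparr>"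

definition level_path :: "diagram \<Rightarrow> level \<Rightarrow> nat \<Rightarrow> (level \<times> edge) list \<Rightarrow> bool" where
  "level_path \<Delta> l v p \<longleftrightarrow>
     pre_digraph.awalk (thompson_graph \<Delta>) (initial_vertex \<Delta>) p v \<and> (\<forall>a\<in>set p. fst a = l)"

definition n_good :: "nat \<Rightarrow> diagram \<Rightarrow> bool" where
  "n_good n \<Delta> \<longleftrightarrow> (\<forall>v\<in>inner_vertices \<Delta>.
     \<exists>p q. level_path \<Delta> Upper v p \<and> level_path \<Delta> Lower v q \<and> [length p = length q] (mod n))"

definition jones_diagrams :: "nat \<Rightarrow> diagram set" where
  "jones_diagrams n = {\<Delta> \<in> reduced_F_diagrams. n_good n \<Delta>}"

text \<open>The subset of Thompson's group identified with the set of reduced \<open>n\<close>-good diagrams.\<close>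

definition jones_subgroup :: "nat \<Rightarrow> (real \<Rightarrow> real) set" where
  "jones_subgroup n = {h. \<exists>\<Delta>\<in>jones_diagrams n. represents \<Delta> h}"

end

theory Submission
  imports Defs
begin

text \<open>A diagram of \<open>F\<close>, cut along its longest positive path, is a pair of binary trees \<open>T\<close>
  and \<open>U\<close> glued along their leaves: \<open>T\<close> consists of the positive cells and \<open>U\<close> is the
  inverse of the negative part (\<open>diagram_of_one_sign_is_forest\<close>, \<open>represents_tree_pair\<close>). The
  edges of either tree carry dyadic intervals \<open>[m / 2 ^ k, (m + 1) / 2 ^ k]\<close>, so each vertex has a
  position in \<open>T\<close> and a position in \<open>U\<close>, both dyadic fractions.

  An inner vertex \<open>v\<close> is the midpoint of an interval \<open>[m / 2 ^ k, (m + 1) / 2 ^ k]\<close> that is split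
  in \<open>T\<close>, and its topmost incoming edge is the left half of that interval. Walking back along this
  edge leads from \<open>(2 * m + 1) / 2 ^ (k + 1)\<close> to \<open>m / 2 ^ k\<close>, that is, it erases the last digit 1.
  So the length of the top path to \<open>v\<close> is the sum of the binary digits of the position of \<open>v\<close>
  in \<open>T\<close>, and by reflection the length of the bottom path is the sum for the position in \<open>U\<close>
  (\<open>level_path_length\<close>). The diagram is \<open>n\<close>-good if and only if corresponding points of the top
  and bottom subdivisions have congruent sums of digits (\<open>n_good_pair_diagram\<close>).

  On a leaf with intervals starting at \<open>m / 2 ^ k\<close> and \<open>m' / 2 ^ k'\<close> the homeomorphism replaces
  the prefix \<open>m\<close> of a binary expansion by the prefix \<open>m'\<close> and keeps the remaining digits. If the
  sums of the two prefixes are congruent on every leaf, then all the classes \<open>digit_class n i\<close> are preserved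
  (\<open>digit_class_affine_image\<close>, \<open>jones_subgroup_stabilizes\<close>). Conversely, a homeomorphism that
  preserves the classes has congruent sums at the ends of the leaves of any of its diagrams.

  What remains is a reduced diagram for a given homeomorphism \<open>h\<close>
  (\<open>thompson_homeo_tree_pair\<close>). Let \<open>T\<close> be obtained by halving \<open>[0,1]\<close> until \<open>h\<close> maps each
  piece affinely onto a dyadic interval, and let \<open>U\<close> be obtained in the same way from the inverse
  of \<open>h\<close>. The leaves of \<open>T\<close> are the maximal intervals that are so mapped; \<open>h\<close> carries them to the
  corresponding maximal intervals of its inverse, and a tiling by maximal intervals is unique, so
  the leaves of \<open>T\<close> correspond to those of \<open>U\<close>. A dipole would consist of two sibling leaves
  whose images are siblings; then \<open>h\<close> would map their parent affinely onto a dyadic interval, and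
  the parent would not have been halved (\<open>pair_diagram_reduced\<close>).\<close>

section \<open>Sums of binary digits\<close>

fun digit_sum :: "nat \<Rightarrow> nat" where
  "digit_sum m = (if m = 0 then 0 else m mod 2 + digit_sum (m div 2))"

declare digit_sum.simps [simp del]

lemma digit_sum_0 [simp]: "digit_sum 0 = 0"
  by (simp add: digit_sum.simps)

lemma digit_sum_double [simp]: "digit_sum (2 * m) = digit_sum m"
  by (cases "m = 0") (simp_all add: digit_sum.simps [of "2 * m"])

lemma digit_sum_double_plus_one [simp]: "digit_sum (Suc (2 * m)) = Suc (digit_sum m)"
  by (simp add: digit_sum.simps [of "Suc (2 * m)"])

text \<open>The binary digits of \<open>m * 2 ^ j + r\<close> are those of \<open>m\<close> followed by the \<open>j\<close> digits of \<open>r\<close>.\<close>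

lemma digit_sum_append:
  assumes "r < 2 ^ j"
  shows "digit_sum (m * 2 ^ j + r) = digit_sum m + digit_sum r"
  using assms
proof (induction j arbitrary: r)
  case 0
  then show ?case by simp
next
  case (Suc j)
  define q where "q = m * 2 ^ j + r div 2"
  have q: "digit_sum q = digit_sum m + digit_sum (r div 2)"
    unfolding q_def using Suc.prems by (intro Suc.IH) auto
  have eq: "m * 2 ^ Suc j + r = 2 * q + r mod 2"
    unfolding q_def by (simp add: algebra_simps)
  have r: "digit_sum r = digit_sum (r div 2) + r mod 2"
    by (cases "r = 0") (simp_all add: digit_sum.simps [of r])
  show ?case
    by (cases "even r") (use eq q r in \<open>auto simp: odd_iff_mod_2_eq_one\<close>)
qed

text \<open>Two representations of a dyadic fraction differ by a power of 2, that is, by trailing zeros.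
  Hence the sum of digits is a function of the fraction.\<close>

lemma digit_sum_dyadic_cong:
  assumes "real m / 2 ^ k = real m' / 2 ^ k'"
  shows "digit_sum m = digit_sum m'"
proof -
  have shift: "digit_sum (a * 2 ^ j) = digit_sum a" for a j
    using digit_sum_append [of 0 j a] by simp
  have "real (m * 2 ^ k') = real (m' * 2 ^ k)"
    using assms by (simp add: field_simps)
  then have "m * 2 ^ k' = m' * 2 ^ k"
    by linarith
  then show ?thesis
    by (metis shift)
qed

lemma finite_binary_expansion_value:
  assumes "finite_binary_expansion ds x"
  obtains m where "x = real m / 2 ^ length ds" "digit_sum m = sum_list ds"
proof -
  \<comment> \<open>The number whose digits are \<open>ds\<close> is \<open>m\<close>; the factor 2 arises because the digit with index 0 is the units digit.\<close>
  have "\<exists>m. (\<Sum>j<length ds. real (ds ! j) / 2 ^ j) = 2 * real m / 2 ^ length ds \<and>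
          digit_sum m = sum_list ds" if "set ds \<subseteq> {0, 1}"
    using that
  proof (induction ds rule: rev_induct)
    case Nil
    show ?case by (intro exI [of _ 0]) simp
  next
    case (snoc d ds)
    then obtain m where m: "(\<Sum>j<length ds. real (ds ! j) / 2 ^ j) = 2 * real m / 2 ^ length ds"
      "digit_sum m = sum_list ds"
      by auto
    have "(\<Sum>j<length (ds @ [d]). real ((ds @ [d]) ! j) / 2 ^ j) =
        2 * real m / 2 ^ length ds + real d / 2 ^ length ds"
      using m(1) by (simp add: nth_append)
    also have "\<dots> = 2 * real (2 * m + d) / 2 ^ length (ds @ [d])"
      by (simp add: field_simps)
    finally have "(\<Sum>j<length (ds @ [d]). real ((ds @ [d]) ! j) / 2 ^ j) =
        2 * real (2 * m + d) / 2 ^ length (ds @ [d])" .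
    moreover have "digit_sum (2 * m + d) = sum_list (ds @ [d])"
      using snoc.prems m(2) by auto
    ultimately show ?case by blast
  qed
  then obtain m where "x = 2 * real m / 2 ^ length ds" "digit_sum m = sum_list ds"
    using assms unfolding finite_binary_expansion_def by blast
  then show thesis
    by (intro that [of "2 * m"]) simp_all
qed

lemma finite_binary_expansion_exists:
  assumes "m \<le> 2 ^ k"
  obtains ds where "finite_binary_expansion ds (real m / 2 ^ k)"
proof -
  have *: "\<exists>ds. length ds = l \<and> set ds \<subseteq> {0, 1} \<and>
          (\<Sum>j<l. real (ds ! j) / 2 ^ j) = 2 * real a / 2 ^ l" if "a < 2 ^ l" for a l
    using that
  proof (induction l arbitrary: a)
    case 0
    then show ?case by simp
  next
    case (Suc l)
    then have "a div 2 < 2 ^ l"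
      by auto
    from Suc.IH [OF this] obtain ds where ds: "length ds = l" "set ds \<subseteq> {0, 1}"
      "(\<Sum>j<l. real (ds ! j) / 2 ^ j) = 2 * real (a div 2) / 2 ^ l"
      by auto
    have a: "real a = 2 * real (a div 2) + real (a mod 2)"
      by (metis div_mult_mod_eq mult.commute of_nat_add of_nat_mult of_nat_numeral)
    have "(\<Sum>j<Suc l. real ((ds @ [a mod 2]) ! j) / 2 ^ j) =
        2 * real (a div 2) / 2 ^ l + real (a mod 2) / 2 ^ l"
      using ds(1,3) by (simp add: nth_append)
    also have "\<dots> = 2 * real a / 2 ^ Suc l"
      unfolding a by (simp add: field_simps)
    finally show ?case
      using ds(1,2) by (intro exI [of _ "ds @ [a mod 2]"]) auto
  qed
  have "m < 2 ^ Suc k"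
    using assms by (rule le_less_trans) simp
  from * [OF this] obtain ds where "length ds = Suc k" "set ds \<subseteq> {0, 1}"
    "(\<Sum>j<Suc k. real (ds ! j) / 2 ^ j) = 2 * real m / 2 ^ Suc k"
    by blast
  then show thesis
    by (intro that [of ds]) (simp add: finite_binary_expansion_def)
qed

text \<open>This replaces digit lists by numerators, for which \<open>digit_sum_append\<close> and
  \<open>digit_sum_dyadic_cong\<close> are available.\<close>

lemma digit_class_iff:
  "x \<in> digit_class n i \<longleftrightarrow>
     (\<exists>m k. x = real m / 2 ^ k \<and> m \<le> 2 ^ k \<and> [digit_sum m = i] (mod n))"
  (is "_ \<longleftrightarrow> ?R")
proof
  assume "x \<in> digit_class n i"
  then obtain ds where x: "x \<le> 1" "finite_binary_expansion ds x" "[sum_list ds = i] (mod n)"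
    by (auto simp: digit_class_def)
  obtain m where m: "x = real m / 2 ^ length ds" "digit_sum m = sum_list ds"
    using finite_binary_expansion_value [OF x(2)] .
  have "real m \<le> real (2 ^ length ds)"
    using x(1) m(1) by (simp add: field_simps)
  then have "m \<le> 2 ^ length ds"
    by linarith
  then show ?R
    using m x(3) by metis
next
  assume ?R
  then obtain m k where x: "x = real m / 2 ^ k" "m \<le> 2 ^ k" "[digit_sum m = i] (mod n)"
    by blast
  obtain ds where ds: "finite_binary_expansion ds x"
    using finite_binary_expansion_exists [OF x(2)] x(1) by metis
  obtain m' where m': "x = real m' / 2 ^ length ds" "digit_sum m' = sum_list ds"
    using finite_binary_expansion_value [OF ds] .
  have "digit_sum m = digit_sum m'"
    using x(1) m'(1) by (intro digit_sum_dyadic_cong [of m k m' "length ds"]) simp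
  moreover have "real m \<le> 2 ^ k"
    using x(2) by (metis of_nat_le_iff of_nat_numeral of_nat_power)
  ultimately show "x \<in> digit_class n i"
    using ds x m' by (auto simp: digit_class_def)
qed

section \<open>Forests and positive diagrams\<close>

datatype edge_tree = Leaf edge | Node edge edge_tree edge_tree

fun top_edge :: "edge_tree \<Rightarrow> edge" where
  "top_edge (Leaf e) = e"
| "top_edge (Node e l r) = e"

fun leaves :: "edge_tree \<Rightarrow> edge list" where
  "leaves (Leaf e) = [e]"
| "leaves (Node e l r) = leaves l @ leaves r"

fun tree_edges :: "edge_tree \<Rightarrow> edge set" where
  "tree_edges (Leaf e) = {e}"
| "tree_edges (Node e l r) = insert e (tree_edges l \<union> tree_edges r)"

fun tree_cells :: "edge_tree \<Rightarrow> (edge list \<times> edge list) set" where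
  "tree_cells (Leaf e) = {}"
| "tree_cells (Node e l r) =
     insert ([e], [top_edge l, top_edge r]) (tree_cells l \<union> tree_cells r)"

fun tree_vertices :: "edge_tree \<Rightarrow> nat set" where
  "tree_vertices (Leaf e) = {source e, target e}"
| "tree_vertices (Node e l r) = tree_vertices l \<union> tree_vertices r"

text \<open>The disjointness conditions are those of \<open>summable_diagrams\<close> for the sum of the two subtrees and
  of \<open>composable_diagrams\<close> for the cell of a node on top of this sum.\<close>

fun wf_tree :: "edge_tree \<Rightarrow> bool" where
  "wf_tree (Leaf e) \<longleftrightarrow> source e \<noteq> target e"
| "wf_tree (Node e l r) \<longleftrightarrow> wf_tree l \<and> wf_tree r \<and>
     source (top_edge l) = source e \<and> target (top_edge l) = source (top_edge r) \<and>
     target (top_edge r) = target e \<and>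
     tree_vertices l \<inter> tree_vertices r = {target (top_edge l)} \<and>
     tree_edges l \<inter> tree_edges r = {} \<and> e \<notin> tree_edges l \<union> tree_edges r"

definition tree_diagram :: "edge_tree \<Rightarrow> diagram" where
  "tree_diagram t = \<lparr>vertices = tree_vertices t, edges = tree_edges t, cells = tree_cells t,
     top_path = [top_edge t], bot_path = leaves t\<rparr>"

definition forest_diagram :: "edge_tree list \<Rightarrow> diagram" where
  "forest_diagram ts = \<lparr>vertices = \<Union>(tree_vertices ` set ts), edges = \<Union>(tree_edges ` set ts),
     cells = \<Union>(tree_cells ` set ts), top_path = map top_edge ts,
     bot_path = concat (map leaves ts)\<rparr>"

lemma forest_diagram_singleton: "forest_diagram [t] = tree_diagram t"
  by (simp add: forest_diagram_def tree_diagram_def)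

fun wf_forest :: "edge_tree list \<Rightarrow> bool" where
  "wf_forest [] \<longleftrightarrow> True"
| "wf_forest (t # ts) \<longleftrightarrow> wf_tree t \<and> wf_forest ts \<and>
     (ts \<noteq> [] \<longrightarrow> target (top_edge t) = source (top_edge (hd ts)) \<and>
        tree_vertices t \<inter> \<Union>(tree_vertices ` set ts) = {target (top_edge t)} \<and>
        tree_edges t \<inter> \<Union>(tree_edges ` set ts) = {})"

lemma top_edge_in_tree_edges [simp]: "top_edge t \<in> tree_edges t"
  by (cases t) auto

lemma leaves_nonempty [simp]: "leaves t \<noteq> []"
  by (induction t) auto

lemma leaves_subset_tree_edges: "set (leaves t) \<subseteq> tree_edges t"
  by (induction t) auto

lemma leaves_ends:
  assumes "wf_tree t"
  shows "source (hd (leaves t)) = source (top_edge t)"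
    and "target (last (leaves t)) = target (top_edge t)"
  using assms by (induction t) auto

lemma edge_ends_in_tree_vertices:
  assumes "wf_tree t" "e \<in> tree_edges t"
  shows "source e \<in> tree_vertices t" "target e \<in> tree_vertices t"
proof -
  have "source e \<in> tree_vertices t \<and> target e \<in> tree_vertices t"
    using assms
  proof (induction t arbitrary: e)
    case (Node e' l r)
    have "source (top_edge l) \<in> tree_vertices l" "target (top_edge r) \<in> tree_vertices r"
      using Node.IH(1) [of "top_edge l"] Node.IH(2) [of "top_edge r"] Node.prems(1) by simp_all
    then show ?case
      using Node by auto
  qed auto
  then show "source e \<in> tree_vertices t" "target e \<in> tree_vertices t"
    by auto
qed

lemma top_edge_ends_in_tree_vertices:
  assumes "wf_tree t"
  shows "source (top_edge t) \<in> tree_vertices t" "target (top_edge t) \<in> tree_vertices t"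
  using edge_ends_in_tree_vertices [OF assms] by simp_all

text \<open>Splitting an edge introduces its middle vertex on the bottom path and removes no vertex, so the
  bottom path passes through all the vertices.\<close>

lemma tree_vertices_leaves:
  shows "tree_vertices t = path_vertices (leaves t)"
  by (induction t) (auto simp: path_vertices_def)

lemma wf_forest_append:
  assumes "ts \<noteq> []" "us \<noteq> []"
  shows "wf_forest (ts @ us) \<longleftrightarrow> wf_forest ts \<and> wf_forest us \<and>
     target (top_edge (last ts)) = source (top_edge (hd us)) \<and>
     \<Union>(tree_vertices ` set ts) \<inter> \<Union>(tree_vertices ` set us) = {target (top_edge (last ts))} \<and>
     \<Union>(tree_edges ` set ts) \<inter> \<Union>(tree_edges ` set us) = {}"
  using assms
proof (induction ts)
  case Nil
  then show ?case by simp
next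
  case (Cons t ts)
  show ?case
  proof (cases "ts = []")
    case True
    then show ?thesis
      using Cons.prems by auto
  next
    case False
    define A B C where "A = tree_vertices t" and "B = \<Union>(tree_vertices ` set ts)"
      and "C = \<Union>(tree_vertices ` set us)"
    define A' B' C' where "A' = tree_edges t" and "B' = \<Union>(tree_edges ` set ts)"
      and "C' = \<Union>(tree_edges ` set us)"
    note defs = A_def [symmetric] B_def [symmetric] C_def [symmetric]
      A'_def [symmetric] B'_def [symmetric] C'_def [symmetric]
    let ?a = "target (top_edge t)" and ?b = "target (top_edge (last ts))"
    have IH: "wf_forest (ts @ us) \<longleftrightarrow> wf_forest ts \<and> wf_forest us \<and>
        ?b = source (top_edge (hd us)) \<and> B \<inter> C = {?b} \<and> B' \<inter> C' = {}"
      using Cons.IH [OF False Cons.prems(2)] unfolding defs .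
    have t_ts: "wf_forest (t # ts) \<longleftrightarrow> wf_tree t \<and> wf_forest ts \<and>
        ?a = source (top_edge (hd ts)) \<and> A \<inter> B = {?a} \<and> A' \<inter> B' = {}"
      using False unfolding defs by (simp add: defs)
    have t_ts_us: "wf_forest ((t # ts) @ us) \<longleftrightarrow> wf_tree t \<and> wf_forest (ts @ us) \<and>
        ?a = source (top_edge (hd ts)) \<and> A \<inter> (B \<union> C) = {?a} \<and> A' \<inter> (B' \<union> C') = {}"
      using False by (simp add: A_def B_def C_def A'_def B'_def C'_def)
    have hd: "source (top_edge (hd xs)) \<in> \<Union>(tree_vertices ` set xs)"
      if "wf_forest xs" "xs \<noteq> []" for xs
      using that top_edge_ends_in_tree_vertices by (cases xs) auto
    have last: "?b \<in> B" if "wf_forest ts"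
      using that False unfolding B_def
    proof (induction ts)
      case (Cons a ts)
      then show ?case
        using top_edge_ends_in_tree_vertices by (cases "ts = []") auto
    qed simp
    have "wf_forest (ts @ us) \<and> ?a \<in> B \<and> A \<inter> (B \<union> C) = {?a} \<longleftrightarrow>
        wf_forest (ts @ us) \<and> ?a \<in> B \<and> A \<inter> B = {?a} \<and> (A \<union> B) \<inter> C = {?b}"
    proof -
      have "A \<inter> (B \<union> C) = {?a} \<longleftrightarrow> A \<inter> B = {?a} \<and> (A \<union> B) \<inter> C = {?b}"
        if "B \<inter> C = {?b}" "?a \<in> B"
        using that by auto
      then show ?thesis
        using IH by auto
    qed
    moreover have "?a \<in> B" if "wf_forest ts" "?a = source (top_edge (hd ts))"
      using hd [OF that(1) False] that(2) unfolding B_def by simp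
    moreover have "A' \<inter> (B' \<union> C') = {} \<and> B' \<inter> C' = {} \<longleftrightarrow> A' \<inter> B' = {} \<and> (A' \<union> B') \<inter> C' = {}"
      by auto
    moreover have "B \<inter> C = {?b}" if "(A \<union> B) \<inter> C = {?b}" "wf_forest ts"
      using that last by auto
    moreover have "B' \<inter> C' = {}" if "(A' \<union> B') \<inter> C' = {}"
      using that by auto
    ultimately have "wf_forest ((t # ts) @ us) \<longleftrightarrow> wf_forest (t # ts) \<and> wf_forest us \<and>
        ?b = source (top_edge (hd us)) \<and> (A \<union> B) \<inter> C = {?b} \<and> (A' \<union> B') \<inter> C' = {}"
      unfolding t_ts t_ts_us using IH by argo
    then show ?thesis
      using False by (simp add: A_def B_def C_def A'_def B'_def C'_def)
  qed
qed

text \<open>The tree \<open>t'\<close> arises by replacing each leaf of \<open>t\<close> by the tree of \<open>us\<close> that hangs from it. The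
  vertices of \<open>t\<close> lie on its leaves, so they are vertices of the grafted forest; this is why the
  vertices of \<open>t'\<close> are those of \<open>us\<close> and well-formedness is a matter of edges.\<close>

lemma graft_tree:
  assumes "wf_tree t" "wf_forest us" "map top_edge us = leaves t"
    and "tree_edges t \<inter> \<Union>(tree_edges ` set us) \<subseteq> set (leaves t)"
  shows "\<exists>t'. wf_tree t' \<and> top_edge t' = top_edge t \<and> leaves t' = concat (map leaves us) \<and>
    tree_vertices t' = \<Union>(tree_vertices ` set us) \<and>
    tree_edges t' = tree_edges t \<union> \<Union>(tree_edges ` set us) \<and>
    tree_cells t' = tree_cells t \<union> \<Union>(tree_cells ` set us)"
  using assms
proof (induction t arbitrary: us)
  case (Leaf e)
  then obtain u where "us = [u]" "top_edge u = e"
    by (cases us) auto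
  then show ?case
    using Leaf by (intro exI [of _ u]) auto
next
  case (Node e l r)
  then obtain us1 us2 where us: "us = us1 @ us2" "map top_edge us1 = leaves l"
    "map top_edge us2 = leaves r"
    by (auto simp: map_eq_append_conv)
  have ne: "us1 \<noteq> []" "us2 \<noteq> []"
    using us(2,3) leaves_nonempty by (metis list.map_disc_iff)+
  define V1 V2 E1 E2 where "V1 = \<Union>(tree_vertices ` set us1)"
    and "V2 = \<Union>(tree_vertices ` set us2)"
    and "E1 = \<Union>(tree_edges ` set us1)" and "E2 = \<Union>(tree_edges ` set us2)"
  note defs = V1_def [symmetric] V2_def [symmetric] E1_def [symmetric] E2_def [symmetric]
  have wf: "wf_forest us1" "wf_forest us2" "V1 \<inter> V2 = {target (top_edge (last us1))}"
    "E1 \<inter> E2 = {}"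
    using Node.prems(2) wf_forest_append [OF ne] us(1) unfolding defs by auto
  have top: "set (leaves l) \<subseteq> E1" "set (leaves r) \<subseteq> E2"
    unfolding us(2,3) [symmetric] E1_def E2_def by auto
  have E: "insert e (tree_edges l \<union> tree_edges r) \<inter> (E1 \<union> E2) \<subseteq> set (leaves l) \<union> set (leaves r)"
    using Node.prems(4) us(1) unfolding E1_def E2_def by auto
  have lr: "wf_tree l" "wf_tree r" "tree_edges l \<inter> tree_edges r = {}"
    "e \<notin> tree_edges l \<union> tree_edges r"
    using Node.prems(1) by auto
  note sub = leaves_subset_tree_edges [of l] leaves_subset_tree_edges [of r]
  have "tree_edges l \<inter> E1 \<subseteq> set (leaves l)" "tree_edges r \<inter> E2 \<subseteq> set (leaves r)"
    using E lr(3) sub by blast+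
  then obtain l' r' where l': "wf_tree l'" "top_edge l' = top_edge l"
      "leaves l' = concat (map leaves us1)" "tree_vertices l' = V1"
      "tree_edges l' = tree_edges l \<union> E1"
      "tree_cells l' = tree_cells l \<union> \<Union>(tree_cells ` set us1)"
    and r': "wf_tree r'" "top_edge r' = top_edge r"
      "leaves r' = concat (map leaves us2)" "tree_vertices r' = V2"
      "tree_edges r' = tree_edges r \<union> E2"
      "tree_cells r' = tree_cells r \<union> \<Union>(tree_cells ` set us2)"
    using Node.IH(1) [OF lr(1) wf(1) us(2)] Node.IH(2) [OF lr(2) wf(2) us(3)] unfolding defs
    by blast
  have "target (top_edge (last us1)) = target (top_edge l)"
    using us(2) ne(1) leaves_ends(2) [OF lr(1)] by (metis last_map)
  moreover have "tree_edges l' \<inter> tree_edges r' = {}" "e \<notin> tree_edges l' \<union> tree_edges r'"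
    using E lr(3,4) sub top wf(4) unfolding l'(5) r'(5) by blast+
  ultimately have "wf_tree (Node e l' r')"
    using l' r' Node.prems(1) wf(3) by simp
  then show ?case
    using l' r' us(1) unfolding V1_def V2_def E1_def E2_def
    by (intro exI [of _ "Node e l' r'"]) auto
qed

text \<open>The composition of two positive diagrams in terms of forests: every leaf of the upper forest
  receives the tree of the lower forest that hangs from it.\<close>

lemma graft_forest:
  assumes "wf_forest ts" "ts \<noteq> []" "wf_forest us" "map top_edge us = concat (map leaves ts)"
    and "\<Union>(tree_edges ` set ts) \<inter> \<Union>(tree_edges ` set us) \<subseteq> set (concat (map leaves ts))"
  shows "\<exists>ts'. wf_forest ts' \<and> ts' \<noteq> [] \<and> map top_edge ts' = map top_edge ts \<and>
    concat (map leaves ts') = concat (map leaves us) \<and>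
    \<Union>(tree_vertices ` set ts') = \<Union>(tree_vertices ` set us) \<and>
    \<Union>(tree_edges ` set ts') = \<Union>(tree_edges ` set ts) \<union> \<Union>(tree_edges ` set us) \<and>
    \<Union>(tree_cells ` set ts') = \<Union>(tree_cells ` set ts) \<union> \<Union>(tree_cells ` set us)"
  using assms
proof (induction ts arbitrary: us)
  case Nil
  then show ?case by simp
next
  case (Cons t ts)
  show ?case
  proof (cases "ts = []")
    case True
    then obtain t' where "wf_tree t'" "top_edge t' = top_edge t" "leaves t' = concat (map leaves us)"
      "tree_vertices t' = \<Union>(tree_vertices ` set us)"
      "tree_edges t' = tree_edges t \<union> \<Union>(tree_edges ` set us)"
      "tree_cells t' = tree_cells t \<union> \<Union>(tree_cells ` set us)"
      using graft_tree [of t us] Cons.prems by auto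
    then show ?thesis
      using True by (intro exI [of _ "[t']"]) auto
  next
    case False
    obtain us1 us2 where us: "us = us1 @ us2" "map top_edge us1 = leaves t"
      "map top_edge us2 = concat (map leaves ts)"
      using Cons.prems(4) by (auto simp: map_eq_append_conv)
    have ne: "us1 \<noteq> []" "us2 \<noteq> []"
    proof -
      have "leaves t \<noteq> []" "concat (map leaves ts) \<noteq> []"
        using False by (auto simp: neq_Nil_conv)
      then show "us1 \<noteq> []" "us2 \<noteq> []"
        using us(2,3) by (metis list.map_disc_iff)+
    qed
    define V1 V2 E1 E2 F where "V1 = \<Union>(tree_vertices ` set us1)"
      and "V2 = \<Union>(tree_vertices ` set us2)"
      and "E1 = \<Union>(tree_edges ` set us1)" and "E2 = \<Union>(tree_edges ` set us2)"
      and "F = \<Union>(tree_edges ` set ts)"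
    note defs = V1_def [symmetric] V2_def [symmetric] E1_def [symmetric] E2_def [symmetric]
      F_def [symmetric]
    have wf: "wf_forest us1" "wf_forest us2" "V1 \<inter> V2 = {target (top_edge (last us1))}"
      "E1 \<inter> E2 = {}" "target (top_edge (last us1)) = source (top_edge (hd us2))"
      using Cons.prems(3) wf_forest_append [OF ne] us(1) unfolding defs by auto
    have top: "set (leaves t) \<subseteq> E1" "set (concat (map leaves ts)) \<subseteq> E2"
      unfolding us(2,3) [symmetric] E1_def E2_def by auto
    have E: "(tree_edges t \<union> F) \<inter> (E1 \<union> E2) \<subseteq> set (leaves t) \<union> set (concat (map leaves ts))"
      using Cons.prems(5) us(1) unfolding E1_def E2_def F_def by auto
    have tts: "wf_tree t" "wf_forest ts" "tree_edges t \<inter> F = {}"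
      using Cons.prems(1) False unfolding F_def by auto
    have sub: "set (leaves t) \<subseteq> tree_edges t" "set (concat (map leaves ts)) \<subseteq> F"
      using leaves_subset_tree_edges unfolding F_def by fastforce+
    have "tree_edges t \<inter> E1 \<subseteq> set (leaves t)" "F \<inter> E2 \<subseteq> set (concat (map leaves ts))"
      using E tts(3) sub by blast+
    then obtain t' ts' where t': "wf_tree t'" "top_edge t' = top_edge t"
        "leaves t' = concat (map leaves us1)" "tree_vertices t' = V1"
        "tree_edges t' = tree_edges t \<union> E1"
        "tree_cells t' = tree_cells t \<union> \<Union>(tree_cells ` set us1)"
      and ts': "wf_forest ts'" "ts' \<noteq> []" "map top_edge ts' = map top_edge ts"
        "concat (map leaves ts') = concat (map leaves us2)"
        "\<Union>(tree_vertices ` set ts') = V2"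
        "\<Union>(tree_edges ` set ts') = F \<union> E2"
        "\<Union>(tree_cells ` set ts') = \<Union>(tree_cells ` set ts) \<union> \<Union>(tree_cells ` set us2)"
      using graft_tree [OF tts(1) wf(1) us(2)] Cons.IH [OF tts(2) False wf(2) us(3)]
      unfolding defs by blast
    have tgt: "target (top_edge (last us1)) = target (top_edge t)"
      using us(2) ne(1) leaves_ends(2) [OF tts(1)] by (metis last_map)
    have "target (top_edge t) = source (top_edge (hd ts))"
      using Cons.prems(1) False by simp
    also have "top_edge (hd ts) = top_edge (hd ts')"
      using ts'(2,3) False by (metis hd_map)
    finally have "target (top_edge t') = source (top_edge (hd ts'))"
      using t'(2) by simp
    moreover have "tree_edges t' \<inter> (F \<union> E2) = {}"
      using E tts(3) sub top wf(4) unfolding t'(5) by blast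
    ultimately have "wf_forest (t' # ts')"
      using t' ts' wf(3) tgt by simp
    then show ?thesis
      using t' ts' us(1) unfolding V1_def V2_def E1_def E2_def F_def
      by (intro exI [of _ "t' # ts'"]) auto
  qed
qed

lemma diagram_inv_inv: "diagram_inv (diagram_inv \<Delta>) = \<Delta>"
  by (simp add: diagram_inv_def image_image)

lemma diagram_inv_sum:
  "diagram_inv (diagram_sum \<Delta>1 \<Delta>2) = diagram_sum (diagram_inv \<Delta>1) (diagram_inv \<Delta>2)"
  by (simp add: diagram_inv_def diagram_sum_def image_Un)

lemma diagram_inv_comp:
  "diagram_inv (diagram_comp \<Delta>1 \<Delta>2) = diagram_comp (diagram_inv \<Delta>2) (diagram_inv \<Delta>1)"
  by (auto simp: diagram_inv_def diagram_comp_def image_Un)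

lemma forest_bot_path_ends:
  assumes "wf_forest ts" "ts \<noteq> []"
  shows "source (hd (concat (map leaves ts))) = source (top_edge (hd ts))"
    and "target (last (concat (map leaves ts))) = target (top_edge (last ts))"
proof -
  show "source (hd (concat (map leaves ts))) = source (top_edge (hd ts))"
    using assms leaves_ends(1) by (cases ts) auto
  show "target (last (concat (map leaves ts))) = target (top_edge (last ts))"
    using assms
  proof (induction ts)
    case (Cons t ts)
    then show ?case
      using leaves_ends(2) by (cases "ts = []") (auto simp: last_append neq_Nil_conv)
  qed simp
qed

lemma sum_forest_diagram:
  assumes "wf_forest ts" "wf_forest us" "ts \<noteq> []" "us \<noteq> []"
    and "target (top_edge (last ts)) = source (top_edge (hd us))"
    and "vertices (forest_diagram ts) \<inter> vertices (forest_diagram us) = {target (top_edge (last ts))}"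
    and "edges (forest_diagram ts) \<inter> edges (forest_diagram us) = {}"
  shows "wf_forest (ts @ us) \<and>
    diagram_sum (forest_diagram ts) (forest_diagram us) = forest_diagram (ts @ us)"
  using assms by (simp add: wf_forest_append forest_diagram_def diagram_sum_def)

lemma comp_forest_diagram:
  assumes "wf_forest ts" "wf_forest us" "ts \<noteq> []"
    and "composable_diagrams (forest_diagram ts) (forest_diagram us)"
  shows "\<exists>ts'. ts' \<noteq> [] \<and> wf_forest ts' \<and>
    diagram_comp (forest_diagram ts) (forest_diagram us) = forest_diagram ts'"
proof -
  have c: "map top_edge us = concat (map leaves ts)"
    "\<Union>(tree_edges ` set ts) \<inter> \<Union>(tree_edges ` set us) \<subseteq> set (concat (map leaves ts))"
  proof -
    have eq: "map top_edge us = concat (map leaves ts)"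
      "\<Union>(tree_edges ` set ts) \<inter> \<Union>(tree_edges ` set us) = set (concat (map leaves ts))"
      using assms(4) unfolding composable_diagrams_def forest_diagram_def diagram.simps by metis+
    then show "map top_edge us = concat (map leaves ts)"
      "\<Union>(tree_edges ` set ts) \<inter> \<Union>(tree_edges ` set us) \<subseteq> set (concat (map leaves ts))"
      by (metis, metis order_refl)
  qed
  obtain ts' where ts': "wf_forest ts'" "ts' \<noteq> []" "map top_edge ts' = map top_edge ts"
    "concat (map leaves ts') = concat (map leaves us)"
    "\<Union>(tree_vertices ` set ts') = \<Union>(tree_vertices ` set us)"
    "\<Union>(tree_edges ` set ts') = \<Union>(tree_edges ` set ts) \<union> \<Union>(tree_edges ` set us)"
    "\<Union>(tree_cells ` set ts') = \<Union>(tree_cells ` set ts) \<union> \<Union>(tree_cells ` set us)"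
    using graft_forest [OF assms(1,3,2) c] by (elim exE conjE) (rule that; assumption)
  have "\<Union>(tree_vertices ` set ts) = path_vertices (concat (map leaves ts))"
    by (auto simp: tree_vertices_leaves path_vertices_def)
  also have "\<dots> = path_vertices (map top_edge us)"
    using c by simp
  also have "\<dots> \<subseteq> \<Union>(tree_vertices ` set us)"
  proof -
    have "wf_tree u" if "u \<in> set us" for u
      using assms(2) that by (induction us) auto
    then show ?thesis
      using top_edge_ends_in_tree_vertices by (auto simp: path_vertices_def)
  qed
  finally show ?thesis
    using ts' by (intro exI [of _ ts']) (auto simp: forest_diagram_def diagram_comp_def)
qed

text \<open>The inductive definition of diagrams also passes through inverses. The two claims are therefore
  proved together: inversion exchanges them, sums concatenate forests, and compositions graft
  them.\<close>

lemma diagram_of_one_sign_is_forest: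
  assumes "\<Delta> \<in> diagrams"
  shows "(\<forall>c\<in>cells \<Delta>. positive_cell c) \<Longrightarrow>
           \<exists>ts. ts \<noteq> [] \<and> wf_forest ts \<and> \<Delta> = forest_diagram ts"
    and "(\<forall>c\<in>cells \<Delta>. negative_cell c) \<Longrightarrow>
           \<exists>ts. ts \<noteq> [] \<and> wf_forest ts \<and> diagram_inv \<Delta> = forest_diagram ts"
  using assms
proof (induction rule: diagrams.induct)
  case (one e)
  {
    case 1
    then show ?case
      using one by (intro exI [of _ "[Leaf e]"]) (simp add: edge_diagram_def forest_diagram_def)
  next
    case 2
    then show ?case
      using one by (intro exI [of _ "[Leaf e]"])
        (simp add: edge_diagram_def forest_diagram_def diagram_inv_def)
  }
next
  case (cell f e g)
  {
    case 1
    have "e \<noteq> f" "e \<noteq> g" "f \<noteq> g"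
      using cell by auto
    then show ?case
      using cell by (intro exI [of _ "[Node e (Leaf f) (Leaf g)]"])
        (auto simp: cell_diagram_def forest_diagram_def)
  next
    case 2
    then show ?case
      by (auto simp: cell_diagram_def negative_cell_def)
  }
next
  case (sum \<Delta>1 \<Delta>2)
  {
    case 1
    then obtain ts us where tu: "ts \<noteq> []" "wf_forest ts" "\<Delta>1 = forest_diagram ts"
      "us \<noteq> []" "wf_forest us" "\<Delta>2 = forest_diagram us"
      using sum.IH(1,3) by (auto simp: diagram_sum_def)
    have "terminal_vertex \<Delta>1 = target (top_edge (last ts))"
      "initial_vertex \<Delta>2 = source (top_edge (hd us))"
      using tu by (simp_all add: terminal_vertex_def initial_vertex_def forest_diagram_def
          last_map hd_map)
    then have "wf_forest (ts @ us) \<and> diagram_sum \<Delta>1 \<Delta>2 = forest_diagram (ts @ us)"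
      using sum.hyps(3) sum_forest_diagram [OF tu(2,5,1,4)] tu(3,6)
      by (simp add: summable_diagrams_def)
    then show ?case
      using tu by blast
  next
    case 2
    then obtain ts us where tu: "ts \<noteq> []" "wf_forest ts" "diagram_inv \<Delta>1 = forest_diagram ts"
      "us \<noteq> []" "wf_forest us" "diagram_inv \<Delta>2 = forest_diagram us"
      using sum.IH(2,4) by (auto simp: diagram_sum_def)
    have paths: "top_path \<Delta>1 = concat (map leaves ts)" "top_path \<Delta>2 = concat (map leaves us)"
      "vertices \<Delta>1 = vertices (forest_diagram ts)" "vertices \<Delta>2 = vertices (forest_diagram us)"
      "edges \<Delta>1 = edges (forest_diagram ts)" "edges \<Delta>2 = edges (forest_diagram us)"
      using tu(3,6) by (auto simp: diagram_inv_def forest_diagram_def)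
    have "terminal_vertex \<Delta>1 = target (top_edge (last ts))"
      "initial_vertex \<Delta>2 = source (top_edge (hd us))"
      using forest_bot_path_ends(2) [OF tu(2,1)] forest_bot_path_ends(1) [OF tu(5,4)]
      by (simp_all add: terminal_vertex_def initial_vertex_def paths(1,2))
    then have "wf_forest (ts @ us) \<and>
        diagram_sum (forest_diagram ts) (forest_diagram us) = forest_diagram (ts @ us)"
      using sum.hyps(3) sum_forest_diagram [OF tu(2,5,1,4)]
      by (simp add: summable_diagrams_def paths)
    then show ?case
      using tu by (intro exI [of _ "ts @ us"]) (simp add: diagram_inv_sum)
  }
next
  case (comp \<Delta>1 \<Delta>2)
  {
    case 1
    then obtain ts us where tu: "ts \<noteq> []" "wf_forest ts" "\<Delta>1 = forest_diagram ts"
      "us \<noteq> []" "wf_forest us" "\<Delta>2 = forest_diagram us"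
      using comp.IH(1,3) by (auto simp: diagram_comp_def)
    then show ?case
      using comp_forest_diagram [OF tu(2,5,1)] comp.hyps(3) by simp
  next
    case 2
    then obtain ts us where tu: "ts \<noteq> []" "wf_forest ts" "diagram_inv \<Delta>1 = forest_diagram ts"
      "us \<noteq> []" "wf_forest us" "diagram_inv \<Delta>2 = forest_diagram us"
      using comp.IH(2,4) by (auto simp: diagram_comp_def)
    have "composable_diagrams (forest_diagram us) (forest_diagram ts)"
      using comp.hyps(3) unfolding composable_diagrams_def tu(3) [symmetric] tu(6) [symmetric]
      by (auto simp: diagram_inv_def)
    then show ?case
      using comp_forest_diagram [OF tu(5,2,4)] tu by (simp add: diagram_inv_comp)
  }
next
  case (inv \<Delta>)
  {
    case 1
    then have "\<forall>c\<in>cells \<Delta>. negative_cell c"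
      by (force simp: diagram_inv_def positive_cell_def negative_cell_def)
    then show ?case
      using inv.IH(2) by blast
  next
    case 2
    then have "\<forall>c\<in>cells \<Delta>. positive_cell c"
      by (force simp: diagram_inv_def positive_cell_def negative_cell_def)
    then show ?case
      using inv.IH(1) by (simp add: diagram_inv_inv)
  }
qed

section \<open>Dyadic intervals of the edges of a tree\<close>

text \<open>Halving \<open>[m / 2 ^ k, (m + 1) / 2 ^ k]\<close> gives the intervals with parameters
  \<open>(2 * m, Suc k)\<close> and \<open>(Suc (2 * m), Suc k)\<close>. A pair \<open>(m, k)\<close> always stands for this interval
  below.\<close>

fun nodes :: "edge_tree \<Rightarrow> nat \<Rightarrow> nat \<Rightarrow> (edge \<times> nat \<times> nat) set" where
  "nodes (Leaf e) m k = {(e, m, k)}"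
| "nodes (Node e l r) m k =
     insert (e, m, k) (nodes l (2 * m) (Suc k) \<union> nodes r (Suc (2 * m)) (Suc k))"

fun leaf_intervals :: "edge_tree \<Rightarrow> nat \<Rightarrow> nat \<Rightarrow> (nat \<times> nat) list" where
  "leaf_intervals (Leaf e) m k = [(m, k)]"
| "leaf_intervals (Node e l r) m k =
     leaf_intervals l (2 * m) (Suc k) @ leaf_intervals r (Suc (2 * m)) (Suc k)"

lemma top_edge_in_nodes [simp]: "(top_edge t, m, k) \<in> nodes t m k"
  by (cases t) auto

lemma nodes_in_tree_edges: "(e, m', k') \<in> nodes t m k \<Longrightarrow> e \<in> tree_edges t"
  by (induction t arbitrary: m k) auto

text \<open>Edges occur only once in a well-formed tree, so the interval of an edge is determined by its
  place in the tree.\<close>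

lemma nodes_functional:
  assumes "wf_tree t" "(e, m1, k1) \<in> nodes t m k" "(e, m2, k2) \<in> nodes t m k"
  shows "m1 = m2 \<and> k1 = k2"
  using assms
proof (induction t arbitrary: m k)
  case (Node e' l r)
  have "e \<noteq> e' \<Longrightarrow> e \<in> tree_edges l \<Longrightarrow> e \<notin> tree_edges r"
    using Node.prems(1) by auto
  then show ?case
    using Node nodes_in_tree_edges by (auto; blast)
qed auto

lemma length_leaf_intervals [simp]: "length (leaf_intervals t m k) = length (leaves t)"
  by (induction t arbitrary: m k) auto

lemma leaf_intervals_in_nodes:
  "j < length (leaves t) \<Longrightarrow> (leaves t ! j, leaf_intervals t m k ! j) \<in> nodes t m k"
  by (induction t arbitrary: m k j) (auto simp: nth_append)

lemma nodes_bound: "(e, m', k') \<in> nodes t m k \<Longrightarrow> m < 2 ^ k \<Longrightarrow> m' < 2 ^ k'"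
proof (induction t arbitrary: m k)
  case (Node e' l r)
  have "2 * m < 2 ^ Suc k" "Suc (2 * m) < 2 ^ Suc k"
    using Node.prems(2) by auto
  then show ?case
    using Node.IH(1) [of "2 * m" "Suc k"] Node.IH(2) [of "Suc (2 * m)" "Suc k"] Node.prems by auto
qed auto

lemma tree_cells_edges:
  assumes "(p, q) \<in> tree_cells t"
  obtains e f g where "p = [e]" "q = [f, g]" "e \<in> tree_edges t" "f \<in> tree_edges t"
    "g \<in> tree_edges t"
proof -
  have "\<exists>e f g. p = [e] \<and> q = [f, g] \<and> e \<in> tree_edges t \<and> f \<in> tree_edges t \<and> g \<in> tree_edges t"
    using assms
  proof (induction t)
    case (Node e l r)
    then show ?case
      using top_edge_in_tree_edges [of l] top_edge_in_tree_edges [of r] by fastforce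
  qed simp
  then show thesis
    using that by blast
qed

lemma nodes_children:
  assumes "wf_tree t" "(e, m', k') \<in> nodes t m k" "([e], [f, g]) \<in> tree_cells t"
  shows "(f, 2 * m', Suc k') \<in> nodes t m k" "(g, Suc (2 * m'), Suc k') \<in> nodes t m k"
proof -
  have "(f, 2 * m', Suc k') \<in> nodes t m k \<and> (g, Suc (2 * m'), Suc k') \<in> nodes t m k"
    using assms
  proof (induction t arbitrary: m k)
    case (Node a l r)
    have ne: "a \<notin> tree_edges l" "a \<notin> tree_edges r" "tree_edges l \<inter> tree_edges r = {}"
      using Node.prems(1) by auto
    consider (a) "e = a" "f = top_edge l" "g = top_edge r"
      | (l) "([e], [f, g]) \<in> tree_cells l" "e \<in> tree_edges l"
      | (r) "([e], [f, g]) \<in> tree_cells r" "e \<in> tree_edges r"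
      using Node.prems(3) by (auto elim: tree_cells_edges)
    then show ?case
    proof cases
      case a
      then have "m' = m \<and> k' = k"
        using Node.prems(2) ne nodes_in_tree_edges by auto
      then show ?thesis
        using a by simp
    next
      case l
      then have "(e, m', k') \<in> nodes l (2 * m) (Suc k)"
        using Node.prems(2) ne nodes_in_tree_edges [of e m' k' r] by auto
      then show ?thesis
        using Node.IH(1) l Node.prems(1) by simp
    next
      case r
      then have "(e, m', k') \<in> nodes r (Suc (2 * m)) (Suc k)"
        using Node.prems(2) ne nodes_in_tree_edges [of e m' k' l] by auto
      then show ?thesis
        using Node.IH(2) r Node.prems(1) by simp
    qed
  qed simp
  then show "(f, 2 * m', Suc k') \<in> nodes t m k" "(g, Suc (2 * m'), Suc k') \<in> nodes t m k"
    by auto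
qed

lemma edge_interval_nodes:
  assumes "wf_tree t" "edge_interval (tree_diagram t) e a b"
  obtains m k where "(e, m, k) \<in> nodes t 0 0" "a = real m / 2 ^ k" "b = real (Suc m) / 2 ^ k"
proof -
  have "\<exists>m k. (e, m, k) \<in> nodes t 0 0 \<and> a = real m / 2 ^ k \<and> b = real (Suc m) / 2 ^ k"
    using assms(2)
  proof (induction rule: edge_interval.induct)
    case (top e)
    then show ?case
      using top_edge_in_nodes [of t 0 0]
      by (intro exI [of _ 0]) (simp add: tree_diagram_def)
  next
    case (left e a b f g)
    then obtain m k where mk: "(e, m, k) \<in> nodes t 0 0" "a = real m / 2 ^ k"
      "b = real (Suc m) / 2 ^ k"
      by blast
    have "([e], [f, g]) \<in> tree_cells t"
      using left.hyps(2) by (simp add: tree_diagram_def)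
    then have "(f, 2 * m, Suc k) \<in> nodes t 0 0"
      using nodes_children(1) [OF assms(1) mk(1)] by blast
    moreover have "a = real (2 * m) / 2 ^ Suc k" "(a + b) / 2 = real (Suc (2 * m)) / 2 ^ Suc k"
      unfolding mk(2,3) by (simp_all add: field_simps)
    ultimately show ?case by blast
  next
    case (right e a b f g)
    then obtain m k where mk: "(e, m, k) \<in> nodes t 0 0" "a = real m / 2 ^ k"
      "b = real (Suc m) / 2 ^ k"
      by blast
    have "([e], [f, g]) \<in> tree_cells t"
      using right.hyps(2) by (simp add: tree_diagram_def)
    then have "(g, Suc (2 * m), Suc k) \<in> nodes t 0 0"
      using nodes_children(2) [OF assms(1) mk(1)] by blast
    moreover have "(a + b) / 2 = real (Suc (2 * m)) / 2 ^ Suc k"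
      "b = real (Suc (Suc (2 * m))) / 2 ^ Suc k"
      unfolding mk(2,3) by (simp_all add: field_simps)
    ultimately show ?case by blast
  qed
  then show thesis
    using that by blast
qed

lemma nodes_edge_interval:
  assumes "(e, m, k) \<in> nodes t 0 0"
  shows "edge_interval (tree_diagram t) e (real m / 2 ^ k) (real (Suc m) / 2 ^ k)"
proof -
  have "edge_interval \<Delta> e (real m / 2 ^ k) (real (Suc m) / 2 ^ k)"
    if "(e, m, k) \<in> nodes u m0 k0" "tree_cells u \<subseteq> cells \<Delta>"
      "edge_interval \<Delta> (top_edge u) (real m0 / 2 ^ k0) (real (Suc m0) / 2 ^ k0)" for \<Delta> u m0 k0
    using that
  proof (induction u arbitrary: m0 k0)
    case (Leaf e')
    then show ?case by simp
  next
    case (Node e' l r)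
    have c: "([e'], [top_edge l, top_edge r]) \<in> cells \<Delta>"
      using Node.prems(2) by auto
    have mid: "(real m0 / 2 ^ k0 + real (Suc m0) / 2 ^ k0) / 2 = real (Suc (2 * m0)) / 2 ^ Suc k0"
      "real m0 / 2 ^ k0 = real (2 * m0) / 2 ^ Suc k0"
      "real (Suc m0) / 2 ^ k0 = real (Suc (Suc (2 * m0))) / 2 ^ Suc k0"
      by (simp_all add: field_simps)
    have top: "edge_interval \<Delta> e' (real m0 / 2 ^ k0) (real (Suc m0) / 2 ^ k0)"
      using Node.prems(3) by simp
    have "edge_interval \<Delta> (top_edge l) (real (2 * m0) / 2 ^ Suc k0)
        (real (Suc (2 * m0)) / 2 ^ Suc k0)"
      using edge_interval.left [OF top c] unfolding mid(1) unfolding mid(2) .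
    moreover have "edge_interval \<Delta> (top_edge r) (real (Suc (2 * m0)) / 2 ^ Suc k0)
        (real (Suc (Suc (2 * m0))) / 2 ^ Suc k0)"
      using edge_interval.right [OF top c] unfolding mid(1) unfolding mid(3) .
    ultimately show ?case
      using Node.IH Node.prems top by auto
  qed
  moreover have "edge_interval (tree_diagram t) (top_edge t) (real 0 / 2 ^ 0) (real (Suc 0) / 2 ^ 0)"
    using edge_interval.top [of "tree_diagram t" "top_edge t"] by (simp add: tree_diagram_def)
  ultimately show ?thesis
    using assms by (simp add: tree_diagram_def)
qed

text \<open>A vertex is an end of several intervals, and the numerators of its position with respect to them
  differ by factors that are powers of 2, so their sums of digits agree and define a function on
  vertices.\<close>

lemma vertex_digit_sums:
  assumes "wf_tree t"
  shows "\<exists>w. \<forall>e m' k'. (e, m', k') \<in> nodes t m k \<longrightarrow>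
     w (source e) = digit_sum m' \<and> w (target e) = digit_sum (Suc m')"
  using assms
proof (induction t arbitrary: m k)
  case (Leaf e)
  then show ?case
    by (intro exI [of _ "\<lambda>v. if v = source e then digit_sum m else digit_sum (Suc m)"]) auto
next
  case (Node a l r)
  then obtain wl wr where wl: "\<And>e m' k'. (e, m', k') \<in> nodes l (2 * m) (Suc k) \<Longrightarrow>
      wl (source e) = digit_sum m' \<and> wl (target e) = digit_sum (Suc m')"
    and wr: "\<And>e m' k'. (e, m', k') \<in> nodes r (Suc (2 * m)) (Suc k) \<Longrightarrow>
      wr (source e) = digit_sum m' \<and> wr (target e) = digit_sum (Suc m')"
    by fastforce
  have wf: "wf_tree l" "wf_tree r" "source (top_edge l) = source a"
    "target (top_edge l) = source (top_edge r)" "target (top_edge r) = target a"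
    "tree_vertices l \<inter> tree_vertices r = {target (top_edge l)}"
    using Node.prems by auto
  define w where "w v = (if v \<in> tree_vertices l then wl v else wr v)" for v
  have l: "w v = wl v" if "v \<in> tree_vertices l" for v
    using that by (simp add: w_def)
  have "wl (target (top_edge l)) = wr (target (top_edge l))"
    using wl [OF top_edge_in_nodes] wr [OF top_edge_in_nodes] wf(4) by simp
  then have r: "w v = wr v" if "v \<in> tree_vertices r" for v
    using that wf(6) unfolding w_def by (metis IntI singletonD)
  have "w (source e) = digit_sum m' \<and> w (target e) = digit_sum (Suc m')"
    if node: "(e, m', k') \<in> nodes (Node a l r) m k" for e m' k'
  proof -
    consider "e = a" "m' = m" | "(e, m', k') \<in> nodes l (2 * m) (Suc k)"
      | "(e, m', k') \<in> nodes r (Suc (2 * m)) (Suc k)"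
      using node by auto
    then show ?thesis
    proof cases
      case 1
      have "w (source a) = wl (source (top_edge l))"
        using l [OF top_edge_ends_in_tree_vertices(1) [OF wf(1)]] wf(3) by simp
      moreover have "w (target a) = wr (target (top_edge r))"
        using r [OF top_edge_ends_in_tree_vertices(2) [OF wf(2)]] wf(5) by simp
      moreover have "digit_sum (Suc (Suc (2 * m))) = digit_sum (Suc m)"
        using digit_sum_double [of "Suc m"] by simp
      ultimately show ?thesis
        using 1 wl [OF top_edge_in_nodes] wr [OF top_edge_in_nodes] by simp
    next
      case 2
      then show ?thesis
        using wl l edge_ends_in_tree_vertices [OF wf(1)] nodes_in_tree_edges by metis
    next
      case 3
      then show ?thesis
        using wr r edge_ends_in_tree_vertices [OF wf(2)] nodes_in_tree_edges by metis
    qed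
  qed
  then show ?case by blast
qed

section \<open>Incoming edges and Thompson graphs\<close>

fun left_children :: "edge_tree \<Rightarrow> edge set" where
  "left_children (Leaf e) = {}"
| "left_children (Node e l r) = insert (top_edge l) (left_children l \<union> left_children r)"

lemma left_children_in_tree_edges: "left_children t \<subseteq> tree_edges t"
  by (induction t) (auto dest: subsetD)

lemma top_edge_source_neq_target:
  assumes "wf_tree t"
  shows "source (top_edge t) \<noteq> target (top_edge t)"
  using assms
proof (induction t)
  case (Node e l r)
  then have wf: "wf_tree l" "wf_tree r" "source (top_edge l) = source e"
    "target (top_edge l) = source (top_edge r)" "target (top_edge r) = target e"
    "tree_vertices l \<inter> tree_vertices r = {target (top_edge l)}"
    by auto
  show ?case
  proof
    assume "source (top_edge (Node e l r)) = target (top_edge (Node e l r))"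
    then have "source (top_edge l) \<in> tree_vertices l \<inter> tree_vertices r"
      using top_edge_ends_in_tree_vertices [OF wf(1)] top_edge_ends_in_tree_vertices [OF wf(2)] wf
      by auto
    then show False
      using Node.IH(1) wf by auto
  qed
qed auto

text \<open>All edges of a tree lead from left to right between its two ends.\<close>

lemma no_edge_into_source_or_out_of_target:
  assumes "wf_tree t" "e \<in> tree_edges t"
  shows "target e \<noteq> source (top_edge t)" "source e \<noteq> target (top_edge t)"
proof -
  have "target e \<noteq> source (top_edge t) \<and> source e \<noteq> target (top_edge t)"
    using assms
  proof (induction t)
    case (Node a l r)
    then have wf: "wf_tree l" "wf_tree r" "source (top_edge l) = source a"
      "target (top_edge l) = source (top_edge r)" "target (top_edge r) = target a"
      "tree_vertices l \<inter> tree_vertices r = {target (top_edge l)}"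
      by auto
    have mid: "v = target (top_edge l)" if "v \<in> tree_vertices l" "v \<in> tree_vertices r" for v
      using wf(6) that by blast
    have s: "source a \<notin> tree_vertices r"
      using mid [of "source a"] top_edge_source_neq_target [OF wf(1)] wf(3)
        top_edge_ends_in_tree_vertices(1) [OF wf(1)] by auto
    have t: "target a \<notin> tree_vertices l"
      using mid [of "target a"] top_edge_source_neq_target [OF wf(2)] wf(4,5)
        top_edge_ends_in_tree_vertices(2) [OF wf(2)] by auto
    have a: "source a \<noteq> target a"
      using top_edge_source_neq_target [OF Node.prems(1)] by simp
    consider "e = a" | "e \<in> tree_edges l" | "e \<in> tree_edges r"
      using Node.prems(2) by auto
    then show ?case
    proof cases
      case 1
      then show ?thesis using a by auto
    next
      case 2
      then show ?thesis
        using Node.IH(1) [OF wf(1) 2] wf(3) t edge_ends_in_tree_vertices(1) [OF wf(1) 2]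
        by (metis top_edge.simps(2))
    next
      case 3
      then show ?thesis
        using Node.IH(2) [OF wf(2) 3] wf(5) s edge_ends_in_tree_vertices(2) [OF wf(2) 3]
        by (metis top_edge.simps(2))
    qed
  qed (auto dest: not_sym)
  then show "target e \<noteq> source (top_edge t)" "source e \<noteq> target (top_edge t)"
    by auto
qed

text \<open>The middle vertex is the only vertex common to both subtrees, and no edge of the right subtree
  ends there. So edges with a common target lie on the same side of a node.\<close>

lemma wf_tree_NodeE:
  assumes "wf_tree (Node e l r)"
  obtains "wf_tree l" "wf_tree r" "source (top_edge l) = source e"
    "target (top_edge l) = source (top_edge r)" "target (top_edge r) = target e"
    "tree_edges l \<inter> tree_edges r = {}" "e \<notin> tree_edges l" "e \<notin> tree_edges r"
    "\<And>v. v \<in> tree_vertices l \<Longrightarrow> v \<in> tree_vertices r \<Longrightarrow> v = target (top_edge l)"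
    "\<And>f. f \<in> tree_edges l \<Longrightarrow> target f \<noteq> target e"
    "\<And>f g. f \<in> tree_edges l \<Longrightarrow> g \<in> tree_edges r \<Longrightarrow> target f \<noteq> target g"
proof -
  have wf: "wf_tree l" "wf_tree r" "source (top_edge l) = source e"
    "target (top_edge l) = source (top_edge r)" "target (top_edge r) = target e"
    "tree_edges l \<inter> tree_edges r = {}" "e \<notin> tree_edges l" "e \<notin> tree_edges r"
    and V: "tree_vertices l \<inter> tree_vertices r = {target (top_edge l)}"
    using assms by auto
  have "target f \<noteq> target g" if "f \<in> tree_edges l" "g \<in> tree_edges r" for f g
  proof
    assume "target f = target g"
    then have "target g \<in> tree_vertices l \<inter> tree_vertices r"
      using edge_ends_in_tree_vertices [OF wf(1) that(1)]
        edge_ends_in_tree_vertices [OF wf(2) that(2)] by auto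
    then show False
      using V wf(4) no_edge_into_source_or_out_of_target(1) [OF wf(2) that(2)] by auto
  qed
  moreover from this have "target f \<noteq> target e" if "f \<in> tree_edges l" for f
    using that wf(5) top_edge_in_tree_edges by metis
  ultimately show thesis
    using that wf V by blast
qed

lemma inner_vertex_is_left_child_target:
  assumes "wf_tree t" "v \<in> tree_vertices t" "v \<noteq> source (top_edge t)" "v \<noteq> target (top_edge t)"
  shows "\<exists>f\<in>left_children t. target f = v"
  using assms by (induction t) auto

lemma vertex_is_leaf_target:
  assumes "wf_tree t" "v \<in> tree_vertices t" "v \<noteq> source (top_edge t)"
  shows "\<exists>x\<in>set (leaves t). target x = v"
  using assms
proof (induction t)
  case (Node e l r)
  show ?case
  proof (cases "v \<in> tree_vertices l")
    case True
    then show ?thesis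
      using Node by auto
  next
    case False
    then have "v \<noteq> source (top_edge r)"
      using Node.prems(1) top_edge_ends_in_tree_vertices [of l] by auto
    then show ?thesis
      using Node False by auto
  qed
qed auto

lemma vertex_is_leaf_source:
  assumes "wf_tree t" "v \<in> tree_vertices t" "v \<noteq> target (top_edge t)"
  shows "\<exists>x\<in>set (leaves t). source x = v"
  using assms
proof (induction t)
  case (Node e l r)
  show ?case
  proof (cases "v \<in> tree_vertices r")
    case True
    then show ?thesis
      using Node by auto
  next
    case False
    then have "v \<noteq> target (top_edge l)"
      using Node.prems(1) top_edge_ends_in_tree_vertices [of r] by auto
    then show ?thesis
      using Node False by auto
  qed
qed auto

text \<open>The relation \<open>directly_above\<close> of the diagram of the tree: of the two bottom edges of a cell, the
  right one shares its target with the top edge.\<close>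

fun right_steps :: "edge_tree \<Rightarrow> (edge \<times> edge) set" where
  "right_steps (Leaf e) = {}"
| "right_steps (Node e l r) = insert (e, top_edge r) (right_steps l \<union> right_steps r)"

lemma right_steps_cells: "right_steps t = {(last p, last q) | p q. (p, q) \<in> tree_cells t}"
proof (induction t)
  case (Node e l r)
  then show ?case by auto (metis last.simps list.distinct(1) old.prod.inject)
qed simp

text \<open>Below an edge, the edges with the same target form the chain of successive right children.\<close>

lemma right_spine:
  assumes "wf_tree t" "e \<in> tree_edges t" "target e = target (top_edge t)"
  shows "(top_edge t, e) \<in> (right_steps t)\<^sup>*"
  using assms
proof (induction t)
  case (Node a l r)
  from Node.prems(1) show ?case
  proof (rule wf_tree_NodeE)
    assume wf: "wf_tree r" "target (top_edge r) = target a"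
      and l: "\<And>f. f \<in> tree_edges l \<Longrightarrow> target f \<noteq> target a"
    consider "e = a" | "e \<in> tree_edges r"
      using Node.prems l by auto
    then show ?case
    proof cases
      case 2
      have "(a, top_edge r) \<in> (right_steps (Node a l r))\<^sup>*"
        by auto
      moreover have "(top_edge r, e) \<in> (right_steps r)\<^sup>*"
        using Node.IH(2) wf 2 Node.prems(3) by simp
      then have "(top_edge r, e) \<in> (right_steps (Node a l r))\<^sup>*"
        by (rule rtrancl_mono [THEN subsetD, rotated]) auto
      ultimately show ?thesis
        by simp
    qed simp
  qed
qed simp

lemma left_child_target_inner:
  assumes "wf_tree t" "f \<in> left_children t"
  shows "target f \<noteq> source (top_edge t)" "target f \<noteq> target (top_edge t)"
proof -
  show "target f \<noteq> source (top_edge t)"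
    using assms left_children_in_tree_edges no_edge_into_source_or_out_of_target(1) by blast
  show "target f \<noteq> target (top_edge t)"
    using assms
  proof (induction t)
    case (Node a l r)
    from Node.prems(1) show ?case
    proof (rule wf_tree_NodeE)
      assume "wf_tree r" "target (top_edge r) = target a"
        and "\<And>f. f \<in> tree_edges l \<Longrightarrow> target f \<noteq> target a"
      then show ?case
        using Node.IH(2) Node.prems(2) left_children_in_tree_edges [of l] by auto
    qed
  qed simp
qed

text \<open>The edges with the target of a left child \<open>f\<close> are \<open>f\<close> itself and its successive right
  children: every other edge ends at another vertex of the tree.\<close>

lemma left_child_above_incoming:
  assumes "wf_tree t" "f \<in> left_children t" "e \<in> tree_edges t" "target e = target f"
  shows "(f, e) \<in> (right_steps t)\<^sup>*"
  using assms
proof (induction t)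
  case (Node a l r)
  from Node.prems(1) show ?case
  proof (rule wf_tree_NodeE)
    assume wf: "wf_tree l" "wf_tree r" "target (top_edge r) = target a"
      and l: "\<And>f. f \<in> tree_edges l \<Longrightarrow> target f \<noteq> target a"
      and lr: "\<And>f g. f \<in> tree_edges l \<Longrightarrow> g \<in> tree_edges r \<Longrightarrow> target f \<noteq> target g"
    have mono: "(right_steps l)\<^sup>* \<subseteq> (right_steps (Node a l r))\<^sup>*"
      "(right_steps r)\<^sup>* \<subseteq> (right_steps (Node a l r))\<^sup>*"
      by (rule rtrancl_mono; auto)+
    consider "f = top_edge l" | "f \<in> left_children l" | "f \<in> left_children r"
      using Node.prems(2) by auto
    then show ?case
    proof cases
      case 1
      then have "e \<in> tree_edges l"
        using Node.prems(3,4) l lr top_edge_in_tree_edges by (metis Un_iff insert_iff tree_edges.simps(2))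
      then show ?thesis
        using right_spine [OF wf(1)] 1 Node.prems(4) mono by auto
    next
      case 2
      then have "f \<in> tree_edges l"
        using left_children_in_tree_edges by auto
      then have "e \<in> tree_edges l"
        using Node.prems(3,4) l lr by (metis Un_iff insert_iff tree_edges.simps(2))
      then show ?thesis
        using Node.IH(1) wf 2 Node.prems(4) mono by auto
    next
      case 3
      then have f: "f \<in> tree_edges r"
        using left_children_in_tree_edges by auto
      have "target f \<noteq> target (top_edge r)"
        using left_child_target_inner wf(2) 3 by blast
      then have "e \<in> tree_edges r"
        using Node.prems(3,4) f lr wf(3) by auto
      then show ?thesis
        using Node.IH(2) wf 3 Node.prems(4) mono by auto
    qed
  qed
qed simp

text \<open>All edges with a given target lie on one chain of right children, which ends in a leaf.\<close>

lemma incoming_above_leaf: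
  assumes "wf_tree t" "x \<in> set (leaves t)" "e \<in> tree_edges t" "target e = target x"
  shows "(e, x) \<in> (right_steps t)\<^sup>*"
  using assms
proof (induction t arbitrary: e)
  case (Node a l r)
  from Node.prems(1) show ?case
  proof (rule wf_tree_NodeE)
    assume wf: "wf_tree l" "wf_tree r" "target (top_edge r) = target a"
      and l: "\<And>f. f \<in> tree_edges l \<Longrightarrow> target f \<noteq> target a"
      and lr: "\<And>f g. f \<in> tree_edges l \<Longrightarrow> g \<in> tree_edges r \<Longrightarrow> target f \<noteq> target g"
    have mono: "(right_steps l)\<^sup>* \<subseteq> (right_steps (Node a l r))\<^sup>*"
      "(right_steps r)\<^sup>* \<subseteq> (right_steps (Node a l r))\<^sup>*"
      by (rule rtrancl_mono; auto)+
    consider "x \<in> set (leaves l)" | "x \<in> set (leaves r)"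
      using Node.prems(2) by auto
    then show ?case
    proof cases
      case 1
      then have "x \<in> tree_edges l"
        using leaves_subset_tree_edges by auto
      then have "e \<in> tree_edges l"
        using Node.prems(3,4) l lr by (metis Un_iff insert_iff tree_edges.simps(2))
      then show ?thesis
        using Node.IH(1) wf 1 Node.prems(4) mono by auto
    next
      case 2
      then have x: "x \<in> tree_edges r"
        using leaves_subset_tree_edges by auto
      show ?thesis
      proof (cases "e = a")
        case True
        have "(top_edge r, x) \<in> (right_steps r)\<^sup>*"
          using Node.IH(2) [OF wf(2) 2, of "top_edge r"] True Node.prems(4) wf(3) by simp
        then have "(top_edge r, x) \<in> (right_steps (Node a l r))\<^sup>*"
          using mono by blast
        then show ?thesis
          using True by (auto intro: converse_rtrancl_into_rtrancl)
      next
        case False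
        then have "e \<in> tree_edges r"
          using Node.prems(3,4) x lr by auto
        then show ?thesis
          using Node.IH(2) wf 2 Node.prems(4) mono by auto
      qed
    qed
  qed
qed simp

lemma right_steps_in_tree_edges:
  "(a, b) \<in> right_steps t \<Longrightarrow> a \<in> tree_edges t \<and> b \<in> tree_edges t"
  by (induction t) auto

lemma top_edge_not_child:
  assumes "wf_tree t"
  shows "top_edge t \<notin> left_children t" "(a, top_edge t) \<notin> right_steps t"
  using assms left_children_in_tree_edges right_steps_in_tree_edges
  by (cases t; fastforce)+

lemma left_child_not_right_child:
  assumes "wf_tree t" "f \<in> left_children t"
  shows "(a, f) \<notin> right_steps t"
  using assms
proof (induction t)
  case (Node e l r)
  then have wf: "wf_tree l" "wf_tree r" "tree_edges l \<inter> tree_edges r = {}"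
    by auto
  have sub: "left_children l \<subseteq> tree_edges l" "left_children r \<subseteq> tree_edges r"
    "top_edge l \<in> tree_edges l" "top_edge r \<in> tree_edges r"
    "\<And>b. (a, b) \<in> right_steps l \<Longrightarrow> b \<in> tree_edges l"
    "\<And>b. (a, b) \<in> right_steps r \<Longrightarrow> b \<in> tree_edges r"
    using left_children_in_tree_edges right_steps_in_tree_edges by auto
  have disj: "b \<notin> tree_edges r" if "b \<in> tree_edges l" for b
    using wf(3) that by blast
  have tops: "top_edge l \<noteq> top_edge r"
    using disj sub(3,4) by metis
  have rl: "(a, b) \<notin> right_steps r" if "b \<in> tree_edges l" for b
    using sub(6) disj that by blast
  have lr: "(a, b) \<notin> right_steps l" if "b \<in> tree_edges r" for b
    using sub(5) disj that by blast
  consider "f = top_edge l" | "f \<in> left_children l" | "f \<in> left_children r"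
    using Node.prems(2) by auto
  then show ?case
  proof cases
    case 1
    then show ?thesis
      using sub(3) tops rl top_edge_not_child(2) [OF wf(1)] by simp
  next
    case 2
    then have f: "f \<in> tree_edges l"
      using sub(1) by blast
    then have "f \<noteq> top_edge r"
      using disj sub(4) by metis
    then show ?thesis
      using f 2 rl wf(1) Node.IH(1) by simp
  next
    case 3
    then have "f \<noteq> top_edge r"
      using top_edge_not_child(1) [OF wf(2)] by auto
    then show ?thesis
      using 3 sub(2) lr [of f] wf(2) Node.IH(2) by auto
  qed
qed simp

lemma leaf_has_no_children:
  assumes "wf_tree t" "x \<in> set (leaves t)"
  shows "(x, a) \<notin> right_steps t"
  using assms
proof (induction t)
  case (Node e l r)
  have wf: "wf_tree l" "wf_tree r" "tree_edges l \<inter> tree_edges r = {}"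
    "e \<notin> tree_edges l" "e \<notin> tree_edges r"
    using Node.prems(1) by auto
  note sub = leaves_subset_tree_edges [of l] leaves_subset_tree_edges [of r]
  have x: "x \<in> set (leaves l) \<or> x \<in> set (leaves r)"
    using Node.prems(2) by simp
  have "x \<noteq> e"
    using x sub wf(4,5) by blast
  moreover have "(x, a) \<notin> right_steps l" "(x, a) \<notin> right_steps r"
    using Node.IH x sub wf(1-3) right_steps_in_tree_edges [of x a] by blast+
  ultimately show ?case
    by simp
qed simp

text \<open>The two trees share their leaves and no other edge. The upper half of a diagram of \<open>F\<close> is
  \<open>T\<close>, and \<open>U\<close> is the reflection of the lower half.\<close>

definition tree_pair :: "edge_tree \<Rightarrow> edge_tree \<Rightarrow> bool" where
  "tree_pair T U \<longleftrightarrow> wf_tree T \<and> wf_tree U \<and> leaves T = leaves U \<and>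
     tree_edges T \<inter> tree_edges U = set (leaves T)"

definition pair_diagram :: "edge_tree \<Rightarrow> edge_tree \<Rightarrow> diagram" where
  "pair_diagram T U = diagram_comp (tree_diagram T) (diagram_inv (tree_diagram U))"

lemma tree_pair_sym: "tree_pair T U \<Longrightarrow> tree_pair U T"
  unfolding tree_pair_def by (metis Int_commute)

lemma tree_pair_ends:
  assumes "tree_pair T U"
  shows "source (top_edge U) = source (top_edge T)" "target (top_edge U) = target (top_edge T)"
    "tree_vertices U = tree_vertices T"
  using assms leaves_ends [of T] leaves_ends [of U]
  by (simp_all add: tree_pair_def tree_vertices_leaves)

lemma inner_vertices_pair_diagram:
  assumes "tree_pair T U"
  shows "inner_vertices (pair_diagram T U) =
    tree_vertices T - {source (top_edge T), target (top_edge T)}"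
    "initial_vertex (pair_diagram T U) = source (top_edge T)"
    "terminal_vertex (pair_diagram T U) = target (top_edge T)"
    "vertices (pair_diagram T U) = tree_vertices T"
    "edges (pair_diagram T U) = tree_edges T \<union> tree_edges U"
  using tree_pair_ends [OF assms]
  by (auto simp: inner_vertices_def initial_vertex_def terminal_vertex_def pair_diagram_def
      diagram_comp_def diagram_inv_def tree_diagram_def)

lemma directly_above_pair_diagram:
  "directly_above (pair_diagram T U) = right_steps T \<union> (right_steps U)\<inverse>"
  unfolding right_steps_cells
  by (auto simp: directly_above_def pair_diagram_def diagram_comp_def diagram_inv_def
      tree_diagram_def image_iff; metis prod.swap_def fst_conv snd_conv)

text \<open>Reflection exchanges \<open>T\<close> and \<open>U\<close> and reverses the vertical order of edges, so statements
  about lower edges follow from those about upper edges.\<close>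

lemma bottommost_incoming_pair_diagram:
  assumes "tree_pair T U"
  shows "bottommost_incoming (pair_diagram T U) v e \<longleftrightarrow> topmost_incoming (pair_diagram U T) v e"
proof -
  have "directly_above (pair_diagram U T) = (directly_above (pair_diagram T U))\<inverse>"
    by (auto simp: directly_above_pair_diagram)
  moreover have "incoming_edges (pair_diagram U T) = incoming_edges (pair_diagram T U)"
    using inner_vertices_pair_diagram(5) [OF assms]
      inner_vertices_pair_diagram(5) [OF tree_pair_sym [OF assms]]
    by (auto simp: incoming_edges_def)
  ultimately show ?thesis
    by (simp add: bottommost_incoming_def topmost_incoming_def rtrancl_converse)
qed

text \<open>The edges into the target of \<open>f\<close> form a chain from top to bottom: right children below \<open>f\<close>
  in \<open>T\<close> down to the common leaf, then upwards in \<open>U\<close> from this leaf through the edges of which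
  it is the rightmost leaf.\<close>

lemma left_child_topmost_incoming:
  assumes "tree_pair T U" "f \<in> left_children T"
  shows "topmost_incoming (pair_diagram T U) (target f) f"
proof -
  have wf: "wf_tree T" "wf_tree U" "leaves T = leaves U"
    using assms(1) by (auto simp: tree_pair_def)
  have f: "f \<in> tree_edges T"
    using assms(2) left_children_in_tree_edges by auto
  have "(f, e) \<in> (directly_above (pair_diagram T U))\<^sup>*"
    if "e \<in> tree_edges T \<union> tree_edges U" "target e = target f" for e
  proof (cases "e \<in> tree_edges T")
    case True
    then have "(f, e) \<in> (right_steps T)\<^sup>*"
      using left_child_above_incoming assms(2) wf(1) that(2) by blast
    then show ?thesis
      unfolding directly_above_pair_diagram by (rule rtrancl_mono [THEN subsetD, rotated]) auto
  next
    case False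
    obtain x where x: "x \<in> set (leaves T)" "target x = target f"
      using vertex_is_leaf_target [OF wf(1)] edge_ends_in_tree_vertices(2) [OF wf(1) f]
        no_edge_into_source_or_out_of_target(1) [OF wf(1) f] by blast
    then have "(f, x) \<in> (right_steps T)\<^sup>*"
      using left_child_above_incoming [OF wf(1) assms(2)] leaves_subset_tree_edges by blast
    then have "(f, x) \<in> (directly_above (pair_diagram T U))\<^sup>*"
      unfolding directly_above_pair_diagram by (rule rtrancl_mono [THEN subsetD, rotated]) auto
    moreover have "(e, x) \<in> (right_steps U)\<^sup>*"
      using incoming_above_leaf [OF wf(2)] x wf(3) that False by auto
    then have "(x, e) \<in> ((right_steps U)\<inverse>)\<^sup>*"
      by (simp add: rtrancl_converse)
    then have "(x, e) \<in> (directly_above (pair_diagram T U))\<^sup>*"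
      unfolding directly_above_pair_diagram by (rule rtrancl_mono [THEN subsetD, rotated]) auto
    ultimately show ?thesis
      by simp
  qed
  then show ?thesis
    using f by (auto simp: topmost_incoming_def incoming_edges_def
        inner_vertices_pair_diagram(5) [OF assms(1)])
qed

text \<open>Nothing lies directly above a left child \<open>f\<close> of \<open>T\<close>: it is not a right child, and if it is an
  edge of \<open>U\<close> at all then it is a leaf of \<open>U\<close>, so it is not the top edge of a cell of \<open>U\<close>.\<close>

lemma topmost_incoming_unique:
  assumes "tree_pair T U" "f \<in> left_children T" "topmost_incoming (pair_diagram T U) (target f) e"
  shows "e = f"
proof -
  have wf: "wf_tree T" "wf_tree U" "leaves T = leaves U"
    "tree_edges T \<inter> tree_edges U = set (leaves T)"
    using assms(1) by (auto simp: tree_pair_def)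
  have f: "f \<in> tree_edges T"
    using assms(2) left_children_in_tree_edges by auto
  have "(e, f) \<in> (directly_above (pair_diagram T U))\<^sup>*"
    using assms(3) f unfolding topmost_incoming_def incoming_edges_def
    by (simp add: inner_vertices_pair_diagram(5) [OF assms(1)])
  then show ?thesis
  proof (cases rule: rtrancl.cases)
    case (rtrancl_into_rtrancl b)
    then have "(f, b) \<in> right_steps U"
      using left_child_not_right_child [OF wf(1) assms(2)]
      by (auto simp: directly_above_pair_diagram)
    moreover from this have "f \<in> set (leaves U)"
      using f wf(3,4) right_steps_in_tree_edges by (metis IntI)
    ultimately show ?thesis
      using leaf_has_no_children wf(2) by blast
  qed simp
qed

lemma thompson_graph_upper_edges:
  assumes "tree_pair T U"
  shows "(\<exists>v. v \<in> inner_vertices (pair_diagram T U) \<and> topmost_incoming (pair_diagram T U) v e)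
    \<longleftrightarrow> e \<in> left_children T"
proof -
  have wf: "wf_tree T"
    using assms by (simp add: tree_pair_def)
  have inner: "v \<in> inner_vertices (pair_diagram T U) \<longleftrightarrow> (\<exists>f\<in>left_children T. target f = v)" for v
    using inner_vertex_is_left_child_target [OF wf, of v] left_child_target_inner [OF wf]
      subsetD [OF left_children_in_tree_edges] edge_ends_in_tree_vertices(2) [OF wf]
    by (auto simp: inner_vertices_pair_diagram [OF assms])
  show ?thesis
  proof
    assume "\<exists>v. v \<in> inner_vertices (pair_diagram T U) \<and> topmost_incoming (pair_diagram T U) v e"
    then obtain f where f: "f \<in> left_children T" "topmost_incoming (pair_diagram T U) (target f) e"
      using inner by metis
    then show "e \<in> left_children T"
      using topmost_incoming_unique [OF assms f] by simp
  next
    assume "e \<in> left_children T"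
    then show "\<exists>v. v \<in> inner_vertices (pair_diagram T U) \<and> topmost_incoming (pair_diagram T U) v e"
      using inner left_child_topmost_incoming [OF assms] by metis
  qed
qed

lemma arcs_thompson_graph:
  assumes "tree_pair T U"
  shows "(Upper, e) \<in> arcs (thompson_graph (pair_diagram T U)) \<longleftrightarrow> e \<in> left_children T"
    and "(Lower, e) \<in> arcs (thompson_graph (pair_diagram T U)) \<longleftrightarrow> e \<in> left_children U"
proof -
  show "(Upper, e) \<in> arcs (thompson_graph (pair_diagram T U)) \<longleftrightarrow> e \<in> left_children T"
    using thompson_graph_upper_edges [OF assms, of e] by (auto simp: thompson_graph_def)
  have "inner_vertices (pair_diagram U T) = inner_vertices (pair_diagram T U)"
    using inner_vertices_pair_diagram(1) [OF assms]
      inner_vertices_pair_diagram(1) [OF tree_pair_sym [OF assms]] tree_pair_ends [OF assms] by simp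
  then show "(Lower, e) \<in> arcs (thompson_graph (pair_diagram T U)) \<longleftrightarrow> e \<in> left_children U"
    using thompson_graph_upper_edges [OF tree_pair_sym [OF assms], of e]
    by (auto simp: thompson_graph_def bottommost_incoming_pair_diagram [OF assms])
qed

definition digit_weight :: "edge_tree \<Rightarrow> (nat \<Rightarrow> nat) \<Rightarrow> bool" where
  "digit_weight t w \<longleftrightarrow> (\<forall>e m k. (e, m, k) \<in> nodes t 0 0 \<longrightarrow>
     w (source e) = digit_sum m \<and> w (target e) = digit_sum (Suc m))"

text \<open>A left child has an interval \<open>(2 * m, k)\<close> with even numerator, and passing to its right end turns
  the last digit 0 into 1.\<close>

lemma digit_weight_left_child:
  assumes "digit_weight t w" "f \<in> left_children t"
  shows "w (target f) = Suc (w (source f))"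
proof -
  have "\<exists>m' k'. (f, 2 * m', k') \<in> nodes u m k" if "f \<in> left_children u" for u m k
    using that
  proof (induction u arbitrary: m k)
    case (Node e l r)
    then show ?case
      using top_edge_in_nodes by (auto; blast)
  qed simp
  then obtain m k where "(f, 2 * m, k) \<in> nodes t 0 0"
    using assms(2) by blast
  then show ?thesis
    using assms(1) by (force simp: digit_weight_def)
qed

fun level_tree :: "edge_tree \<Rightarrow> edge_tree \<Rightarrow> level \<Rightarrow> edge_tree" where
  "level_tree T U Upper = T"
| "level_tree T U Lower = U"

lemma arcs_thompson_graph_level:
  assumes "tree_pair T U"
  shows "(l, e) \<in> arcs (thompson_graph (pair_diagram T U)) \<longleftrightarrow> e \<in> left_children (level_tree T U l)"
  using arcs_thompson_graph [OF assms] by (cases l) auto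

lemma thompson_graph_sel:
  "tail (thompson_graph \<Delta>) (l, e) = source e" "head (thompson_graph \<Delta>) (l, e) = target e"
  "verts (thompson_graph \<Delta>) = vertices \<Delta> - {terminal_vertex \<Delta>}"
  by (simp_all add: thompson_graph_def)

text \<open>The weight vanishes at the initial vertex and grows by one along each edge of the level.\<close>

lemma level_path_length:
  assumes "tree_pair T U" "digit_weight (level_tree T U l) w"
    and "level_path (pair_diagram T U) l v p"
  shows "length p = w v"
proof -
  let ?G = "thompson_graph (pair_diagram T U)"
  have walk: "w v = w u + length p"
    if "pre_digraph.cas ?G u p v" "set p \<subseteq> arcs ?G" "\<forall>a\<in>set p. fst a = l" for u
    using that
  proof (induction p arbitrary: u)
    case Nil
    then show ?case by (simp add: pre_digraph.cas.simps)
  next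
    case (Cons a p)
    obtain e where a: "a = (l, e)"
      using Cons.prems(3) by (cases a) auto
    have e: "e \<in> left_children (level_tree T U l)"
      using Cons.prems(2) a arcs_thompson_graph_level [OF assms(1)] by auto
    have c: "source e = u" "pre_digraph.cas ?G (target e) p v"
      using Cons.prems(1) a by (simp_all add: pre_digraph.cas.simps thompson_graph_sel)
    have "w v = w (target e) + length p"
      using Cons.IH [OF c(2)] Cons.prems by auto
    then show ?case
      using digit_weight_left_child [OF assms(2) e] c(1) by simp
  qed
  have "source (top_edge (level_tree T U l)) = source (top_edge T)"
    using tree_pair_ends [OF assms(1)] by (cases l) auto
  then have "w (source (top_edge T)) = 0"
    using assms(2) top_edge_in_nodes unfolding digit_weight_def by (metis digit_sum_0)
  then show ?thesis
    using walk [of "source (top_edge T)"] assms(3)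
    by (auto simp: level_path_def pre_digraph.awalk_def inner_vertices_pair_diagram [OF assms(1)])
qed

lemma cas_snoc:
  "pre_digraph.cas G u p (tail G a) \<Longrightarrow> pre_digraph.cas G u (p @ [a]) (head G a)"
  by (induction p arbitrary: u) (auto simp: pre_digraph.cas.simps)

text \<open>Walking backwards, each edge of the level lowers the weight, so the walk reaches the initial
  vertex.\<close>

lemma level_path_exists:
  assumes "tree_pair T U" "v \<in> tree_vertices T" "v \<noteq> target (top_edge T)"
  shows "\<exists>p. level_path (pair_diagram T U) l v p"
proof -
  let ?D = "pair_diagram T U" and ?t = "level_tree T U l"
  have t: "wf_tree ?t" "source (top_edge ?t) = source (top_edge T)"
    "target (top_edge ?t) = target (top_edge T)" "tree_vertices ?t = tree_vertices T"
    using tree_pair_ends [OF assms(1)] assms(1) by (cases l; auto simp: tree_pair_def)+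
  obtain w where w: "digit_weight ?t w"
    using vertex_digit_sums [OF t(1), of 0 0] unfolding digit_weight_def by blast
  show ?thesis
    using assms(2,3)
  proof (induction "w v" arbitrary: v rule: less_induct)
    case less
    show ?case
    proof (cases "v = source (top_edge T)")
      case True
      then show ?thesis
        using less.prems by (intro exI [of _ "[]"])
          (simp add: level_path_def pre_digraph.awalk_def pre_digraph.cas.simps
            thompson_graph_sel inner_vertices_pair_diagram [OF assms(1)])
    next
      case False
      then obtain f where f: "f \<in> left_children ?t" "target f = v"
        using inner_vertex_is_left_child_target [OF t(1)] less.prems t by metis
      then have fe: "f \<in> tree_edges ?t"
        using left_children_in_tree_edges by blast
      have "source f \<in> tree_vertices T" "source f \<noteq> target (top_edge T)"
        using edge_ends_in_tree_vertices(1) [OF t(1) fe] no_edge_into_source_or_out_of_target(2) [OF t(1) fe] t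
        by auto
      moreover have "w (source f) < w v"
        using digit_weight_left_child [OF w f(1)] f(2) by simp
      ultimately obtain p where p: "level_path ?D l (source f) p"
        using less.hyps by blast
      have "level_path ?D l v (p @ [(l, f)])"
        using p cas_snoc [of "thompson_graph ?D" _ p "(l, f)"] f
          arcs_thompson_graph_level [OF assms(1)]
        by (auto simp: level_path_def pre_digraph.awalk_def thompson_graph_sel)
      then show ?thesis by blast
    qed
  qed
qed

lemma n_good_pair_diagram:
  assumes "tree_pair T U" "digit_weight T w" "digit_weight U w'"
  shows "n_good n (pair_diagram T U) \<longleftrightarrow>
    (\<forall>v\<in>tree_vertices T - {source (top_edge T), target (top_edge T)}. [w v = w' v] (mod n))"
proof -
  have "(\<exists>p q. level_path (pair_diagram T U) Upper v p \<and> level_path (pair_diagram T U) Lower v q \<and>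
      [length p = length q] (mod n)) \<longleftrightarrow> [w v = w' v] (mod n)"
    if "v \<in> tree_vertices T - {source (top_edge T), target (top_edge T)}" for v
    using level_path_exists [OF assms(1), of v] that
      level_path_length [OF assms(1), of Upper w v] level_path_length [OF assms(1), of Lower w' v]
      assms(2,3) by (metis DiffD1 DiffD2 insertCI level_tree.simps)
  then show ?thesis
    by (simp add: n_good_def inner_vertices_pair_diagram [OF assms(1)])
qed

section \<open>Maps that are affine on dyadic intervals\<close>

text \<open>The map \<open>h\<close> is affine on the interval \<open>I\<close> and carries it onto the interval \<open>J\<close>, preserving
  orientation.\<close>

definition maps_dyadic :: "(real \<Rightarrow> real) \<Rightarrow> nat \<times> nat \<Rightarrow> nat \<times> nat \<Rightarrow> bool" where
  "maps_dyadic h I J \<longleftrightarrow> (case (I, J) of ((m, k), (m', k')) \<Rightarrow>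
     (\<forall>x\<in>{real m / 2 ^ k..real (Suc m) / 2 ^ k}.
        h x = real m' / 2 ^ k' + 2 ^ k / 2 ^ k' * (x - real m / 2 ^ k)))"

lemma maps_dyadicD:
  assumes "maps_dyadic h (m, k) (m', k')" "real m / 2 ^ k \<le> x" "x \<le> real (Suc m) / 2 ^ k"
  shows "h x = real m' / 2 ^ k' + 2 ^ k / 2 ^ k' * (x - real m / 2 ^ k)"
  using assms by (simp add: maps_dyadic_def)

lemma maps_dyadic_ends:
  assumes "maps_dyadic h (m, k) (m', k')"
  shows "h (real m / 2 ^ k) = real m' / 2 ^ k'" "h (real (Suc m) / 2 ^ k) = real (Suc m') / 2 ^ k'"
proof -
  show "h (real m / 2 ^ k) = real m' / 2 ^ k'"
    by (subst maps_dyadicD [OF assms]) (auto intro: divide_right_mono)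
  show "h (real (Suc m) / 2 ^ k) = real (Suc m') / 2 ^ k'"
    by (subst maps_dyadicD [OF assms]) (auto intro: divide_right_mono simp: field_simps)
qed

lemma dyadic_interval_inj:
  assumes "real m / 2 ^ k = real m' / 2 ^ k'" "real (Suc m) / 2 ^ k = real (Suc m') / 2 ^ k'"
  shows "m = m' \<and> k = k'"
proof -
  have "1 / 2 ^ k = (1 / 2 ^ k' :: real)"
    using assms by (simp add: add_divide_distrib)
  then have "(2::real) ^ k = 2 ^ k'"
    by simp
  then have "k = k'"
    by simp
  then show ?thesis
    using assms by simp
qed

lemma dyadic_interval_in_unit:
  assumes "m < 2 ^ k" "real m / 2 ^ k \<le> x" "x \<le> real (Suc m) / 2 ^ k"
  shows "x \<in> {0..1}"
proof -
  have "real (Suc m) \<le> 2 ^ k"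
    using assms(1) by (metis Suc_leI of_nat_le_iff of_nat_numeral of_nat_power)
  then have "real (Suc m) / 2 ^ k \<le> 1" "0 \<le> real m / 2 ^ k"
    by simp_all
  then show ?thesis
    using assms(2,3) by (meson atLeastAtMost_iff order_trans)
qed

lemma maps_dyadic_functional:
  assumes "maps_dyadic h (m, k) (m1, k1)" "maps_dyadic h (m, k) (m2, k2)"
  shows "m1 = m2 \<and> k1 = k2"
  using maps_dyadic_ends [OF assms(1)] maps_dyadic_ends [OF assms(2)]
  by (intro dyadic_interval_inj) simp_all

lemma maps_dyadic_inverse:
  assumes "maps_dyadic h (m, k) (m', k')"
    and "\<And>x. real m / 2 ^ k \<le> x \<Longrightarrow> x \<le> real (Suc m) / 2 ^ k \<Longrightarrow> g (h x) = x"
  shows "maps_dyadic g (m', k') (m, k)"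
  unfolding maps_dyadic_def prod.case
proof
  fix y
  assume y: "y \<in> {real m' / 2 ^ k'..real (Suc m') / 2 ^ k'}"
  define x where "x = real m / 2 ^ k + 2 ^ k' / 2 ^ k * (y - real m' / 2 ^ k')"
  have "real m / 2 ^ k \<le> x"
    using y by (simp add: x_def)
  moreover have "x \<le> real (Suc m) / 2 ^ k"
  proof -
    have "2 ^ k' / 2 ^ k * (y - real m' / 2 ^ k') \<le>
        2 ^ k' / 2 ^ k * (real (Suc m') / 2 ^ k' - real m' / 2 ^ k')"
      using y by (intro mult_left_mono) auto
    also have "\<dots> = 1 / 2 ^ k"
      by (simp add: field_simps)
    finally show ?thesis
      by (simp add: x_def add_divide_distrib)
  qed
  moreover have "h x = y"
    using maps_dyadicD [OF assms(1) calculation] by (simp add: x_def)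
  ultimately show "g y = real m / 2 ^ k + 2 ^ k' / 2 ^ k * (y - real m' / 2 ^ k')"
    using assms(2) [of x] by (simp add: x_def)
qed

text \<open>In binary expansions \<open>h\<close> exchanges the prefix \<open>m\<close> for the prefix \<open>m'\<close>; the further digits,
  those of \<open>r\<close>, stay in place.\<close>

lemma maps_dyadic_refine:
  assumes "maps_dyadic h (m, k) (m', k')" "r < 2 ^ j"
  shows "maps_dyadic h (m * 2 ^ j + r, k + j) (m' * 2 ^ j + r, k' + j)"
  unfolding maps_dyadic_def prod.case
proof
  have lo: "real (a * 2 ^ j + r) / 2 ^ (b + j) = real a / 2 ^ b + real r / 2 ^ (b + j)" for a b
    by (simp add: field_simps power_add)
  fix x
  assume x: "x \<in> {real (m * 2 ^ j + r) / 2 ^ (k + j)..real (Suc (m * 2 ^ j + r)) / 2 ^ (k + j)}"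
  have "real m / 2 ^ k \<le> real (m * 2 ^ j + r) / 2 ^ (k + j)"
    unfolding lo by simp
  then have "real m / 2 ^ k \<le> x"
    using x by (meson atLeastAtMost_iff order_trans)
  have "Suc (m * 2 ^ j + r) \<le> Suc m * 2 ^ j"
    using assms(2) by simp
  then have "real (Suc (m * 2 ^ j + r)) \<le> real (Suc m * 2 ^ j)"
    by (rule of_nat_mono)
  then have "real (Suc (m * 2 ^ j + r)) / 2 ^ (k + j) \<le> real (Suc m * 2 ^ j) / 2 ^ (k + j)"
    by (intro divide_right_mono) simp_all
  moreover have "real (Suc m * 2 ^ j) / 2 ^ (k + j) = real (Suc m) / 2 ^ k"
    by (simp add: power_add field_simps)
  ultimately have "x \<le> real (Suc m) / 2 ^ k"
    using x by (metis atLeastAtMost_iff order_trans)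
  with \<open>real m / 2 ^ k \<le> x\<close> have "h x = real m' / 2 ^ k' + 2 ^ k / 2 ^ k' * (x - real m / 2 ^ k)"
    by (rule maps_dyadicD [OF assms(1)])
  also have "\<dots> = real (m' * 2 ^ j + r) / 2 ^ (k' + j) +
      2 ^ (k + j) / 2 ^ (k' + j) * (x - real (m * 2 ^ j + r) / 2 ^ (k + j))"
    unfolding lo by (simp add: field_simps power_add)
  finally show "h x = real (m' * 2 ^ j + r) / 2 ^ (k' + j) +
      2 ^ (k + j) / 2 ^ (k' + j) * (x - real (m * 2 ^ j + r) / 2 ^ (k + j))" .
qed

lemma maps_dyadic_join:
  assumes "maps_dyadic h (2 * m, Suc k) (2 * m', Suc k')"
    and "maps_dyadic h (Suc (2 * m), Suc k) (Suc (2 * m'), Suc k')"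
  shows "maps_dyadic h (m, k) (m', k')"
  unfolding maps_dyadic_def prod.case
proof
  fix x
  assume x: "x \<in> {real m / 2 ^ k..real (Suc m) / 2 ^ k}"
  show "h x = real m' / 2 ^ k' + 2 ^ k / 2 ^ k' * (x - real m / 2 ^ k)"
  proof (cases "x \<le> real (Suc (2 * m)) / 2 ^ Suc k")
    case True
    moreover have "real (2 * m) / 2 ^ Suc k \<le> x"
      using x by simp
    ultimately show ?thesis
      using maps_dyadicD [OF assms(1)] by simp
  next
    case False
    moreover have "x \<le> real (Suc (Suc (2 * m))) / 2 ^ Suc k"
      using x by (auto simp: field_simps)
    ultimately have "h x = real (Suc (2 * m')) / 2 ^ Suc k' +
        2 ^ Suc k / 2 ^ Suc k' * (x - real (Suc (2 * m)) / 2 ^ Suc k)"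
      using maps_dyadicD [OF assms(2)] by simp
    moreover have "real (Suc (2 * a)) / 2 ^ Suc b = real a / 2 ^ b + 1 / 2 ^ Suc b" for a b
      by (simp add: field_simps)
    ultimately have "h x = real m' / 2 ^ k' + 1 / 2 ^ Suc k' +
        2 ^ k / 2 ^ k' * (x - (real m / 2 ^ k + 1 / 2 ^ Suc k))"
      by simp
    moreover have "2 ^ k / 2 ^ k' * (1 / 2 ^ Suc k) = (1 / 2 ^ Suc k' :: real)"
      by (simp add: field_simps)
    ultimately show ?thesis
      unfolding right_diff_distrib distrib_left by linarith
  qed
qed

text \<open>The point \<open>x\<close> has the prefix \<open>m\<close>, its image has the prefix \<open>m'\<close>, and the remaining digits
  agree, so the sum of digits changes by \<open>digit_sum m' - digit_sum m\<close>.\<close>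

lemma digit_class_affine_image:
  assumes "m < 2 ^ k" "m' < 2 ^ k'" "[digit_sum m = digit_sum m'] (mod n)"
    and "maps_dyadic h (m, k) (m', k')"
    and x: "x \<in> digit_class n i" "real m / 2 ^ k \<le> x" "x < real (Suc m) / 2 ^ k"
  shows "h x \<in> digit_class n i"
proof -
  obtain a l where a: "x = real a / 2 ^ l" "[digit_sum a = i] (mod n)"
    using x(1) by (auto simp: digit_class_iff)
  \<comment> \<open>With denominator \<open>2 ^ (k + l)\<close> the numerator of \<open>x\<close> is \<open>m * 2 ^ l + r\<close>.\<close>
  have xk: "x = real (a * 2 ^ k) / 2 ^ (k + l)"
    by (simp add: a(1) power_add)
  have "real (m * 2 ^ l) \<le> real (a * 2 ^ k)" "real (a * 2 ^ k) < real (Suc m * 2 ^ l)"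
    using x(2,3) unfolding a(1) by (simp_all add: field_simps)
  then have "m * 2 ^ l \<le> a * 2 ^ k" "a * 2 ^ k < Suc m * 2 ^ l"
    by (metis of_nat_le_iff, metis of_nat_less_iff)
  then obtain r where r: "a * 2 ^ k = m * 2 ^ l + r" "r < 2 ^ l"
    by (metis add_less_cancel_right le_Suc_ex mult_Suc add.commute)
  have "digit_sum a = digit_sum (m * 2 ^ l + r)"
    using digit_sum_dyadic_cong [of a l "m * 2 ^ l + r" "k + l"] a(1) xk r(1) by simp
  then have da: "digit_sum a = digit_sum m + digit_sum r"
    using digit_sum_append r(2) by simp
  have "h x = h (real (m * 2 ^ l + r) / 2 ^ (k + l))"
    using xk r(1) by simp
  also have "\<dots> = real (m' * 2 ^ l + r) / 2 ^ (k' + l)"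
    using maps_dyadic_refine [OF assms(4) r(2)] by (rule maps_dyadic_ends)
  finally have hx: "h x = real (m' * 2 ^ l + r) / 2 ^ (k' + l)" .
  have "m' * 2 ^ l + r \<le> Suc m' * 2 ^ l"
    using r(2) by simp
  also have "\<dots> \<le> 2 ^ k' * 2 ^ l"
    using assms(2) by (intro mult_right_mono) auto
  finally have "m' * 2 ^ l + r \<le> 2 ^ (k' + l)"
    by (simp add: power_add)
  moreover have "[digit_sum (m' * 2 ^ l + r) = i] (mod n)"
  proof -
    have "[digit_sum m' + digit_sum r = digit_sum m + digit_sum r] (mod n)"
      using assms(3) by (simp add: cong_add_rcancel_nat cong_sym)
    then show ?thesis
      using da a(2) digit_sum_append [OF r(2), of m'] by (simp add: cong_trans)
  qed
  ultimately show ?thesis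
    using hx unfolding digit_class_iff by blast
qed

fun tiling :: "real \<Rightarrow> (nat \<times> nat) list \<Rightarrow> real \<Rightarrow> bool" where
  "tiling a [] b \<longleftrightarrow> a = b"
| "tiling a ((m, k) # L) b \<longleftrightarrow> a = real m / 2 ^ k \<and> tiling (real (Suc m) / 2 ^ k) L b"

lemma tiling_append: "tiling a L b \<Longrightarrow> tiling b M c \<Longrightarrow> tiling a (L @ M) c"
  by (induction a L b rule: tiling.induct) auto

lemma leaf_intervals_tiling:
  "tiling (real m / 2 ^ k) (leaf_intervals t m k) (real (Suc m) / 2 ^ k)"
proof (induction t arbitrary: m k)
  case (Node e l r)
  have "tiling (real (2 * m) / 2 ^ Suc k) (leaf_intervals (Node e l r) m k)
      (real (Suc (Suc (2 * m))) / 2 ^ Suc k)"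
    using tiling_append [OF Node.IH(1) [of "2 * m" "Suc k"] Node.IH(2) [of "Suc (2 * m)" "Suc k"]]
    by simp
  moreover have "real (2 * m) / 2 ^ Suc k = real m / 2 ^ k"
    "real (Suc (Suc (2 * m))) / 2 ^ Suc k = real (Suc m) / 2 ^ k"
    by (simp_all add: field_simps)
  ultimately show ?case
    by simp
qed simp

lemma leaf_intervals_tiling_unit: "tiling 0 (leaf_intervals t 0 0) 1"
  using leaf_intervals_tiling [of 0 0 t] by simp

lemma tiling_le: "tiling a L b \<Longrightarrow> a \<le> b"
proof (induction a L b rule: tiling.induct)
  case (2 a m k L b)
  have "real m / 2 ^ k \<le> real (Suc m) / 2 ^ k"
    by (intro divide_right_mono) auto
  then show ?case
    using 2 by auto
qed simp

lemma tiling_covers: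
  assumes "tiling a L b" "a \<le> x" "x < b"
  obtains j where "j < length L" "real (fst (L ! j)) / 2 ^ snd (L ! j) \<le> x"
    "x < real (Suc (fst (L ! j))) / 2 ^ snd (L ! j)"
proof -
  have "\<exists>j<length L. real (fst (L ! j)) / 2 ^ snd (L ! j) \<le> x \<and>
      x < real (Suc (fst (L ! j))) / 2 ^ snd (L ! j)"
    using assms
  proof (induction a L b rule: tiling.induct)
    case (2 a m k L b)
    show ?case
    proof (cases "x < real (Suc m) / 2 ^ k")
      case True
      then show ?thesis
        using 2 by (intro exI [of _ 0]) auto
    next
      case False
      then obtain j where "j < length L" "real (fst (L ! j)) / 2 ^ snd (L ! j) \<le> x"
        "x < real (Suc (fst (L ! j))) / 2 ^ snd (L ! j)"
        using 2 by force
      then show ?thesis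
        by (intro exI [of _ "Suc j"]) auto
    qed
  qed simp
  then show thesis
    using that by blast
qed

text \<open>Gluing continuous strictly increasing pieces at the common end points, one piece at a time.\<close>

lemma piecewise_affine_on_tilings:
  assumes "tiling a L b" "tiling c M d" "list_all2 (maps_dyadic h) L M" "L \<noteq> []"
  shows "continuous_on {a..b} h \<and> strict_mono_on {a..b} h \<and> h a = c \<and> h b = d"
  using assms
proof (induction L arbitrary: a c M)
  case Nil
  then show ?case by simp
next
  case (Cons I L)
  obtain m k where I: "I = (m, k)"
    by fastforce
  obtain m' k' M' where M: "M = (m', k') # M'" "maps_dyadic h (m, k) (m', k')"
    "list_all2 (maps_dyadic h) L M'"
    using Cons.prems(3) I by (auto simp: list_all2_Cons1)
  define e f where "e = real (Suc m) / 2 ^ k" and "f = real (Suc m') / 2 ^ k'"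
  have a: "a = real m / 2 ^ k" "tiling e L b" and c: "c = real m' / 2 ^ k'" "tiling f M' d"
    using Cons.prems(1,2) I M by (auto simp: e_def f_def)
  have ae: "a < e"
    unfolding a e_def by (intro divide_strict_right_mono) auto
  have eq: "h x = c + 2 ^ k / 2 ^ k' * (x - a)" if "x \<in> {a..e}" for x
    using maps_dyadicD [OF M(2)] that unfolding a(1) c(1) e_def by simp
  have cont: "continuous_on {a..e} h"
    by (rule continuous_on_eq [of _ "\<lambda>x. c + 2 ^ k / 2 ^ k' * (x - a)"])
      (auto intro!: continuous_intros simp: eq)
  have mono: "strict_mono_on {a..e} h"
    by (rule strict_mono_onI) (simp add: eq divide_strict_right_mono)
  have ends: "h a = c" "h e = f"
    using maps_dyadic_ends [OF M(2)] unfolding a(1) c(1) e_def f_def by auto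
  show ?case
  proof (cases "L = []")
    case True
    then have "b = e" "d = f"
      using a c M(3) by auto
    then show ?thesis
      using cont mono ends by simp
  next
    case False
    then have IH: "continuous_on {e..b} h" "strict_mono_on {e..b} h" "h e = f" "h b = d"
      using Cons.IH [OF a(2) c(2) M(3)] by auto
    have eb: "e \<le> b"
      using tiling_le [OF a(2)] .
    have "{a..b} = {a..e} \<union> {e..b}"
      using ae eb by auto
    then have "continuous_on {a..b} h"
      using cont IH(1) by (metis continuous_on_closed_Un closed_atLeastAtMost)
    moreover have "strict_mono_on {a..b} h"
    proof (rule strict_mono_onI)
      fix x y
      assume xy: "x \<in> {a..b}" "y \<in> {a..b}" "x < y"
      consider "y \<le> e" | "e \<le> x" | "x < e" "e < y"
        by linarith
      then show "h x < h y"
      proof cases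
        case 1
        then show ?thesis
          using mono xy by (auto simp: strict_mono_on_def)
      next
        case 2
        then show ?thesis
          using IH(2) xy by (auto simp: strict_mono_on_def)
      next
        case 3
        then have "h x < h e" "h e < h y"
          using mono IH(2) xy ae eb by (auto simp: strict_mono_on_def)
        then show ?thesis by simp
      qed
    qed
    ultimately show ?thesis
      using IH ends by simp
  qed
qed

lemma tiling_break_points:
  assumes "tiling a L b"
  shows "\<exists>xs. xs \<noteq> [] \<and> hd xs = a \<and> last xs = b \<and> sorted_wrt (<) xs \<and>
     (L \<noteq> [] \<longrightarrow> set xs \<subseteq> dyadics) \<and> length xs = Suc (length L) \<and> (\<forall>j<length L.
       xs ! j = real (fst (L ! j)) / 2 ^ snd (L ! j) \<and>
       xs ! Suc j = real (Suc (fst (L ! j))) / 2 ^ snd (L ! j))"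
  using assms
proof (induction a L b rule: tiling.induct)
  case (1 a b)
  then show ?case by (intro exI [of _ "[a]"]) simp
next
  case (2 a m k L b)
  define e where "e = real (Suc m) / 2 ^ k"
  have a: "a = real m / 2 ^ k" "tiling e L b"
    using 2 by (auto simp: e_def)
  have ae: "a < e"
    unfolding a e_def by (intro divide_strict_right_mono) auto
  obtain xs where xs: "xs \<noteq> []" "hd xs = e" "last xs = b" "sorted_wrt (<) xs"
    "L \<noteq> [] \<longrightarrow> set xs \<subseteq> dyadics" "length xs = Suc (length L)"
    "\<forall>j<length L. xs ! j = real (fst (L ! j)) / 2 ^ snd (L ! j) \<and>
       xs ! Suc j = real (Suc (fst (L ! j))) / 2 ^ snd (L ! j)"
    using "2.IH" 2(2) by (auto simp: e_def)
  have dy: "real p / 2 ^ q \<in> dyadics" for p q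
    unfolding dyadics_def by (auto intro!: exI [of _ "int p"] exI [of _ q])
  have "set xs \<subseteq> dyadics"
    using xs(1,2,5,6) dy [of "Suc m" k] by (cases xs) (auto simp: e_def)
  moreover have "sorted_wrt (<) (a # xs)"
    using xs(1,2,4) ae by (cases xs) auto
  moreover have "(a # xs) ! j = real (fst (((m, k) # L) ! j)) / 2 ^ snd (((m, k) # L) ! j) \<and>
      (a # xs) ! Suc j = real (Suc (fst (((m, k) # L) ! j))) / 2 ^ snd (((m, k) # L) ! j)"
    if "j < length ((m, k) # L)" for j
  proof (cases j)
    case 0
    then show ?thesis
      using xs(1,2) a by (simp add: e_def hd_conv_nth)
  next
    case (Suc i)
    then show ?thesis
      using xs(7) that by simp
  qed
  ultimately show ?case
    using xs(1,3,6) a(1) dy by (intro exI [of _ "a # xs"]) auto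
qed

text \<open>A map that carries a dyadic tiling of \<open>[0,1]\<close> affinely onto another one has slopes
  \<open>2 ^ k / 2 ^ k'\<close>, and the end points of the first tiling contain its break points.\<close>

lemma thompson_homeos_of_tilings:
  assumes "\<forall>x. x \<notin> {0..1} \<longrightarrow> h x = x"
    and "tiling 0 L 1" "tiling 0 M 1" "list_all2 (maps_dyadic h) L M"
  shows "h \<in> thompson_homeos"
proof -
  have ne: "L \<noteq> []"
    using assms(2) by auto
  have h: "continuous_on {0..1} h" "strict_mono_on {0..1} h" "h 0 = 0" "h 1 = 1"
    using piecewise_affine_on_tilings [OF assms(2-4) ne] by auto
  have "h ` {0..1} = {0..1}"
  proof
    show "h ` {0..1} \<subseteq> {0..1}"
    proof (rule image_subsetI)
      fix x :: real
      assume "x \<in> {0..1}"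
      then show "h x \<in> {0..1}"
        using strict_mono_on_leD [OF h(2), of 0 x] strict_mono_on_leD [OF h(2), of x 1] h(3,4) by simp
    qed
    show "{0..1} \<subseteq> h ` {0..1}"
      using IVT' [of h 0 _ 1] h by fastforce
  qed
  then obtain g where g: "homeomorphism {0..1} {0..1} h g"
    using homeomorphism_compact [OF compact_Icc h(1)] strict_mono_on_imp_inj_on [OF h(2)] by metis
  obtain xs where xs: "xs \<noteq> []" "hd xs = 0" "last xs = 1" "sorted_wrt (<) xs"
    "set xs \<subseteq> dyadics" "length xs = Suc (length L)"
    "\<forall>j<length L. xs ! j = real (fst (L ! j)) / 2 ^ snd (L ! j) \<and>
       xs ! Suc j = real (Suc (fst (L ! j))) / 2 ^ snd (L ! j)"
    using tiling_break_points [OF assms(2)] ne by auto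
  have "\<exists>(k::int) c. \<forall>x\<in>{xs ! i..xs ! Suc i}. h x = 2 powi k * x + c" if "Suc i < length xs" for i
  proof -
    obtain m k m' k' where LM: "L ! i = (m, k)" "M ! i = (m', k')"
      by fastforce
    have i: "i < length L"
      using that xs(6) by simp
    have "maps_dyadic h (m, k) (m', k')"
      using list_all2_nthD [OF assms(4) i] LM by simp
    then have "h x = 2 powi (int k - int k') * x +
        (real m' / 2 ^ k' - 2 powi (int k - int k') * (real m / 2 ^ k))"
      if "x \<in> {xs ! i..xs ! Suc i}" for x
      using maps_dyadicD [of h m k m' k' x] that xs(7) i LM
      by (simp add: power_int_diff algebra_simps add_divide_distrib diff_divide_distrib)
    then show ?thesis by blast
  qed
  then show ?thesis
    unfolding thompson_homeos_def using assms(1) g h(2) xs by blast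
qed

section \<open>Good diagrams preserve the digit classes\<close>

text \<open>Since the top and the bottom path are single edges, the forests of the two halves of the cut
  are single trees. The intervals that the definition of \<open>represents\<close> assigns to an edge of the
  cutting path are the leaf intervals of the two trees.\<close>

lemma represents_tree_pair:
  assumes "represents \<Delta> h" "length (top_path \<Delta>) = 1" "length (bot_path \<Delta>) = 1"
  obtains T U where "tree_pair T U" "\<Delta> = pair_diagram T U" "\<forall>x. x \<notin> {0..1} \<longrightarrow> h x = x"
    "list_all2 (maps_dyadic h) (leaf_intervals T 0 0) (leaf_intervals U 0 0)"
proof -
  obtain \<Delta>p \<Delta>m where cut: "cut_diagram \<Delta> \<Delta>p \<Delta>m"
    and ivs: "\<forall>e\<in>set (bot_path \<Delta>p). \<exists>a b c d.
       edge_interval \<Delta>p e a b \<and> edge_interval (diagram_inv \<Delta>m) e c d \<and>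
       (\<forall>x\<in>{a..b}. h x = c + (d - c) / (b - a) * (x - a))"
    and id: "\<forall>x. x \<notin> {0..1} \<longrightarrow> h x = x"
    using assms(1) unfolding represents_def by blast
  have comp: "composable_diagrams \<Delta>p \<Delta>m" and \<Delta>: "\<Delta> = diagram_comp \<Delta>p \<Delta>m"
    using cut by (auto simp: cut_diagram_def)
  obtain ts where ts: "ts \<noteq> []" "wf_forest ts" "\<Delta>p = forest_diagram ts"
    using cut diagram_of_one_sign_is_forest(1) [of \<Delta>p] unfolding cut_diagram_def by blast
  obtain us where us: "us \<noteq> []" "wf_forest us" "diagram_inv \<Delta>m = forest_diagram us"
    using cut diagram_of_one_sign_is_forest(2) [of \<Delta>m] unfolding cut_diagram_def by blast
  have "length ts = 1"
    using assms(2) \<Delta> ts(3) by (simp add: diagram_comp_def forest_diagram_def)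
  then obtain T where T: "ts = [T]"
    by (auto simp: length_Suc_conv)
  have "bot_path \<Delta> = top_path (diagram_inv \<Delta>m)"
    using \<Delta> by (simp add: diagram_comp_def diagram_inv_def)
  then have "length us = 1"
    using assms(3) us(3) by (simp add: forest_diagram_def)
  then obtain U where U: "us = [U]"
    by (auto simp: length_Suc_conv)
  have p: "\<Delta>p = tree_diagram T" "wf_tree T" and m: "diagram_inv \<Delta>m = tree_diagram U" "wf_tree U"
    using ts us T U by (auto simp: forest_diagram_singleton)
  have m': "\<Delta>m = diagram_inv (tree_diagram U)"
    using m(1) by (metis diagram_inv_inv)
  have leaves: "leaves T = leaves U" "tree_edges T \<inter> tree_edges U = set (leaves T)"
    using comp unfolding composable_diagrams_def p(1) m'
    by (simp_all add: tree_diagram_def diagram_inv_def)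
  have pair: "tree_pair T U"
    using p(2) m(2) leaves by (simp add: tree_pair_def)
  have "maps_dyadic h (leaf_intervals T 0 0 ! j) (leaf_intervals U 0 0 ! j)"
    if j: "j < length (leaves T)" for j
  proof -
    have "leaves T ! j \<in> set (bot_path \<Delta>p)"
      using j p(1) by (simp add: tree_diagram_def)
    then obtain a b c d where i: "edge_interval (tree_diagram T) (leaves T ! j) a b"
      "edge_interval (tree_diagram U) (leaves T ! j) c d"
      "\<forall>x\<in>{a..b}. h x = c + (d - c) / (b - a) * (x - a)"
      using ivs m(1) p(1) by metis
    obtain m k where mk: "(leaves T ! j, m, k) \<in> nodes T 0 0" "a = real m / 2 ^ k"
      "b = real (Suc m) / 2 ^ k"
      using edge_interval_nodes [OF p(2) i(1)] .
    obtain m' k' where mk': "(leaves T ! j, m', k') \<in> nodes U 0 0" "c = real m' / 2 ^ k'"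
      "d = real (Suc m') / 2 ^ k'"
      using edge_interval_nodes [OF m(2) i(2)] .
    have "leaf_intervals T 0 0 ! j = (m, k)"
      using nodes_functional [OF p(2) mk(1)] leaf_intervals_in_nodes [OF j, of 0 0]
      by (metis prod.collapse)
    moreover have "leaf_intervals U 0 0 ! j = (m', k')"
      using nodes_functional [OF m(2) mk'(1)] leaf_intervals_in_nodes [of j U 0 0] j leaves(1)
      by (metis prod.collapse)
    moreover have "d - c = 1 / 2 ^ k'" "b - a = 1 / 2 ^ k"
      unfolding mk mk' by (simp_all add: diff_divide_distrib [symmetric])
    then have "(d - c) / (b - a) = 2 ^ k / 2 ^ k'"
      by simp
    ultimately show ?thesis
      using i(3) unfolding mk(2,3) mk'(2) by (simp add: maps_dyadic_def)
  qed
  then have "list_all2 (maps_dyadic h) (leaf_intervals T 0 0) (leaf_intervals U 0 0)"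
    using leaves(1) by (simp add: list_all2_conv_all_nth)
  moreover have "\<Delta> = pair_diagram T U"
    using \<Delta> p(1) m' by (simp add: pair_diagram_def)
  ultimately show thesis
    using that pair id by blast
qed

lemma digit_class_image_subset:
  assumes "tiling 0 L 1" "list_all2 (maps_dyadic h) L M" "h 1 = 1"
    and "\<And>j. j < length L \<Longrightarrow> fst (L ! j) < 2 ^ snd (L ! j) \<and> fst (M ! j) < 2 ^ snd (M ! j) \<and>
      [digit_sum (fst (L ! j)) = digit_sum (fst (M ! j))] (mod n)"
    and "x \<in> digit_class n i"
  shows "h x \<in> digit_class n i"
proof (cases "x = 1")
  case True
  then show ?thesis
    using assms(3,5) by simp
next
  case False
  then have "0 \<le> x" "x < 1"
    using assms(5) by (auto simp: digit_class_def)
  then obtain j where j: "j < length L" "real (fst (L ! j)) / 2 ^ snd (L ! j) \<le> x"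
    "x < real (Suc (fst (L ! j))) / 2 ^ snd (L ! j)"
    using tiling_covers [OF assms(1)] by blast
  have map: "maps_dyadic h (fst (L ! j), snd (L ! j)) (fst (M ! j), snd (M ! j))"
    using list_all2_nthD [OF assms(2) j(1)] by simp
  show ?thesis
    using digit_class_affine_image [OF _ _ _ map assms(5) j(2,3)] assms(4) [OF j(1)] by blast
qed

lemma leaf_intervals_bound:
  assumes "j < length (leaves t)"
  shows "fst (leaf_intervals t 0 0 ! j) < 2 ^ snd (leaf_intervals t 0 0 ! j)"
  using nodes_bound [of "leaves t ! j" _ _ t 0 0] leaf_intervals_in_nodes [OF assms, of 0 0]
  by (metis less_numeral_extra(1) power_0 prod.collapse)

lemma leaf_intervals_digit_weight:
  assumes "digit_weight t w" "j < length (leaves t)"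
  shows "w (source (leaves t ! j)) = digit_sum (fst (leaf_intervals t 0 0 ! j))"
  using assms leaf_intervals_in_nodes [OF assms(2), of 0 0] unfolding digit_weight_def
  by (metis prod.collapse)

text \<open>Goodness compares the sums of digits at the left end points of the leaf intervals of both trees.
  The comparison is symmetric, so both \<open>h\<close> and its inverse map the class into itself.\<close>

lemma jones_subgroup_stabilizes:
  assumes "h \<in> jones_subgroup n"
  shows "h \<in> thompson_homeos" "h ` digit_class n i = digit_class n i"
proof -
  obtain \<Delta> where \<Delta>: "\<Delta> \<in> reduced_F_diagrams" "n_good n \<Delta>" "represents \<Delta> h"
    using assms by (auto simp: jones_subgroup_def jones_diagrams_def)
  then obtain T U where TU: "tree_pair T U" "\<Delta> = pair_diagram T U" "\<forall>x. x \<notin> {0..1} \<longrightarrow> h x = x"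
    "list_all2 (maps_dyadic h) (leaf_intervals T 0 0) (leaf_intervals U 0 0)"
    using represents_tree_pair unfolding reduced_F_diagrams_def by blast
  let ?L = "leaf_intervals T 0 0" and ?M = "leaf_intervals U 0 0"
  have wf: "wf_tree T" "wf_tree U" "leaves T = leaves U"
    using TU(1) by (auto simp: tree_pair_def)
  show h: "h \<in> thompson_homeos"
    using thompson_homeos_of_tilings TU(3,4) leaf_intervals_tiling_unit by blast
  have ends: "h 1 = 1"
    using piecewise_affine_on_tilings [OF leaf_intervals_tiling_unit leaf_intervals_tiling_unit TU(4)]
      leaves_nonempty [of T] by (metis length_0_conv length_leaf_intervals)
  obtain g where "homeomorphism {0..1} {0..1} h g"
    using h unfolding thompson_homeos_def mem_Collect_eq by (elim conjE exE)
  then have g: "\<And>x. x \<in> {0..1} \<Longrightarrow> g (h x) = x" "\<And>y. y \<in> {0..1} \<Longrightarrow> h (g y) = y"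
    by (simp_all add: homeomorphism_apply1 homeomorphism_apply2)
  \<comment> \<open>The left end of a leaf is an inner vertex or the initial vertex, where both weights vanish.\<close>
  obtain w w' where w: "digit_weight T w" "digit_weight U w'"
    using vertex_digit_sums [OF wf(1), of 0 0] vertex_digit_sums [OF wf(2), of 0 0]
    unfolding digit_weight_def by blast
  have good: "[w v = w' v] (mod n)"
    if "v \<in> tree_vertices T" "v \<noteq> source (top_edge T)" "v \<noteq> target (top_edge T)" for v
    using \<Delta>(2) that n_good_pair_diagram [OF TU(1) w] TU(2) by simp
  have cong: "fst (?L ! j) < 2 ^ snd (?L ! j) \<and> fst (?M ! j) < 2 ^ snd (?M ! j) \<and>
      [digit_sum (fst (?L ! j)) = digit_sum (fst (?M ! j))] (mod n)" if j: "j < length ?L" for j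
  proof -
    let ?v = "source (leaves T ! j)"
    have e: "leaves T ! j \<in> tree_edges T"
      using j leaves_subset_tree_edges [of T] by auto
    have "w (source (top_edge T)) = 0" "w' (source (top_edge T)) = 0"
      using w top_edge_in_nodes tree_pair_ends(1) [OF TU(1)] unfolding digit_weight_def
      by (metis digit_sum_0)+
    then have "[w ?v = w' ?v] (mod n)"
      using good [of ?v] edge_ends_in_tree_vertices(1) [OF wf(1) e]
        no_edge_into_source_or_out_of_target(2) [OF wf(1) e] by (cases "?v = source (top_edge T)") auto
    then show ?thesis
      using leaf_intervals_digit_weight [OF w(1), of j] leaf_intervals_digit_weight [OF w(2), of j]
        leaf_intervals_bound [of j] j wf(3) by simp
  qed
  have "h x \<in> digit_class n i" if "x \<in> digit_class n i" for x
    using digit_class_image_subset [OF leaf_intervals_tiling_unit TU(4) ends cong that] .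
  moreover have "y \<in> h ` digit_class n i" if y: "y \<in> digit_class n i" for y
  proof -
    have inv: "maps_dyadic g (?M ! j) (?L ! j)" if j: "j < length ?M" for j
    proof -
      obtain m k m' k' where eq: "?L ! j = (m, k)" "?M ! j = (m', k')"
        by fastforce
      have j': "j < length ?L"
        using j wf(3) by simp
      have m: "m < 2 ^ k"
        using cong [OF j'] eq by simp
      have "maps_dyadic g (m', k') (m, k)"
      proof (rule maps_dyadic_inverse)
        show "maps_dyadic h (m, k) (m', k')"
          using list_all2_nthD [OF TU(4) j'] eq by simp
        show "g (h x) = x" if "real m / 2 ^ k \<le> x" "x \<le> real (Suc m) / 2 ^ k" for x
          using g(1) [OF dyadic_interval_in_unit [OF m that]] .
      qed
      then show ?thesis
        using eq by simp
    qed
    have "list_all2 (maps_dyadic g) ?M ?L"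
      using inv wf(3) by (simp add: list_all2_conv_all_nth)
    moreover have "g 1 = 1"
      using g(1) [of 1] ends by simp
    ultimately have "g y \<in> digit_class n i"
      using y cong wf(3) cong_sym by (intro digit_class_image_subset [of ?M g ?L])
        (auto simp: leaf_intervals_tiling_unit)
    moreover have "h (g y) = y"
      using g(2) y by (auto simp: digit_class_def)
    ultimately show ?thesis
      by (metis imageI)
  qed
  ultimately show "h ` digit_class n i = digit_class n i"
    by blast
qed

section \<open>Homeomorphisms on short dyadic intervals\<close>

text \<open>In this form finitely many dyadic fractions get a common denominator by intersecting eventual
  statements.\<close>

lemma dyadics_eventually:
  "x \<in> dyadics \<longleftrightarrow> (\<forall>\<^sub>F n in sequentially. 2 ^ n * x \<in> \<int>)"
proof
  assume "x \<in> dyadics"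
  then obtain m :: int and k where x: "x = of_int m / 2 ^ k"
    by (auto simp: dyadics_def)
  have "2 ^ n * x \<in> \<int>" if nk: "k \<le> n" for n
  proof -
    obtain d where "n = k + d"
      using le_Suc_ex [OF nk] by blast
    then have "2 ^ n * x = of_int (2 ^ d * m)"
      by (simp add: x power_add)
    then show ?thesis
      by (metis Ints_of_int)
  qed
  then show "\<forall>\<^sub>F n in sequentially. 2 ^ n * x \<in> \<int>"
    by (auto simp: eventually_sequentially)
next
  assume "\<forall>\<^sub>F n in sequentially. 2 ^ n * x \<in> \<int>"
  then obtain n where "2 ^ n * x \<in> \<int>"
    by (auto simp: eventually_sequentially)
  then obtain m :: int where "2 ^ n * x = of_int m"
    by (auto elim: Ints_cases)
  then have "x = of_int m / 2 ^ n"
    by (simp add: field_simps)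
  then show "x \<in> dyadics"
    by (auto simp: dyadics_def)
qed

lemma dyadics_shift:
  assumes "x \<in> dyadics"
  shows "\<forall>\<^sub>F n in sequentially. \<exists>n'. int n' = int n - p \<and> 2 ^ n' * x \<in> \<int>"
proof -
  obtain N where N: "\<And>n. n \<ge> N \<Longrightarrow> 2 ^ n * x \<in> \<int>"
    using assms by (auto simp: dyadics_eventually eventually_sequentially)
  have "\<exists>n'. int n' = int n - p \<and> 2 ^ n' * x \<in> \<int>" if "n \<ge> N + nat p" for n
    using that N [of "nat (int n - p)"] by (intro exI [of _ "nat (int n - p)"]) auto
  then show ?thesis
    by (auto simp: eventually_sequentially)
qed

lemma dyadics_diff:
  assumes "x \<in> dyadics" "y \<in> dyadics"
  shows "x - y \<in> dyadics"
  using assms unfolding dyadics_eventually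
  by eventually_elim (simp add: right_diff_distrib)

lemma dyadics_power_int:
  assumes "x \<in> dyadics"
  shows "2 powi p * x \<in> dyadics"
  unfolding dyadics_eventually
  using dyadics_shift [OF assms, of "- p"]
proof eventually_elim
  case (elim n)
  then obtain n' where n': "int n' = int n + p" "2 ^ n' * x \<in> \<int>"
    by auto
  have "2 ^ n * (2 powi p * x) = 2 powi (int n + p) * x"
    by (simp add: power_int_add)
  also have "\<dots> = 2 ^ n' * x"
    using n'(1) by (metis power_int_of_nat)
  finally have eq: "2 ^ n * (2 powi p * x) = 2 ^ n' * x" .
  show ?case
    unfolding eq by (rule n'(2))
qed

lemma list_crossing:
  fixes x :: real
  assumes "xs \<noteq> []" "hd xs \<le> x" "x < last xs"
  obtains j where "Suc j < length xs" "xs ! j \<le> x" "x < xs ! Suc j"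
proof -
  have "\<exists>j. Suc j < length xs \<and> xs ! j \<le> x \<and> x < xs ! Suc j"
    using assms
  proof (induction xs)
    case (Cons a xs)
    show ?case
    proof (cases "xs = []")
      case False
      show ?thesis
      proof (cases "x < hd xs")
        case True
        then show ?thesis
          using Cons.prems False by (intro exI [of _ 0]) (auto simp: hd_conv_nth)
      next
        case False
        then obtain j where "Suc j < length xs" "xs ! j \<le> x" "x < xs ! Suc j"
          using Cons \<open>xs \<noteq> []\<close> by force
        then show ?thesis
          by (intro exI [of _ "Suc j"]) auto
      qed
    qed (use Cons.prems in auto)
  qed simp
  then show thesis
    using that by blast
qed

text \<open>On a piece \<open>f x = 2 powi p * x + c\<close> with dyadic \<open>c\<close>, an interval \<open>(m, k)\<close> is mapped to one of
  length \<open>1 / 2 ^ (k - p)\<close> with left end \<open>(m + 2 ^ (k - p) * c) / 2 ^ (k - p)\<close>. For large \<open>k\<close> the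
  exponent \<open>k - p\<close> is nonnegative, the numerator is an integer, and, since the end points of the
  pieces are multiples of \<open>1 / 2 ^ k\<close>, every interval \<open>(m, k)\<close> lies inside a single piece.\<close>

lemma piecewise_affine_maps_deep_intervals:
  assumes "xs \<noteq> []" "hd xs = 0" "last xs = 1" "set xs \<subseteq> dyadics" "f ` set xs \<subseteq> dyadics"
    and "f ` {0..1} \<subseteq> {0..1}"
    and pieces: "\<And>i. Suc i < length xs \<Longrightarrow>
      \<exists>(p::int) c. \<forall>x\<in>{xs ! i..xs ! Suc i}. f x = 2 powi p * x + c"
  shows "\<exists>K. \<forall>k\<ge>K. \<forall>m<2 ^ k. \<exists>J. maps_dyadic f (m, k) J"
proof -
  have "\<forall>\<^sub>F k in sequentially. \<forall>x\<in>set xs. 2 ^ k * x \<in> \<int>"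
    using assms(4) by (intro eventually_ball_finite) (auto simp: dyadics_eventually)
  moreover have "\<forall>\<^sub>F k in sequentially. \<forall>i\<in>{i. Suc i < length xs \<and> xs ! i < xs ! Suc i}.
      \<exists>p c k'. (\<forall>x\<in>{xs ! i..xs ! Suc i}. f x = 2 powi p * x + c) \<and>
        int k' = int k - p \<and> 2 ^ k' * c \<in> \<int>"
  proof (intro eventually_ball_finite ballI)
    show "finite {i. Suc i < length xs \<and> xs ! i < xs ! Suc i}"
      by (rule finite_subset [of _ "{..<length xs}"]) auto
    fix i
    assume i: "i \<in> {i. Suc i < length xs \<and> xs ! i < xs ! Suc i}"
    then obtain p :: int and c where pc: "\<forall>x\<in>{xs ! i..xs ! Suc i}. f x = 2 powi p * x + c"
      using pieces by blast
    have "c = f (xs ! i) - 2 powi p * (xs ! i)"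
      using pc i by simp
    moreover have "xs ! i \<in> set xs"
      using i by simp
    ultimately have "c \<in> dyadics"
      using assms(4,5) dyadics_diff dyadics_power_int by blast
    from dyadics_shift [OF this, of p]
    show "\<forall>\<^sub>F k in sequentially. \<exists>p c k'. (\<forall>x\<in>{xs ! i..xs ! Suc i}. f x = 2 powi p * x + c) \<and>
        int k' = int k - p \<and> 2 ^ k' * c \<in> \<int>"
      by eventually_elim (use pc in blast)
  qed
  ultimately have "\<forall>\<^sub>F k in sequentially. \<forall>m<2 ^ k. \<exists>J. maps_dyadic f (m, k) J"
  proof eventually_elim
    case (elim k)
    show ?case
    proof (intro allI impI)
      fix m :: nat
      assume "m < 2 ^ k"
      then have m: "real (Suc m) \<le> 2 ^ k"
        by (metis Suc_leI of_nat_le_iff of_nat_numeral of_nat_power)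
      then have "real m < 2 ^ k"
        unfolding of_nat_Suc by linarith
      then have "real m / 2 ^ k < 1"
        by simp
      then obtain j where j: "Suc j < length xs" "xs ! j \<le> real m / 2 ^ k" "real m / 2 ^ k < xs ! Suc j"
        using list_crossing [OF assms(1), of "real m / 2 ^ k"] assms(2,3) by auto
      have "2 ^ k * (xs ! Suc j) \<in> \<int>"
        using elim(1) j(1) by simp
      then obtain a :: int where a: "2 ^ k * (xs ! Suc j) = of_int a"
        by (auto elim: Ints_cases)
      have "real m < 2 ^ k * (xs ! Suc j)"
        using j(3) by (simp add: field_simps)
      then have "int m < a"
        unfolding a by linarith
      then have "real (Suc m) \<le> 2 ^ k * (xs ! Suc j)"
        unfolding a by linarith
      then have hi: "real (Suc m) / 2 ^ k \<le> xs ! Suc j"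
        by (simp add: field_simps)
      have "j \<in> {i. Suc i < length xs \<and> xs ! i < xs ! Suc i}"
        using j by simp
      then obtain p :: int and c k' where p: "\<forall>x\<in>{xs ! j..xs ! Suc j}. f x = 2 powi p * x + c"
        "int k' = int k - p" "2 ^ k' * c \<in> \<int>"
        using elim(2) by blast
      have slope: "2 powi p = (2 ^ k / 2 ^ k' :: real)"
      proof -
        have "p = int k - int k'"
          using p(2) by simp
        then show ?thesis
          by (simp add: power_int_diff)
      qed
      define y where "y = f (real m / 2 ^ k)"
      have y: "y = 2 ^ k / 2 ^ k' * (real m / 2 ^ k) + c"
        using p(1) j(2,3) slope unfolding y_def by simp
      then have "2 ^ k' * y = real m + 2 ^ k' * c"
        by (simp add: field_simps)
      then have "2 ^ k' * y \<in> \<int>"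
        using p(3) by simp
      moreover have "real m / 2 ^ k \<in> {0..1}"
        using \<open>real m / 2 ^ k < 1\<close> by simp
      then have "0 \<le> y"
        using assms(6) unfolding y_def by (metis atLeastAtMost_iff image_subset_iff)
      then have "0 \<le> 2 ^ k' * y"
        by simp
      ultimately obtain m' where m': "2 ^ k' * y = real m'"
        by (metis Ints_cases of_int_0_le_iff of_int_of_nat_eq zero_le_imp_eq_int)
      have "f x = real m' / 2 ^ k' + 2 ^ k / 2 ^ k' * (x - real m / 2 ^ k)"
        if x: "x \<in> {real m / 2 ^ k..real (Suc m) / 2 ^ k}" for x
      proof -
        have "x \<in> {xs ! j..xs ! Suc j}"
          using x j(2) hi by (meson atLeastAtMost_iff order_trans)
        then have "f x = 2 ^ k / 2 ^ k' * x + c"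
          using p(1) slope by simp
        moreover have "real m' / 2 ^ k' = y"
          using m' by (simp add: field_simps)
        ultimately show ?thesis
          unfolding right_diff_distrib using y by linarith
      qed
      then have "maps_dyadic f (m, k) (m', k')"
        by (simp add: maps_dyadic_def)
      then show "\<exists>J. maps_dyadic f (m, k) J"
        by blast
    qed
  qed
  then show ?thesis
    by (auto simp: eventually_sequentially)
qed

text \<open>Starting from \<open>h 0 = 0\<close>, the images of the break points are dyadic one after the other, because
  the slopes are powers of 2. So the inverse has a subdivision of the same kind, formed by these
  images.\<close>

lemma thompson_homeo_maps_deep_intervals:
  assumes "h \<in> thompson_homeos" and g: "homeomorphism {0..1} {0..1} h g"
  shows "\<exists>K. \<forall>k\<ge>K. \<forall>m<2 ^ k. \<exists>J. maps_dyadic h (m, k) J"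
    and "\<exists>K. \<forall>k\<ge>K. \<forall>m<2 ^ k. \<exists>J. maps_dyadic g (m, k) J"
    and "h 0 = 0" "h 1 = 1"
proof -
  have mono: "strict_mono_on {0..1} h"
    using assms(1) by (simp add: thompson_homeos_def)
  have img: "h ` {0..1} = {0..1}" "g ` {0..1} = {0..1}"
    using g by (auto simp: homeomorphism_def)
  have hg: "h (g y) = y" if "y \<in> {0..1}" for y
    using homeomorphism_apply2 [OF g that] .
  have gh: "g (h x) = x" if "x \<in> {0..1}" for x
    using homeomorphism_apply1 [OF g that] .
  have g01: "g y \<in> {0..1}" if "y \<in> {0..1}" for y
    using img(2) that by blast
  have h01: "h y \<in> {0..1}" if "y \<in> {0..1}" for y
    using img(1) that by blast
  have "h 0 \<le> h (g 0)"
    using strict_mono_on_leD [OF mono, of 0 "g 0"] g01 [of 0] by simp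
  then show h0: "h 0 = 0"
    using hg [of 0] h01 [of 0] by simp
  have "h (g 1) \<le> h 1"
    using strict_mono_on_leD [OF mono, of "g 1" 1] g01 [of 1] by simp
  then show h1: "h 1 = 1"
    using hg [of 1] h01 [of 1] by simp
  have "\<exists>xs. xs \<noteq> [] \<and> hd xs = 0 \<and> last xs = 1 \<and> sorted_wrt (<) xs \<and> set xs \<subseteq> dyadics \<and>
      (\<forall>i. Suc i < length xs \<longrightarrow> (\<exists>(k::int) c. \<forall>x\<in>{xs ! i..xs ! Suc i}. h x = 2 powi k * x + c))"
    using assms(1) by (simp add: thompson_homeos_def)
  then obtain xs where xs: "xs \<noteq> []" "hd xs = 0" "last xs = 1" "sorted_wrt (<) xs"
    "set xs \<subseteq> dyadics" and pieces: "\<And>i. Suc i < length xs \<Longrightarrow>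
      \<exists>(p::int) c. \<forall>x\<in>{xs ! i..xs ! Suc i}. h x = 2 powi p * x + c"
    by (elim exE conjE) blast
  have step: "xs ! i < xs ! Suc i" if "Suc i < length xs" for i
    using xs(4) that by (simp add: sorted_wrt_iff_nth_less)
  have "h (xs ! i) \<in> dyadics" if "i < length xs" for i
    using that
  proof (induction i)
    case 0
    have "xs ! 0 = 0"
      using xs(1,2) by (simp add: hd_conv_nth)
    moreover have "0 \<in> dyadics"
      by (auto simp: dyadics_def intro!: exI [of _ "0::int"])
    ultimately show ?case
      using h0 by simp
  next
    case (Suc i)
    obtain p :: int and c where pc: "\<forall>x\<in>{xs ! i..xs ! Suc i}. h x = 2 powi p * x + c"
      using pieces [OF Suc.prems] by blast
    have "h (xs ! i) = 2 powi p * (xs ! i) + c" "h (xs ! Suc i) = 2 powi p * (xs ! Suc i) + c"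
      using pc step [OF Suc.prems] by auto
    then have "h (xs ! Suc i) = h (xs ! i) - (2 powi p * (xs ! i) - 2 powi p * (xs ! Suc i))"
      by simp
    moreover have "xs ! i \<in> dyadics" "xs ! Suc i \<in> dyadics"
      using xs(5) Suc.prems by auto
    ultimately show ?case
      using Suc.IH Suc.prems by (simp add: dyadics_diff dyadics_power_int)
  qed
  then have hxs: "h ` set xs \<subseteq> dyadics"
    by (auto simp: in_set_conv_nth)
  show "\<exists>K. \<forall>k\<ge>K. \<forall>m<2 ^ k. \<exists>J. maps_dyadic h (m, k) J"
    using xs hxs img pieces by (intro piecewise_affine_maps_deep_intervals) auto
  have xs01: "set xs \<subseteq> {0..1}"
  proof
    fix x
    assume "x \<in> set xs"
    then obtain i where i: "i < length xs" "x = xs ! i"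
      by (auto simp: in_set_conv_nth)
    have sorted: "sorted xs"
      using xs(4) by (rule strict_sorted_imp_sorted)
    have "xs ! 0 \<le> xs ! i" "xs ! i \<le> xs ! (length xs - 1)"
      using i sorted by (auto intro!: sorted_nth_mono)
    then show "x \<in> {0..1}"
      using xs(1-3) i(2) by (simp add: hd_conv_nth last_conv_nth)
  qed
  show "\<exists>K. \<forall>k\<ge>K. \<forall>m<2 ^ k. \<exists>J. maps_dyadic g (m, k) J"
  proof (rule piecewise_affine_maps_deep_intervals)
    show "map h xs \<noteq> []" "hd (map h xs) = 0" "last (map h xs) = 1"
      using xs h0 h1 by (simp_all add: hd_map last_map)
    show "set (map h xs) \<subseteq> dyadics"
      using hxs by simp
    have "g ` h ` set xs = set xs"
      using gh xs01 by (force simp: image_image)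
    then show "g ` set (map h xs) \<subseteq> dyadics"
      using xs(5) by simp
    show "g ` {0..1} \<subseteq> {0..1}"
      using img by simp
    fix i
    assume "Suc i < length (map h xs)"
    then have i: "Suc i < length xs"
      by simp
    obtain p :: int and c where pc: "\<forall>x\<in>{xs ! i..xs ! Suc i}. h x = 2 powi p * x + c"
      using pieces [OF i] by blast
    have in01: "xs ! i \<in> {0..1}" "xs ! Suc i \<in> {0..1}"
      using subsetD [OF xs01 nth_mem, of i] subsetD [OF xs01 nth_mem, of "Suc i"] i by auto
    have "g y = 2 powi (- p) * y + - (2 powi (- p) * c)" if y: "y \<in> {h (xs ! i)..h (xs ! Suc i)}" for y
    proof -
      have y01: "y \<in> {0..1}"
        using y h01 [OF in01(1)] h01 [OF in01(2)] by auto
      have "xs ! i \<le> g y"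
      proof (rule ccontr)
        assume "\<not> xs ! i \<le> g y"
        then have "h (g y) < h (xs ! i)"
          using mono in01 g01 [OF y01] by (simp add: strict_mono_on_def)
        then show False
          using hg [OF y01] y by simp
      qed
      moreover have "g y \<le> xs ! Suc i"
      proof (rule ccontr)
        assume "\<not> g y \<le> xs ! Suc i"
        then have "h (xs ! Suc i) < h (g y)"
          using mono in01 g01 [OF y01] by (simp add: strict_mono_on_def)
        then show False
          using hg [OF y01] y by simp
      qed
      ultimately have "y = 2 powi p * g y + c"
        using pc hg [OF y01] by (metis atLeastAtMost_iff)
      then have "2 powi (- p) * (y - c) = 2 powi (- p) * (2 powi p * g y)"
        by simp
      also have "\<dots> = g y"
        by (simp add: power_int_minus)
      finally show ?thesis
        by (simp add: right_diff_distrib)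
    qed
    moreover have "map h xs ! i = h (xs ! i)" "map h xs ! Suc i = h (xs ! Suc i)"
      using i by simp_all
    ultimately show "\<exists>(p::int) c. \<forall>x\<in>{map h xs ! i..map h xs ! Suc i}. g x = 2 powi p * x + c"
      by metis
  qed
qed

section \<open>Trees of maximal intervals\<close>

text \<open>The interval \<open>(m, k)\<close> is halved until \<open>P\<close> holds; the argument of type \<open>nat\<close> following the label
  \<open>c\<close> bounds the number of halvings. The vertices are numbered from left to right starting with
  \<open>i\<close>. Leaves get label 0 and inner edges get label \<open>c\<close>, so that trees built with different
  labels share only leaves.\<close>

fun maximal_tree :: "(nat \<Rightarrow> nat \<Rightarrow> bool) \<Rightarrow> nat \<Rightarrow> nat \<Rightarrow> nat \<Rightarrow> nat \<Rightarrow> nat \<Rightarrow> edge_tree" where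
  "maximal_tree P c 0 i m k = Leaf (Edge 0 i (Suc i))"
| "maximal_tree P c (Suc d) i m k =
     (if P m k then Leaf (Edge 0 i (Suc i))
      else let l = maximal_tree P c d i (2 * m) (Suc k);
               j = i + length (leaves l);
               r = maximal_tree P c d j (Suc (2 * m)) (Suc k)
           in Node (Edge c i (j + length (leaves r))) l r)"

definition numbered_tree :: "nat \<Rightarrow> nat \<Rightarrow> edge_tree \<Rightarrow> bool" where
  "numbered_tree c i t \<longleftrightarrow> wf_tree t \<and> source (top_edge t) = i \<and>
     target (top_edge t) = i + length (leaves t) \<and>
     leaves t = map (\<lambda>j. Edge 0 j (Suc j)) [i..<i + length (leaves t)] \<and>
     (\<forall>e\<in>tree_edges t. i \<le> source e \<and> source e < target e \<and> target e \<le> i + length (leaves t) \<and>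
        (e \<in> set (leaves t) \<or> label e = c))"

lemma numbered_tree_vertices:
  assumes "numbered_tree c i t"
  shows "tree_vertices t = {i..i + length (leaves t)}"
proof -
  let ?n = "length (leaves t)"
  have range: "{i..<i + n} \<union> Suc ` {i..<i + n} = {i..i + n}" if "n > 0" for n
    using that by (auto simp: image_Suc_atLeastLessThan)
  have "path_vertices (map (\<lambda>j. Edge 0 j (Suc j)) [i..<i + ?n]) = {i..<i + ?n} \<union> Suc ` {i..<i + ?n}"
    by (auto simp: path_vertices_def image_image)
  also have "\<dots> = {i..i + ?n}"
    by (rule range) simp
  finally have "path_vertices (map (\<lambda>j. Edge 0 j (Suc j)) [i..<i + ?n]) = {i..i + ?n}" .
  moreover have "leaves t = map (\<lambda>j. Edge 0 j (Suc j)) [i..<i + ?n]"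
    using assms unfolding numbered_tree_def by blast
  ultimately show ?thesis
    by (simp add: tree_vertices_leaves)
qed

lemma numbered_tree_Leaf: "numbered_tree c i (Leaf (Edge 0 i (Suc i)))"
  by (simp add: numbered_tree_def)

lemma numbered_tree_Node:
  assumes l: "numbered_tree c i l" and r: "numbered_tree c (i + length (leaves l)) r"
  shows "numbered_tree c i
    (Node (Edge c i (i + length (leaves l) + length (leaves r))) l r)"
proof -
  let ?a = "length (leaves l)" and ?b = "length (leaves r)"
  let ?e = "Edge c i (i + ?a + ?b)"
  have pos: "?a > 0" "?b > 0"
    by simp_all
  have el: "i \<le> source e" "source e < target e" "target e \<le> i + ?a"
    "e \<in> set (leaves l) \<or> label e = c" if "e \<in> tree_edges l" for e
    using l that by (auto simp: numbered_tree_def)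
  have er: "i + ?a \<le> source e" "source e < target e" "target e \<le> i + ?a + ?b"
    "e \<in> set (leaves r) \<or> label e = c" if "e \<in> tree_edges r" for e
    using r that by (auto simp: numbered_tree_def)
  have disj: "tree_edges l \<inter> tree_edges r = {}"
    using el(2,3) er(1) by fastforce
  have notin: "?e \<notin> tree_edges l" "?e \<notin> tree_edges r"
    using el(3) [of ?e] er(1) [of ?e] pos by auto
  have "tree_vertices l \<inter> tree_vertices r = {i + ?a}"
    using numbered_tree_vertices [OF l] numbered_tree_vertices [OF r] by auto
  then have wf: "wf_tree (Node ?e l r)"
    using l r disj notin by (simp add: numbered_tree_def)
  have "leaves l @ leaves r =
      map (\<lambda>j. Edge 0 j (Suc j)) ([i..<i + ?a] @ [i + ?a..<i + ?a + ?b])"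
    using l r unfolding numbered_tree_def map_append by metis
  also have "[i..<i + ?a] @ [i + ?a..<i + ?a + ?b] = [i..<i + ?a + ?b]"
    by (metis le_add1 upt_add_eq_append)
  finally have lv: "leaves l @ leaves r = map (\<lambda>j. Edge 0 j (Suc j)) [i..<i + (?a + ?b)]"
    by (simp add: add.assoc)
  have "i \<le> source e \<and> source e < target e \<and> target e \<le> i + (?a + ?b) \<and>
      (e \<in> set (leaves l @ leaves r) \<or> label e = c)" if "e \<in> tree_edges (Node ?e l r)" for e
  proof -
    consider "e = ?e" | "e \<in> tree_edges l" | "e \<in> tree_edges r"
      using \<open>e \<in> tree_edges (Node ?e l r)\<close> by auto
    then show ?thesis
    proof cases
      case 1
      then show ?thesis using pos by simp
    next
      case 2
      then show ?thesis using el [OF 2] by auto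
    next
      case 3
      then show ?thesis using er [OF 3] by auto
    qed
  qed
  then show ?thesis
    unfolding numbered_tree_def using wf lv by simp
qed

lemma numbered_maximal_tree: "numbered_tree c i (maximal_tree P c d i m k)"
  by (induction P c d i m k rule: maximal_tree.induct)
    (auto simp: Let_def numbered_tree_Leaf intro!: numbered_tree_Node)

text \<open>The numbering determines the leaves, and the labels 1 and 2 separate all other edges.\<close>

lemma numbered_tree_pair:
  assumes "numbered_tree 1 0 T" "numbered_tree 2 0 U" "length (leaves T) = length (leaves U)"
  shows "tree_pair T U"
proof -
  have "leaves T = map (\<lambda>j. Edge 0 j (Suc j)) [0..<0 + length (leaves T)]"
    using assms(1) unfolding numbered_tree_def by blast
  also have "\<dots> = map (\<lambda>j. Edge 0 j (Suc j)) [0..<0 + length (leaves U)]"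
    using assms(3) by simp
  also have "\<dots> = leaves U"
    using assms(2) unfolding numbered_tree_def by metis
  finally have eq: "leaves T = leaves U" .
  have "e \<in> set (leaves T)" if e: "e \<in> tree_edges T" "e \<in> tree_edges U" for e
  proof (rule ccontr)
    assume "e \<notin> set (leaves T)"
    then have "label e = 1" "label e = 2"
      using assms(1,2) e eq unfolding numbered_tree_def by (blast, metis)
    then show False by simp
  qed
  moreover have "set (leaves T) \<subseteq> tree_edges T" "set (leaves T) \<subseteq> tree_edges U"
    using leaves_subset_tree_edges [of T] leaves_subset_tree_edges [of U] eq by auto
  ultimately have "tree_edges T \<inter> tree_edges U = set (leaves T)"
    by blast
  then show ?thesis
    using assms(1,2) eq by (simp add: tree_pair_def numbered_tree_def)
qed

text \<open>The interval \<open>(m div 2, k - 1)\<close> is the dyadic interval of twice the length containing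
  \<open>(m, k)\<close>, its parent in every tree; \<open>[0,1]\<close> is the root and has no parent.\<close>

definition maximal_interval :: "(nat \<Rightarrow> nat \<Rightarrow> bool) \<Rightarrow> nat \<times> nat \<Rightarrow> bool" where
  "maximal_interval P I \<longleftrightarrow> P (fst I) (snd I) \<and>
     (snd I = 0 \<or> \<not> P (fst I div 2) (snd I - 1))"

lemma maximal_tree_leaf_intervals:
  assumes "\<forall>k'\<ge>K. \<forall>m'<2 ^ k'. P m' k'" "K \<le> k + d" "m < 2 ^ k"
    and "k = 0 \<or> \<not> P (m div 2) (k - 1)"
    and "I \<in> set (leaf_intervals (maximal_tree P c d i m k) m k)"
  shows "maximal_interval P I"
  using assms(2-)
proof (induction d arbitrary: i m k)
  case 0
  then show ?case
    using assms(1) by (auto simp: maximal_interval_def)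
next
  case (Suc d)
  show ?case
  proof (cases "P m k")
    case True
    then show ?thesis
      using Suc.prems by (auto simp: maximal_interval_def)
  next
    case False
    have "2 * m < 2 ^ Suc k" "Suc (2 * m) < 2 ^ Suc k"
      using Suc.prems(2) by auto
    then show ?thesis
      using Suc.IH [of "Suc k" "2 * m"] Suc.IH [of "Suc k" "Suc (2 * m)"] Suc.prems False
      by (auto simp: Let_def)
  qed
qed

lemma maximal_tree_inner_intervals:
  assumes "(e, p, q) \<in> nodes (maximal_tree P c d i m k) m k"
    and "e \<notin> set (leaves (maximal_tree P c d i m k))"
  shows "\<not> P p q"
  using assms
proof (induction d arbitrary: i m k)
  case (Suc d)
  show ?case
  proof (cases "P m k")
    case False
    then show ?thesis
      using Suc.prems Suc.IH [of i "2 * m" "Suc k"] Suc.IH [of _ "Suc (2 * m)" "Suc k"]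
      by (auto simp: Let_def)
  qed (use Suc.prems in auto)
qed simp

text \<open>If the intervals had different lengths, then the parent of the shorter one would be an initial part of
  the longer one, and \<open>P\<close> would hold for it by repeated halving.\<close>

lemma maximal_intervals_same_start:
  assumes refine: "\<And>m k. P m k \<Longrightarrow> P (2 * m) (Suc k)"
    and "maximal_interval P (m, k)" "maximal_interval P (p, q)" "real m / 2 ^ k = real p / 2 ^ q"
  shows "(m, k) = (p, q)"
proof -
  have less: False if "maximal_interval P (m, k)" "maximal_interval P (p, q)"
    "real m / 2 ^ k = real p / 2 ^ q" "k < q" for m k p q
  proof -
    define j where "j = q - Suc k"
    have q: "q = Suc (k + j)"
      using that(4) by (simp add: j_def)
    have "real (m * 2 ^ Suc j) = real p"
      using that(3) by (simp add: q field_simps power_add)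
    then have p: "p = m * 2 ^ Suc j"
      by linarith
    have "P (m * 2 ^ j) (k + j)" for j
    proof (induction j)
      case 0
      then show ?case
        using that(1) by (simp add: maximal_interval_def)
    next
      case (Suc j)
      then show ?case
        using refine [OF Suc] by (simp add: mult.left_commute)
    qed
    then have "P (p div 2) (q - 1)"
      by (simp add: p q)
    then show False
      using that(2) by (simp add: maximal_interval_def q)
  qed
  have "k = q"
    using less [OF assms(2,3,4)] less [OF assms(3,2) assms(4) [symmetric]]
    by (metis linorder_neqE_nat)
  then show ?thesis
    using assms(4) by simp
qed

text \<open>Both lists begin at \<open>a\<close>, so their first intervals agree and the remaining lists begin at a
  common point again.\<close>

lemma maximal_tiling_unique:
  assumes refine: "\<And>m k. P m k \<Longrightarrow> P (2 * m) (Suc k)"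
    and "tiling a L b" "tiling a M b" "\<forall>I\<in>set L. maximal_interval P I"
    "\<forall>I\<in>set M. maximal_interval P I"
  shows "L = M"
  using assms(2-)
proof (induction L arbitrary: a M)
  case Nil
  show ?case
  proof (cases M)
    case (Cons I M')
    obtain m k where I: "I = (m, k)"
      by fastforce
    have "real (Suc m) / 2 ^ k \<le> real m / 2 ^ k"
      using Nil.prems Cons I tiling_le by auto
    then show ?thesis
      by (simp add: divide_le_cancel)
  qed simp
next
  case (Cons I L)
  obtain m k where I: "I = (m, k)"
    by fastforce
  show ?case
  proof (cases M)
    case Nil
    have "real (Suc m) / 2 ^ k \<le> real m / 2 ^ k"
      using Cons.prems Nil I tiling_le by auto
    then show ?thesis
      by (simp add: divide_le_cancel)
  next
    case M: (Cons J M')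
    obtain p q where J: "J = (p, q)"
      by fastforce
    have "(m, k) = (p, q)"
      using Cons.prems M I J by (intro maximal_intervals_same_start [where P = P, OF refine]) auto
    then show ?thesis
      using Cons.IH [of "real (Suc m) / 2 ^ k" M'] Cons.prems M I J by auto
  qed
qed

lemma tiling_image:
  assumes "tiling a L b" "list_all2 (maps_dyadic h) L M"
  shows "tiling (h a) M (h b)"
  using assms
proof (induction L arbitrary: a M)
  case (Cons I L)
  obtain m k where I: "I = (m, k)"
    by fastforce
  obtain m' k' M' where M: "M = (m', k') # M'" "maps_dyadic h (m, k) (m', k')"
    "list_all2 (maps_dyadic h) L M'"
    using Cons.prems(2) I by (auto simp: list_all2_Cons1)
  show ?case
    using Cons.IH [of "real (Suc m) / 2 ^ k" M'] Cons.prems(1) I M maps_dyadic_ends [OF M(2)] by auto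
qed simp

section \<open>The reduced diagram of a homeomorphism\<close>

text \<open>A node is the composition of its cell with the sum of its subtrees.\<close>

lemma tree_diagram_in_diagrams:
  assumes "wf_tree t"
  shows "tree_diagram t \<in> diagrams"
  using assms
proof (induction t)
  case (Leaf e)
  have "tree_diagram (Leaf e) = edge_diagram e"
    by (simp add: tree_diagram_def edge_diagram_def)
  then show ?case
    using Leaf diagrams.one by simp
next
  case (Node e l r)
  let ?f = "top_edge l" and ?g = "top_edge r"
  have wf: "wf_tree l" "wf_tree r" "source ?f = source e" "target ?f = source ?g"
    "target ?g = target e" "tree_vertices l \<inter> tree_vertices r = {target ?f}"
    "tree_edges l \<inter> tree_edges r = {}" "e \<notin> tree_edges l" "e \<notin> tree_edges r"
    using Node.prems by auto
  have "source e \<noteq> target e" "source e \<noteq> target ?f" "target ?f \<noteq> target e"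
    using top_edge_source_neq_target [OF Node.prems] top_edge_source_neq_target [OF wf(1)]
      top_edge_source_neq_target [OF wf(2)] wf(3-5) by auto
  then have "cell_diagram e ?f ?g \<in> diagrams"
    using wf(3-5) by (intro diagrams.cell) auto
  moreover have "summable_diagrams (tree_diagram l) (tree_diagram r)"
    using wf(4,6,7) by (simp add: summable_diagrams_def terminal_vertex_def initial_vertex_def
        tree_diagram_def)
  then have "diagram_sum (tree_diagram l) (tree_diagram r) \<in> diagrams"
    using Node.IH wf(1,2) by (intro diagrams.sum)
  moreover have "composable_diagrams (cell_diagram e ?f ?g)
      (diagram_sum (tree_diagram l) (tree_diagram r))"
  proof -
    have "{source e, target ?f, target e} \<inter> (tree_vertices l \<union> tree_vertices r) =
        path_vertices [?f, ?g]"
      using top_edge_ends_in_tree_vertices [OF wf(1)] top_edge_ends_in_tree_vertices [OF wf(2)]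
        wf(3-5) by (auto simp: path_vertices_def)
    moreover have "{e, ?f, ?g} \<inter> (tree_edges l \<union> tree_edges r) = {?f, ?g}"
      using wf(8,9) by auto
    ultimately show ?thesis
      by (simp add: composable_diagrams_def cell_diagram_def diagram_sum_def tree_diagram_def)
  qed
  moreover have "diagram_comp (cell_diagram e ?f ?g) (diagram_sum (tree_diagram l) (tree_diagram r)) =
      tree_diagram (Node e l r)"
    using top_edge_ends_in_tree_vertices [OF wf(1)] top_edge_ends_in_tree_vertices [OF wf(2)] wf(3-5)
    by (auto simp: diagram_comp_def cell_diagram_def diagram_sum_def tree_diagram_def)
  ultimately show ?case
    using diagrams.comp by metis
qed

lemma cas_append:
  "pre_digraph.cas G u p v \<Longrightarrow> pre_digraph.cas G v q w \<Longrightarrow> pre_digraph.cas G u (p @ q) w"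
  by (induction p arbitrary: u) (auto simp: pre_digraph.cas.simps)

lemma leaves_cas:
  assumes "wf_tree t"
  shows "pre_digraph.cas (diagram_digraph \<Delta>) (source (top_edge t)) (leaves t) (target (top_edge t))"
  using assms
proof (induction t)
  case (Leaf e)
  then show ?case
    by (simp add: pre_digraph.cas.simps diagram_digraph_def)
next
  case (Node e l r)
  then have wf: "wf_tree l" "wf_tree r" "source (top_edge l) = source e"
    "target (top_edge l) = source (top_edge r)" "target (top_edge r) = target e"
    by auto
  have "pre_digraph.cas (diagram_digraph \<Delta>) (source (top_edge l)) (leaves l) (target (top_edge l))"
    "pre_digraph.cas (diagram_digraph \<Delta>) (target (top_edge l)) (leaves r) (target (top_edge r))"
    using Node.IH wf by simp_all
  then have "pre_digraph.cas (diagram_digraph \<Delta>) (source (top_edge l)) (leaves l @ leaves r)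
      (target (top_edge r))"
    by (rule cas_append)
  then show ?case
    using wf by simp
qed

lemma increasing_walk_length:
  assumes "pre_digraph.cas (diagram_digraph \<Delta>) u p v" "\<And>e. e \<in> set p \<Longrightarrow> source e < target e"
  shows "u + length p \<le> v"
  using assms
proof (induction p arbitrary: u)
  case (Cons e p)
  have "target e + length p \<le> v"
    using Cons by (simp add: pre_digraph.cas.simps diagram_digraph_def)
  moreover have "source e = u"
    using Cons.prems(1) by (simp add: pre_digraph.cas.simps diagram_digraph_def)
  moreover have "source e < target e"
    using Cons.prems(2) by simp
  ultimately show ?case
    by simp
qed (simp add: pre_digraph.cas.simps)

text \<open>Every edge increases the numbers of the vertices, which run from 0 to the number of leaves. So no
  positive path is longer than the path of the leaves.\<close>

lemma cut_numbered_pair_diagram: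
  assumes "numbered_tree c 0 T" "numbered_tree c' 0 U" "tree_pair T U"
  shows "cut_diagram (pair_diagram T U) (tree_diagram T) (diagram_inv (tree_diagram U))"
proof -
  have wf: "wf_tree T" "wf_tree U" "leaves T = leaves U"
    "tree_edges T \<inter> tree_edges U = set (leaves T)"
    using assms(3) by (auto simp: tree_pair_def)
  let ?D = "pair_diagram T U" and ?n = "length (leaves T)"
  have ends: "source (top_edge T) = 0" "target (top_edge T) = ?n"
    using assms(1) by (auto simp: numbered_tree_def)
  have "composable_diagrams (tree_diagram T) (diagram_inv (tree_diagram U))"
    using wf(3,4) tree_vertices_leaves [of T] tree_vertices_leaves [of U]
    by (simp add: composable_diagrams_def tree_diagram_def diagram_inv_def)
  moreover have "longest_positive_path ?D (leaves T)"
  proof -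
    have inc: "source e < target e" if "e \<in> edges ?D" for e
      using that assms(1,2) inner_vertices_pair_diagram(5) [OF assms(3)]
      by (auto simp: numbered_tree_def)
    have "length q \<le> ?n" if "pre_digraph.awalk (diagram_digraph ?D) 0 q ?n" for q
      using increasing_walk_length [of ?D 0 q ?n] that inc
      by (auto simp: pre_digraph.awalk_def diagram_digraph_def)
    moreover have "pre_digraph.awalk (diagram_digraph ?D) 0 (leaves T) ?n"
      using leaves_cas [OF wf(1), of ?D] ends leaves_subset_tree_edges [of T]
        top_edge_ends_in_tree_vertices(1) [OF wf(1)]
      by (auto simp: pre_digraph.awalk_def inner_vertices_pair_diagram [OF assms(3)]
          diagram_digraph_def)
    ultimately show ?thesis
      unfolding longest_positive_path_def inner_vertices_pair_diagram(2,3) [OF assms(3)] ends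
      by blast
  qed
  moreover have "positive_cell x" if "x \<in> tree_cells t" for x t
    using that tree_cells_edges [of "fst x" "snd x" t] unfolding positive_cell_def
    by (metis prod.collapse)
  then have "positive_cell x" if "x \<in> cells (tree_diagram T)" for x
    using that by (simp add: tree_diagram_def)
  moreover have "negative_cell x" if x: "x \<in> cells (diagram_inv (tree_diagram U))" for x
  proof -
    have "prod.swap x \<in> tree_cells U"
      using x by (auto simp: tree_diagram_def diagram_inv_def)
    then obtain e f g where "snd x = [e]" "fst x = [f, g]"
      using tree_cells_edges [of "snd x" "fst x" U] by (metis prod.swap_def)
    then show ?thesis
      unfolding negative_cell_def by (metis prod.collapse)
  qed
  ultimately show ?thesis
    using tree_diagram_in_diagrams [OF wf(1)] tree_diagram_in_diagrams [OF wf(2)] diagrams.inv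
    unfolding cut_diagram_def pair_diagram_def by (simp add: tree_diagram_def)
qed

lemma represents_numbered_pair_diagram:
  assumes "numbered_tree c 0 T" "numbered_tree c' 0 U" "tree_pair T U"
    and "\<forall>x. x \<notin> {0..1} \<longrightarrow> h x = x"
    and "list_all2 (maps_dyadic h) (leaf_intervals T 0 0) (leaf_intervals U 0 0)"
  shows "represents (pair_diagram T U) h"
proof -
  have "\<exists>a b c d. edge_interval (tree_diagram T) e a b \<and>
      edge_interval (diagram_inv (diagram_inv (tree_diagram U))) e c d \<and>
      (\<forall>x\<in>{a..b}. h x = c + (d - c) / (b - a) * (x - a))"
    if e: "e \<in> set (bot_path (tree_diagram T))" for e
  proof -
    obtain j where j: "j < length (leaves T)" "e = leaves T ! j"
      using e by (auto simp: tree_diagram_def in_set_conv_nth)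
    obtain m k m' k' where mk: "leaf_intervals T 0 0 ! j = (m, k)"
      "leaf_intervals U 0 0 ! j = (m', k')"
      by fastforce
    have eq: "leaves T = leaves U"
      using assms(3) by (simp add: tree_pair_def)
    have "edge_interval (tree_diagram T) e (real m / 2 ^ k) (real (Suc m) / 2 ^ k)"
      using leaf_intervals_in_nodes [OF j(1), of 0 0] mk(1) j(2) nodes_edge_interval by metis
    moreover have "edge_interval (tree_diagram U) e (real m' / 2 ^ k') (real (Suc m') / 2 ^ k')"
      using leaf_intervals_in_nodes [of j U 0 0] mk(2) j eq nodes_edge_interval by metis
    moreover have "maps_dyadic h (m, k) (m', k')"
      using list_all2_nthD [OF assms(5), of j] mk j(1) by simp
    moreover have "(real (Suc m') / 2 ^ k' - real m' / 2 ^ k') / (real (Suc m) / 2 ^ k - real m / 2 ^ k) =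
        2 ^ k / 2 ^ k'"
      by (simp add: diff_divide_distrib [symmetric])
    ultimately show ?thesis
      unfolding diagram_inv_inv maps_dyadic_def prod.case by metis
  qed
  then show ?thesis
    unfolding represents_def using assms(4) cut_numbered_pair_diagram [OF assms(1-3)] by blast
qed

lemma parent_not_leaf:
  assumes "wf_tree t" "([e], [f, g]) \<in> tree_cells t"
  shows "e \<notin> set (leaves t)"
  using assms
proof (induction t)
  case (Node a l r)
  have wf: "wf_tree l" "wf_tree r" "tree_edges l \<inter> tree_edges r = {}"
    "a \<notin> tree_edges l" "a \<notin> tree_edges r"
    using Node.prems(1) by auto
  note sub = leaves_subset_tree_edges [of l] leaves_subset_tree_edges [of r]
  consider (a) "e = a" | (l) "([e], [f, g]) \<in> tree_cells l" "e \<in> tree_edges l"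
    | (r) "([e], [f, g]) \<in> tree_cells r" "e \<in> tree_edges r"
    using Node.prems(2) by (auto elim: tree_cells_edges)
  then show ?case
  proof cases
    case a
    then show ?thesis using wf(4,5) sub by auto
  next
    case l
    then have "e \<notin> set (leaves l)" "e \<notin> tree_edges r"
      using Node.IH(1) wf by blast+
    then show ?thesis using sub by auto
  next
    case r
    then have "e \<notin> set (leaves r)" "e \<notin> tree_edges l"
      using Node.IH(2) wf by blast+
    then show ?thesis using sub by auto
  qed
qed simp

text \<open>A dipole of the second kind would need an edge that is inner in both trees, whereas only leaves
  are shared. In a dipole of the first kind the two shared edges are leaves and siblings in both
  trees, and \<open>h\<close> maps the halves of one parent interval affinely onto the halves of the other.\<close>

lemma pair_diagram_reduced:
  assumes "tree_pair T U"
    and "list_all2 (maps_dyadic h) (leaf_intervals T 0 0) (leaf_intervals U 0 0)"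
    and inner: "\<And>e m k J. (e, m, k) \<in> nodes T 0 0 \<Longrightarrow> e \<notin> set (leaves T) \<Longrightarrow>
      \<not> maps_dyadic h (m, k) J"
  shows "\<not> has_dipole (pair_diagram T U)"
proof
  have wf: "wf_tree T" "wf_tree U" "leaves T = leaves U"
    "tree_edges T \<inter> tree_edges U = set (leaves T)"
    using assms(1) by (auto simp: tree_pair_def)
  have cells: "cells (pair_diagram T U) = tree_cells T \<union> prod.swap ` tree_cells U"
    by (simp add: pair_diagram_def diagram_comp_def diagram_inv_def tree_diagram_def)
  have pos: "([e], [f, g]) \<in> tree_cells T" if "([e], [f, g]) \<in> cells (pair_diagram T U)" for e f g
    using that unfolding cells by (auto elim: tree_cells_edges)
  have neg: "([e], [f, g]) \<in> tree_cells U" if "([f, g], [e]) \<in> cells (pair_diagram T U)" for e f g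
    using that unfolding cells by (auto elim: tree_cells_edges)
  have leaf_map: "maps_dyadic h (m, k) (m', k')"
    if e: "(e, m, k) \<in> nodes T 0 0" "(e, m', k') \<in> nodes U 0 0" for e m k m' k'
  proof -
    have "e \<in> set (leaves T)"
      using e nodes_in_tree_edges wf(4) by blast
    then obtain j where j: "j < length (leaves T)" "e = leaves T ! j"
      by (auto simp: in_set_conv_nth)
    have "leaf_intervals T 0 0 ! j = (m, k)"
      using nodes_functional [OF wf(1) e(1)] leaf_intervals_in_nodes [OF j(1), of 0 0] j(2)
      by (metis prod.collapse)
    moreover have "leaf_intervals U 0 0 ! j = (m', k')"
      using nodes_functional [OF wf(2) e(2)] leaf_intervals_in_nodes [of j U 0 0] j wf(3)
      by (metis prod.collapse)
    ultimately show ?thesis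
      using list_all2_nthD [OF assms(2), of j] j(1) by simp
  qed
  have node: "\<exists>m k. (e, m, k) \<in> nodes t m0 k0" if "e \<in> tree_edges t" for e t m0 k0
    using that
  proof (induction t arbitrary: m0 k0)
    case (Node a l r)
    then show ?case
      unfolding tree_edges.simps nodes.simps insert_iff Un_iff by blast
  qed simp
  \<comment> \<open>The first alternative is a positive cell followed by a negative one.\<close>
  assume "has_dipole (pair_diagram T U)"
  then consider e f g e' where "([e], [f, g]) \<in> cells (pair_diagram T U)"
      "([f, g], [e']) \<in> cells (pair_diagram T U)"
    | f g e f' g' where "([f, g], [e]) \<in> cells (pair_diagram T U)"
      "([e], [f', g']) \<in> cells (pair_diagram T U)"
    unfolding has_dipole_def by blast
  then show False
  proof cases
    case 1
    then have c: "([e], [f, g]) \<in> tree_cells T" "([e'], [f, g]) \<in> tree_cells U"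
      using pos neg by blast+
    have "e \<in> tree_edges T" "e' \<in> tree_edges U"
      using c by (auto elim: tree_cells_edges)
    then obtain m k m' k' where mk: "(e, m, k) \<in> nodes T 0 0" "(e', m', k') \<in> nodes U 0 0"
      using node by blast
    have "maps_dyadic h (2 * m, Suc k) (2 * m', Suc k')"
      "maps_dyadic h (Suc (2 * m), Suc k) (Suc (2 * m'), Suc k')"
      using leaf_map nodes_children [OF wf(1) mk(1) c(1)] nodes_children [OF wf(2) mk(2) c(2)]
      by blast+
    then have "maps_dyadic h (m, k) (m', k')"
      by (rule maps_dyadic_join)
    then show False
      using inner [OF mk(1)] parent_not_leaf [OF wf(1) c(1)] by blast
  next
    case 2
    then have c: "([e], [f, g]) \<in> tree_cells U" "([e], [f', g']) \<in> tree_cells T"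
      using pos neg by blast+
    have "e \<in> tree_edges T" "e \<in> tree_edges U"
      using c by (auto elim: tree_cells_edges)
    then show False
      using parent_not_leaf [OF wf(1) c(2)] wf(4) by blast
  qed
qed

text \<open>If the inverse \<open>g\<close> maps the parent of \<open>(m', k')\<close> affinely onto a dyadic interval, then its image
  is the parent of \<open>(m, k)\<close>, on which \<open>h\<close> is affine; this contradicts the maximality of
  \<open>(m, k)\<close>.\<close>

lemma maximal_interval_image:
  assumes gh: "\<And>x. x \<in> {0..1} \<Longrightarrow> g (h x) = x" and hg: "\<And>y. y \<in> {0..1} \<Longrightarrow> h (g y) = y"
    and h01: "\<And>x. x \<in> {0..1} \<Longrightarrow> h x \<in> {0..1}"
    and max: "maximal_interval (\<lambda>m k. \<exists>J. maps_dyadic h (m, k) J) (m, k)" and m: "m < 2 ^ k"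
    and map: "maps_dyadic h (m, k) (m', k')"
  shows "maximal_interval (\<lambda>m k. \<exists>J. maps_dyadic g (m, k) J) (m', k')"
proof -
  have inv: "maps_dyadic g (m', k') (m, k)"
    by (rule maps_dyadic_inverse [OF map]) (rule gh [OF dyadic_interval_in_unit [OF m]])
  have "real (Suc m) / 2 ^ k \<in> {0..1}"
    by (rule dyadic_interval_in_unit [OF m]) (simp_all add: divide_right_mono)
  then have "real (Suc m') / 2 ^ k' \<le> 1"
    using h01 maps_dyadic_ends(2) [OF map] by (metis atLeastAtMost_iff)
  then have "real (Suc m') \<le> real (2 ^ k')"
    by simp
  then have m': "m' < 2 ^ k'"
    by linarith
  have "\<not> maps_dyadic g (m' div 2, k' - 1) (p, q)" if "k' > 0" for p q
  proof
    assume par: "maps_dyadic g (m' div 2, k' - 1) (p, q)"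
    have "maps_dyadic g (m' div 2 * 2 ^ 1 + m' mod 2, k' - 1 + 1) (p * 2 ^ 1 + m' mod 2, q + 1)"
      by (rule maps_dyadic_refine [OF par]) simp
    moreover have "m' div 2 * 2 ^ 1 + m' mod 2 = m'" "k' - 1 + 1 = k'"
      using that by simp_all
    ultimately have "maps_dyadic g (m', k') (p * 2 + m' mod 2, Suc q)"
      by simp
    from maps_dyadic_functional [OF inv this] have pq: "p = m div 2" "q = k - 1" "k > 0"
      by auto
    have "m' div 2 < 2 ^ (k' - 1)"
      using m' that by (cases k') auto
    then have "maps_dyadic h (p, q) (m' div 2, k' - 1)"
      by (intro maps_dyadic_inverse [OF par] hg dyadic_interval_in_unit [of "m' div 2" "k' - 1"])
    then show False
      using max pq by (auto simp: maximal_interval_def)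
  qed
  then show ?thesis
    using inv by (auto simp: maximal_interval_def)
qed

text \<open>The images of the leaf intervals of \<open>T\<close> form a tiling by maximal intervals of the inverse, and
  so do the leaf intervals of \<open>U\<close>; by uniqueness of such tilings the two lists are equal.\<close>

lemma thompson_homeo_tree_pair:
  assumes "h \<in> thompson_homeos"
  obtains T U where "numbered_tree 1 0 T" "numbered_tree 2 0 U" "tree_pair T U"
    "list_all2 (maps_dyadic h) (leaf_intervals T 0 0) (leaf_intervals U 0 0)"
    "\<And>e m k J. (e, m, k) \<in> nodes T 0 0 \<Longrightarrow> e \<notin> set (leaves T) \<Longrightarrow> \<not> maps_dyadic h (m, k) J"
proof -
  have "\<exists>g. homeomorphism {0..1} {0..1} h g"
    using assms by (simp add: thompson_homeos_def)
  then obtain g where g: "homeomorphism {0..1} {0..1} h g"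
    by blast
  have gh: "\<And>x. x \<in> {0..1} \<Longrightarrow> g (h x) = x" and hg: "\<And>y. y \<in> {0..1} \<Longrightarrow> h (g y) = y"
    using g by (simp_all add: homeomorphism_apply1 homeomorphism_apply2)
  have h01: "\<And>x. x \<in> {0..1} \<Longrightarrow> h x \<in> {0..1}"
    using g unfolding homeomorphism_def by blast
  define P where "P f m k \<longleftrightarrow> (\<exists>J. maps_dyadic f (m, k) J)" for f m k
  obtain K K' where K: "\<forall>k\<ge>K. \<forall>m<2 ^ k. P h m k" "\<forall>k\<ge>K'. \<forall>m<2 ^ k. P g m k"
    using thompson_homeo_maps_deep_intervals(1,2) [OF assms g] unfolding P_def by blast
  have h_ends: "h 0 = 0" "h 1 = 1"
    using thompson_homeo_maps_deep_intervals(3,4) [OF assms g] .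
  define T where "T = maximal_tree (P h) 1 K 0 0 0"
  define U where "U = maximal_tree (P g) 2 K' 0 0 0"
  let ?L = "leaf_intervals T 0 0" and ?M = "leaf_intervals U 0 0"
  have num: "numbered_tree 1 0 T" "numbered_tree 2 0 U"
    unfolding T_def U_def by (rule numbered_maximal_tree)+
  have maxT: "maximal_interval (P h) I" if "I \<in> set ?L" for I
    using that unfolding T_def by (rule maximal_tree_leaf_intervals [OF K(1), rotated 3]) auto
  have maxU: "maximal_interval (P g) I" if "I \<in> set ?M" for I
    using that unfolding U_def by (rule maximal_tree_leaf_intervals [OF K(2), rotated 3]) auto
  define M where "M = map (\<lambda>I. SOME J. maps_dyadic h I J) ?L"
  have map: "maps_dyadic h I (SOME J. maps_dyadic h I J)" if "I \<in> set ?L" for I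
  proof (rule someI_ex)
    show "\<exists>J. maps_dyadic h I J"
      using maxT [OF that] by (simp add: maximal_interval_def P_def)
  qed
  then have LM: "list_all2 (maps_dyadic h) ?L M"
    unfolding M_def by (simp add: list_all2_conv_all_nth)
  have "maximal_interval (P g) J" if J: "J \<in> set M" for J
  proof -
    obtain I where I: "I \<in> set ?L" "maps_dyadic h I J"
      using J map unfolding M_def by auto
    obtain j where j: "j < length (leaves T)" "I = ?L ! j"
      using I(1) by (auto simp: in_set_conv_nth)
    have "fst I < 2 ^ snd I"
      using leaf_intervals_bound [OF j(1)] j(2) by simp
    then show ?thesis
      using maximal_interval_image [OF gh hg h01, of "fst I" "snd I" "fst J" "snd J"]
        maxT [OF I(1)] I(2) unfolding P_def by simp
  qed
  moreover have "tiling 0 M 1"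
    using tiling_image [OF leaf_intervals_tiling_unit LM] h_ends by simp
  moreover have "P g (2 * m) (Suc k)" if gmk: "P g m k" for m k
  proof -
    obtain m' k' where "maps_dyadic g (m, k) (m', k')"
      using gmk unfolding P_def by auto
    then have "maps_dyadic g (m * 2 ^ 1 + 0, k + 1) (m' * 2 ^ 1 + 0, k' + 1)"
      by (rule maps_dyadic_refine) simp
    then show ?thesis
      unfolding P_def by (auto simp: mult.commute)
  qed
  ultimately have "M = ?M"
    using maximal_tiling_unique [of "P g" 0 M 1 ?M] maxU leaf_intervals_tiling_unit by blast
  then have L2: "list_all2 (maps_dyadic h) ?L ?M"
    using LM by simp
  then have "length (leaves T) = length (leaves U)"
    by (auto dest: list_all2_lengthD)
  then have pair: "tree_pair T U"
    using numbered_tree_pair num by blast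
  have "\<not> maps_dyadic h (m, k) J" if "(e, m, k) \<in> nodes T 0 0" "e \<notin> set (leaves T)" for e m k J
    using maximal_tree_inner_intervals that unfolding T_def P_def by blast
  then show thesis
    using that num pair L2 by blast
qed

text \<open>Every dyadic fraction in \<open>[0,1]\<close> lies in the class of its own sum of digits modulo \<open>n\<close>, and the
  sum of digits of its image is determined modulo \<open>n\<close> by the class of the image.\<close>

lemma digit_class_preserved_imp_cong:
  assumes "n \<ge> 1" "\<And>i. i < n \<Longrightarrow> h ` digit_class n i = digit_class n i"
    and "real m / 2 ^ k \<le> 1" "h (real m / 2 ^ k) = real m' / 2 ^ k'"
  shows "[digit_sum m = digit_sum m'] (mod n)"
proof -
  define i where "i = digit_sum m mod n"
  have "real m \<le> real (2 ^ k)"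
    using assms(3) by simp
  then have "m \<le> 2 ^ k"
    by linarith
  then have "real m / 2 ^ k \<in> digit_class n i"
    unfolding digit_class_iff i_def
    by - (rule exI [of _ m], rule exI [of _ k], simp add: cong_def)
  moreover have "i < n"
    using assms(1) by (simp add: i_def)
  ultimately have "real m' / 2 ^ k' \<in> digit_class n i"
    using assms(2,4) by (metis imageI)
  then obtain a l where a: "real m' / 2 ^ k' = real a / 2 ^ l" "[digit_sum a = i] (mod n)"
    by (auto simp: digit_class_iff)
  then have "[digit_sum m' = i] (mod n)"
    using digit_sum_dyadic_cong by metis
  then show ?thesis
    by (simp add: i_def cong_def)
qed

lemma stabilizers_subset_jones_subgroup:
  assumes "n \<ge> 1" "h \<in> thompson_homeos" "\<And>i. i < n \<Longrightarrow> h ` digit_class n i = digit_class n i"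
  shows "h \<in> jones_subgroup n"
proof -
  obtain T U where TU: "numbered_tree 1 0 T" "numbered_tree 2 0 U" "tree_pair T U"
    and map: "list_all2 (maps_dyadic h) (leaf_intervals T 0 0) (leaf_intervals U 0 0)"
    and inner: "\<And>e m k J. (e, m, k) \<in> nodes T 0 0 \<Longrightarrow> e \<notin> set (leaves T) \<Longrightarrow>
      \<not> maps_dyadic h (m, k) J"
    using thompson_homeo_tree_pair [OF assms(2)] by blast
  have id: "\<forall>x. x \<notin> {0..1} \<longrightarrow> h x = x"
    using assms(2) by (simp add: thompson_homeos_def)
  have wf: "wf_tree T" "wf_tree U" "leaves T = leaves U"
    using TU(3) by (auto simp: tree_pair_def)
  let ?D = "pair_diagram T U"
  have rep: "represents ?D h"
    using represents_numbered_pair_diagram [OF TU id map] .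
  have "?D \<in> diagrams"
    using cut_numbered_pair_diagram [OF TU] diagrams.comp unfolding cut_diagram_def by metis
  then have red: "?D \<in> reduced_F_diagrams"
    using pair_diagram_reduced [OF TU(3) map inner]
    by (simp add: reduced_F_diagrams_def pair_diagram_def diagram_comp_def diagram_inv_def
        tree_diagram_def)
  obtain w w' where w: "digit_weight T w" "digit_weight U w'"
    using vertex_digit_sums [OF wf(1), of 0 0] vertex_digit_sums [OF wf(2), of 0 0]
    unfolding digit_weight_def by blast
  have "[w v = w' v] (mod n)" if v: "v \<in> tree_vertices T" "v \<noteq> target (top_edge T)" for v
  proof -
    obtain j where j: "j < length (leaves T)" "v = source (leaves T ! j)"
      using vertex_is_leaf_source [OF wf(1) v] by (auto simp: in_set_conv_nth)
    obtain m k m' k' where mk: "leaf_intervals T 0 0 ! j = (m, k)"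
      "leaf_intervals U 0 0 ! j = (m', k')"
      by fastforce
    have "maps_dyadic h (m, k) (m', k')"
      using list_all2_nthD [OF map, of j] mk j(1) by simp
    then have "h (real m / 2 ^ k) = real m' / 2 ^ k'"
      by (rule maps_dyadic_ends)
    moreover have "m < 2 ^ k"
      using leaf_intervals_bound [OF j(1)] mk(1) by simp
    then have "real m / 2 ^ k \<le> 1"
      by (metis divide_le_eq_1_pos less_imp_le of_nat_le_iff of_nat_numeral of_nat_power
          zero_less_numeral zero_less_power)
    ultimately have "[digit_sum m = digit_sum m'] (mod n)"
      using digit_class_preserved_imp_cong [OF assms(1,3)] by blast
    then show ?thesis
      using leaf_intervals_digit_weight [OF w(1) j(1)] leaf_intervals_digit_weight [OF w(2), of j]
        mk j wf(3) by simp
  qed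
  then have "n_good n ?D"
    using n_good_pair_diagram [OF TU(3) w] by simp
  then show ?thesis
    using red rep by (auto simp: jones_subgroup_def jones_diagrams_def)
qed

theorem theorem5p11:
  fixes n :: nat
  assumes "n \<ge> 1"
  shows "jones_subgroup n = (\<Inter>i<n. stabilizer thompson_F (\<lambda>g S. g ` S) (digit_class n i))"
proof -
  have stab: "h \<in> (\<Inter>i<n. stabilizer thompson_F (\<lambda>g S. g ` S) (digit_class n i)) \<longleftrightarrow>
      h \<in> thompson_homeos \<and> (\<forall>i<n. h ` digit_class n i = digit_class n i)" for h
  proof -
    have "0 \<in> {..<n}"
      using assms by simp
    then show ?thesis
      by (simp add: stabilizer_def thompson_F_def Ball_def) blast
  qed
  show ?thesis
  proof (rule Set.set_eqI)
    fix h
    show "h \<in> jones_subgroup n \<longleftrightarrow>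
        h \<in> (\<Inter>i<n. stabilizer thompson_F (\<lambda>g S. g ` S) (digit_class n i))"
      unfolding stab
      using jones_subgroup_stabilizes [of h n] stabilizers_subset_jones_subgroup [OF assms, of h]
      by metis
  qed
qed

end
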